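(* Let $n\in\mathbb{N}$, $a<b$, $\tau>0$, $A,A_d\in L_\infty^{n\times 3n}[a,b]$, and let $B\in\mathbb{R}^{2n\times 4n}$ be such that the $2n\times 2n$ matrix $BH$ is invertible. Let $\mathcal{T},\mathcal{A}$ be the operators on $\mathrm{Z}:=L_2^n[a,b]\times L_2^n[[0,1]\times[a,b]]$ defined in the context. Suppose there exist constants $\epsilon,\alpha>0$ and a PI operator $\mathcal{P}:\mathrm{Z}\to\mathrm{Z}$ with $\mathcal{P}=\mathcal{P}^*$, $\mathcal{P}\succeq\epsilon^2 I$ and $$\mathcal{A}^*\mathcal{P}\mathcal{T}+\mathcal{T}^*\mathcal{P}\mathcal{A}\preceq-2\alpha\,\mathcal{T}^*\mathcal{P}\mathcal{T},$$ and let $\zeta:=\sqrt{\|\mathcal{P}\|}$ (operator norm on $\mathrm{Z}$). Then every solution $(\mathbf{u},\boldsymbol\phi)$ to the delayed PDE (DPDE) defined by $\{A,A_d,B,\tau\}$ satisfies $$\left\|\begin{bmatrix}\mathbf{u}(t)\\ \boldsymbol\phi(t)\end{bmatrix}\right\|_{\mathrm Z}\le\frac{\zeta}{\epsilon}\left\|\begin{bmatrix}\mathbf{u}(0)\\ \boldsymbol\phi(0)\end{bmatrix}\right\|_{\mathrm Z}e^{-\alpha t}\qquad\text{for all }t\ge0,$$ where $\|(\mathbf{u},\boldsymbol\phi)\|_{\mathrm Z}^2=\|\mathbf{u}\|_{L_2[a,b]}^2+\int_0^1\|\boldsymbol\phi(s,\cdot)\|_{L_2[a,b]}^2ds$.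
   Context: Spaces. $H_2^n[a,b]$ is the set of $\mathbf{u}$ with $\mathbf{u},\mathbf{u}_x,\mathbf{u}_{xx}\in L_2^n[a,b]$. $H_{(1,2)}^n$ is the set of functions $\boldsymbol\phi(s,x)$ on $[0,1]\times[a,b]$ with $\partial_s^{\alpha}\partial_x^{\beta}\boldsymbol\phi\in L_2^n$ for all $0\le\alpha\le1$, $0\le\beta\le2$. Both carry their natural Sobolev norms. Define $$X_B=\{\mathbf{u}\in H_2^n[a,b] : B\,(\mathbf{u}(a),\mathbf{u}(b),\mathbf{u}_x(a),\mathbf{u}_x(b))^T=0\},$$ $$Y_{\mathbf{u}}=\{\boldsymbol\phi\in H_{(1,2)}^n : \boldsymbol\phi(0,\cdot)=\mathbf{u},\ \boldsymbol\phi(s,\cdot)\in X_B\ \forall s\in[0,1]\}.$$ DPDE and solutions. The delayed PDE $\mathbf{u}_t(t,x)=A(x)(\mathbf{u},\mathbf{u}_x,\mathbf{u}_{xx})^T(t,x)+A_d(x)(\mathbf{u},\mathbf{u}_x,\mathbf{u}_{xx})^T(t-\tau,x)$, $\mathbf{u}(t)\in X_B$, is interpreted via $\boldsymbol\phi(t,s)=\mathbf{u}(t-s\tau)$, $s\in[0,1]$, as $$\mathbf{u}_t(t)=A\begin{bmatrix}\mathbf{u}(t)\\ \mathbf{u}_x(t)\\ \mathbf{u}_{xx}(t)\end{bmatrix}+A_d\begin{bmatrix}\boldsymbol\phi(t,1)\\ \boldsymbol\phi_x(t,1)\\ \boldsymbol\phi_{xx}(t,1)\end{bmatrix},\quad \boldsymbol\phi_t(t)=-\tfrac1\tau\boldsymbol\phi_s(t),\quad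 \mathbf{u}(t)\in X_B,\ \boldsymbol\phi(t)\in Y_{\mathbf{u}(t)}.\qquad( * )$$ For $\mathbf{u}_0\in X_B$, $\boldsymbol\phi_0\in Y_{\mathbf{u}_0}$, a solution to the DPDE defined by $\{A,A_d,B,\tau\}$ with initial state $(\mathbf{u}_0,\boldsymbol\phi_0)$ is a pair $(\mathbf{u},\boldsymbol\phi)$ of functions of $t\in[0,\infty)$ that is Fréchet differentiable in $t$ (with respect to the norms of $H_2^n$ and $H_{(1,2)}^n$), has $(\mathbf{u}(0),\boldsymbol\phi(0))=(\mathbf{u}_0,\boldsymbol\phi_0)$, and satisfies $( * )$ for all $t\ge0$. Operators. Let $$H=\begin{bmatrix} I_n & 0\\ I_n & (b-a) I_n\\ 0 & I_n\\ 0 & I_n\end{bmatrix},\quad Q(x,\theta)=\begin{bmatrix} 0\\ (b-\theta) I_n\\ 0\\ I_n\end{bmatrix},\quad K(x)=\begin{bmatrix} I_n & (x-a) I_n\end{bmatrix},$$ $$T_2(x,\theta)=-K(x)(BH)^{-1}BQ(x,\theta),\qquad T_1(x,\theta)=(x-\theta)I_n+T_2(x,\theta).$$ On $L_2^n[a,b]$ define $$(\mathcal{T}_1\mathbf{v})(x)=\int_a^xT_1(x,\theta)\mathbf{v}(\theta)d\theta+\int_x^bT_2(x,\theta)\mathbf{v}(\theta)d\theta,$$ $$(\mathcal{A}_{11}\mathbf{v})(x)=A_0(x)\mathbf{v}(x)+\int_a^xA_1(x,\theta)\mathbf{v}(\theta)d\theta+\int_x^bA_2(x,\theta)\mathbf{v}(\theta)d\theta,$$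 where $A_0(x)=A(x)\begin{bmatrix} 0\\ 0\\ I_n\end{bmatrix}$ and $A_j(x,\theta)=A(x)\begin{bmatrix}T_j(x,\theta)\\ \partial_xT_j(x,\theta)\\ 0\end{bmatrix}$, $j=1,2$. Let $\mathcal{A}_{11,d}$ be defined exactly as $\mathcal{A}_{11}$ with $A_d(x)$ in place of $A(x)$. For $\hat{\mathbf{v}}\in L_2^n[[0,1]\times[a,b]]$ let $$(\mathcal{T}_2\hat{\mathbf{v}})(s)=\int_0^s\mathcal{T}_1\hat{\mathbf{v}}(\theta)d\theta,\quad \mathcal{A}_{12}\hat{\mathbf{v}}=\int_0^1\mathcal{A}_{11,d}\hat{\mathbf{v}}(s)ds,\quad(\mathcal{A}_{22}\hat{\mathbf{v}})(s)=-\tfrac1\tau\mathcal{T}_1\hat{\mathbf{v}}(s).$$ Finally $$\mathcal{T}=\begin{bmatrix}\mathcal{T}_1&0\\ \mathcal{T}_1&\mathcal{T}_2\end{bmatrix},\qquad\mathcal{A}=\begin{bmatrix}\mathcal{A}_{11}+\mathcal{A}_{11,d}&\mathcal{A}_{12}\\ 0&\mathcal{A}_{22}\end{bmatrix},$$ where in the lower-left block $\mathcal{T}_1\mathbf{v}$ is viewed as a function on $[0,1]\times[a,b]$ constant in $s$. PI operators on $\mathrm{Z}$. A 3-PI operator on $L_2^n[a,b]$ is $(\mathcal{R}\mathbf{u})(x)=R_0(x)\mathbf{u}(x)+\int_a^xR_1(x,\theta)\mathbf{u}(\theta)d\theta+\int_x^bR_2(x,\theta)\mathbf{u}(\theta)d\theta$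 with $R_0\in L_\infty^{n\times n}$, $R_1,R_2\in L_2^{n\times n}[[a,b]^2]$; its size is $\|R_0\|_{L_\infty}+\|R_1\|_{L_2}+\|R_2\|_{L_2}$. A PI operator $\mathcal{P}:\mathrm{Z}\to\mathrm{Z}$ is an operator of the form $$\mathcal{P}\begin{bmatrix}\mathbf{u}_1\\ \mathbf{u}_2\end{bmatrix}(s)=\begin{bmatrix}\mathcal{R}_{11}\mathbf{u}_1+\int_0^1\mathcal{R}_{12}(\nu)\mathbf{u}_2(\nu)d\nu\\ \mathcal{R}_{21}(s)\mathbf{u}_1+\mathcal{N}_0(s)\mathbf{u}_2(s)+\int_0^s\mathcal{N}_1(s,\nu)\mathbf{u}_2(\nu)d\nu+\int_s^1\mathcal{N}_2(s,\nu)\mathbf{u}_2(\nu)d\nu\end{bmatrix},$$ where $\mathcal{R}_{11}$, $\mathcal{R}_{12}(\nu)$, $\mathcal{R}_{21}(s)$, $\mathcal{N}_0(s)$, $\mathcal{N}_1(s,\nu)$, $\mathcal{N}_2(s,\nu)$ are 3-PI operators in $x$ whose parameters are jointly measurable in all variables and whose size is essentially bounded in $s,\nu$. Adjoints and $\succeq,\preceq$ are with respect to the $L_2$ inner product on $\mathrm{Z}$. *)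

theory Defs
  imports "HOL-Analysis.Analysis"
begin

section \<open>Block vectors and block matrices\<close>

text \<open>
  Sizes \<open>2n\<close>, \<open>3n\<close>, \<open>4n\<close> are index types \<open>'n + 'n\<close>, \<open>'n + 'n + 'n\<close>, \<open>'n + 'n + 'n + 'n\<close>.
  The element type is arbitrary, so \<open>\<oplus>\<close> stacks vectors (element type \<^typ>\<open>real\<close>) and also
  matrices on top of each other (elements are rows).  \<open>x \<parallel> y\<close> puts matrices side by side.
\<close>

definition vstack :: "'e ^ 'p \<Rightarrow> 'e ^ 'q \<Rightarrow> 'e ^ ('p::finite + 'q::finite)" (infixr \<open>\<oplus>\<close> 65)
  where "x \<oplus> y = (\<chi> i. case i of Inl j \<Rightarrow> x $ j | Inr j \<Rightarrow> y $ j)"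

definition hstack :: "'e ^ 'p ^ 'm \<Rightarrow> 'e ^ 'q ^ 'm \<Rightarrow> 'e ^ ('p::finite + 'q::finite) ^ 'm::finite"
    (infixr \<open>\<parallel>\<close> 67)
  where "M \<parallel> N = (\<chi> i. M $ i \<oplus> N $ i)"


section \<open>Lebesgue spaces\<close>

text \<open>
  Elements of \<open>L\<^sub>2(S)\<close> and \<open>L\<^sub>\<infinity>(S)\<close> are classes modulo null sets; they are represented here by
  functions that are Borel measurable on \<open>S\<close> (every class contains one) and whose values off \<open>S\<close>
  are irrelevant.  On matrices, \<^const>\<open>norm\<close> is the Frobenius norm.
\<close>

definition L2_space :: "'d::euclidean_space set \<Rightarrow> ('d \<Rightarrow> 'e::euclidean_space) set"
  where "L2_space S = {f. set_borel_measurable lborel S f \<and>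
                          set_integrable lborel S (\<lambda>x. (norm (f x))\<^sup>2)}"

definition L2_norm :: "'d::euclidean_space set \<Rightarrow> ('d \<Rightarrow> 'e::euclidean_space) \<Rightarrow> real"
  where "L2_norm S f = sqrt (LINT x:S|lborel. (norm (f x))\<^sup>2)"

definition L2_inner ::
    "'d::euclidean_space set \<Rightarrow> ('d \<Rightarrow> 'e::euclidean_space) \<Rightarrow> ('d \<Rightarrow> 'e) \<Rightarrow> real"
  where "L2_inner S f g = (LINT x:S|lborel. f x \<bullet> g x)"

definition Linf_space :: "'d::euclidean_space set \<Rightarrow> ('d \<Rightarrow> 'e::euclidean_space) set"
  where "Linf_space S = {f. set_borel_measurable lborel S f \<and>
                            (\<exists>C. AE x\<in>S in lborel. norm (f x) \<le> C)}"

definition Linf_norm :: "'d::euclidean_space set \<Rightarrow> ('d \<Rightarrow> 'e::euclidean_space) \<Rightarrow> real"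
  where "Linf_norm S f = Inf {C. 0 \<le> C \<and> (AE x\<in>S in lborel. norm (f x) \<le> C)}"


section \<open>Weak derivatives and Sobolev spaces\<close>

definition partial_deriv :: "'d::euclidean_space \<Rightarrow> ('d \<Rightarrow> real) \<Rightarrow> 'd \<Rightarrow> real"
  where "partial_deriv i f x = frechet_derivative f (at x) i"

primrec C_k :: "nat \<Rightarrow> ('d::euclidean_space \<Rightarrow> real) \<Rightarrow> bool" where
  "C_k 0 f \<longleftrightarrow> continuous_on UNIV f"
| "C_k (Suc k) f \<longleftrightarrow> (\<forall>x. f differentiable at x) \<and> (\<forall>i\<in>Basis. C_k k (partial_deriv i f))"

definition test_function :: "'d::euclidean_space set \<Rightarrow> ('d \<Rightarrow> real) \<Rightarrow> bool"
  where "test_function \<Omega> \<psi> \<longleftrightarrow> (\<forall>k. C_k k \<psi>) \<and>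
           compact (closure {x. \<psi> x \<noteq> 0}) \<and> closure {x. \<psi> x \<noteq> 0} \<subseteq> \<Omega>"

text \<open>
  \<open>is\<close> lists the coordinate directions of the derivative, e.g. \<open>[(1,0), (0,1), (0,1)]\<close> for
  \<open>\<partial>\<^sub>s \<partial>\<^sub>x\<^sup>2\<close>; the empty list is the derivative of order zero.
\<close>

definition is_weak_deriv :: "'d::euclidean_space set \<Rightarrow> 'd list \<Rightarrow>
    ('d \<Rightarrow> 'e::euclidean_space) \<Rightarrow> ('d \<Rightarrow> 'e) \<Rightarrow> bool"
  where "is_weak_deriv S is f g \<longleftrightarrow> (\<forall>\<psi>. test_function (interior S) \<psi> \<longrightarrow>
           (LINT x:S|lborel. foldr partial_deriv is \<psi> x *\<^sub>R f x) =
           (-1) ^ length is *\<^sub>R (LINT x:S|lborel. \<psi> x *\<^sub>R g x))"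

text \<open>The weak derivative in \<open>L\<^sub>2(S)\<close>, determined up to null sets if it exists.\<close>

definition weak_deriv :: "'d::euclidean_space set \<Rightarrow> 'd list \<Rightarrow>
    ('d \<Rightarrow> 'e::euclidean_space) \<Rightarrow> 'd \<Rightarrow> 'e"
  where "weak_deriv S is f = (SOME g. g \<in> L2_space S \<and> is_weak_deriv S is f g)"

text \<open>
  Functions in \<open>H\<^sub>2\<close> and in \<open>H\<^sub>(\<^sub>1\<^sub>,\<^sub>2\<^sub>)\<close> have a (unique) continuous representative.  It is the
  one used here, so that the point values \<open>u(a)\<close> and \<open>\<phi>(s, \<cdot>)\<close> are meaningful.
\<close>

definition H2_space :: "real \<Rightarrow> real \<Rightarrow> (real \<Rightarrow> real ^ 'n) set"
  where "H2_space a b = {u. continuous_on {a..b} u \<and>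
           (\<forall>k\<le>2. \<exists>g \<in> L2_space {a..b}. is_weak_deriv {a..b} (replicate k 1) u g)}"

definition H2_norm :: "real \<Rightarrow> real \<Rightarrow> (real \<Rightarrow> real ^ 'n) \<Rightarrow> real"
  where "H2_norm a b u =
           sqrt (\<Sum>k\<le>2. (L2_norm {a..b} (weak_deriv {a..b} (replicate k 1) u))\<^sup>2)"

abbreviation rect :: "real \<Rightarrow> real \<Rightarrow> (real \<times> real) set"
  where "rect a b \<equiv> {0..1} \<times> {a..b}"

definition H12_space :: "real \<Rightarrow> real \<Rightarrow> (real \<times> real \<Rightarrow> real ^ 'n) set"
  where "H12_space a b = {\<phi>. continuous_on (rect a b) \<phi> \<and>
           (\<forall>i\<le>1. \<forall>j\<le>2. \<exists>g \<in> L2_space (rect a b).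
              is_weak_deriv (rect a b) (replicate i (1, 0) @ replicate j (0, 1)) \<phi> g)}"

definition H12_norm :: "real \<Rightarrow> real \<Rightarrow> (real \<times> real \<Rightarrow> real ^ 'n) \<Rightarrow> real"
  where "H12_norm a b \<phi> = sqrt (\<Sum>i\<le>1. \<Sum>j\<le>2. (L2_norm (rect a b)
           (weak_deriv (rect a b) (replicate i (1, 0) @ replicate j (0, 1)) \<phi>))\<^sup>2)"

text \<open>The boundary values of \<open>u\<^sub>x\<close> are those of its continuous representative \<open>ux\<close>.\<close>

definition X_space ::
    "real \<Rightarrow> real \<Rightarrow> real ^ ('n + 'n + 'n + 'n) ^ ('n + 'n) \<Rightarrow> (real \<Rightarrow> real ^ 'n::finite) set"
  where "X_space a b B = {u \<in> H2_space a b. \<exists>ux. continuous_on {a..b} ux \<and>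
           is_weak_deriv {a..b} [1] u ux \<and> B *v (u a \<oplus> u b \<oplus> ux a \<oplus> ux b) = 0}"

definition Y_space ::
    "real \<Rightarrow> real \<Rightarrow> real ^ ('n + 'n + 'n + 'n) ^ ('n + 'n) \<Rightarrow> (real \<Rightarrow> real ^ 'n::finite) \<Rightarrow>
     (real \<times> real \<Rightarrow> real ^ 'n) set"
  where "Y_space a b B u = {\<phi> \<in> H12_space a b. (\<forall>x\<in>{a..b}. \<phi> (0, x) = u x) \<and>
           (\<forall>s\<in>{0..1}. (\<lambda>x. \<phi> (s, x)) \<in> X_space a b B)}"


section \<open>The delayed PDE\<close>

text \<open>
  Frechet differentiability of a curve of functions on \<open>[0, \<infinity>)\<close> with respect to the norm \<open>N\<close>;
  one-sided at \<open>t = 0\<close>.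
\<close>

definition has_time_deriv :: "(('d \<Rightarrow> 'e::real_vector) \<Rightarrow> real) \<Rightarrow>
    (real \<Rightarrow> 'd \<Rightarrow> 'e) \<Rightarrow> ('d \<Rightarrow> 'e) \<Rightarrow> real \<Rightarrow> bool"
  where "has_time_deriv N f f' t \<longleftrightarrow>
    ((\<lambda>r. N (\<lambda>x. f r x - f t x - (r - t) *\<^sub>R f' x) / \<bar>r - t\<bar>) \<longlongrightarrow> 0) (at t within {0..})"

definition jet :: "real \<Rightarrow> real \<Rightarrow> (real \<Rightarrow> real ^ 'n::finite) \<Rightarrow> real \<Rightarrow> real ^ ('n + 'n + 'n)"
  where "jet a b u x = u x \<oplus> weak_deriv {a..b} [1] u x \<oplus> weak_deriv {a..b} [1, 1] u x"

definition DPDE_solution ::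
    "real \<Rightarrow> real \<Rightarrow> (real \<Rightarrow> real ^ ('n + 'n + 'n) ^ 'n) \<Rightarrow> (real \<Rightarrow> real ^ ('n + 'n + 'n) ^ 'n) \<Rightarrow>
     real ^ ('n + 'n + 'n + 'n) ^ ('n + 'n) \<Rightarrow> real \<Rightarrow>
     (real \<Rightarrow> real ^ 'n::finite) \<Rightarrow> (real \<times> real \<Rightarrow> real ^ 'n) \<Rightarrow>
     (real \<Rightarrow> real \<Rightarrow> real ^ 'n) \<Rightarrow> (real \<Rightarrow> real \<times> real \<Rightarrow> real ^ 'n) \<Rightarrow> bool"
  where "DPDE_solution a b A Ad B \<tau> u0 \<phi>0 u \<phi> \<longleftrightarrow>
    u0 \<in> X_space a b B \<and> \<phi>0 \<in> Y_space a b B u0 \<and>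
    (\<forall>x\<in>{a..b}. u 0 x = u0 x) \<and> (\<forall>z\<in>rect a b. \<phi> 0 z = \<phi>0 z) \<and>
    (\<forall>t\<ge>0. u t \<in> X_space a b B \<and> \<phi> t \<in> Y_space a b B (u t) \<and>
      (\<exists>u' \<phi>'. u' \<in> H2_space a b \<and> has_time_deriv (H2_norm a b) u u' t \<and>
               \<phi>' \<in> H12_space a b \<and> has_time_deriv (H12_norm a b) \<phi> \<phi>' t \<and>
        (AE x\<in>{a..b} in lborel.
           u' x = A x *v jet a b (u t) x + Ad x *v jet a b (\<lambda>y. \<phi> t (1, y)) x) \<and>
        (AE z\<in>rect a b in lborel.
           \<phi>' z = - (1 / \<tau>) *\<^sub>R weak_deriv (rect a b) [(1, 0)] (\<phi> t) z)))"


section \<open>The Hilbert space Z\<close>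

type_synonym 'n Z = "(real \<Rightarrow> real ^ 'n) \<times> (real \<times> real \<Rightarrow> real ^ 'n)"

definition Z_space :: "real \<Rightarrow> real \<Rightarrow> 'n::finite Z set"
  where "Z_space a b = L2_space {a..b} \<times> L2_space (rect a b)"

definition Z_inner :: "real \<Rightarrow> real \<Rightarrow> 'n::finite Z \<Rightarrow> 'n Z \<Rightarrow> real"
  where "Z_inner a b w z = L2_inner {a..b} (fst w) (fst z) + L2_inner (rect a b) (snd w) (snd z)"

definition Z_norm :: "real \<Rightarrow> real \<Rightarrow> 'n::finite Z \<Rightarrow> real"
  where "Z_norm a b w = sqrt ((L2_norm {a..b} (fst w))\<^sup>2 +
           (LINT s:{0..1}|lborel. (L2_norm {a..b} (\<lambda>x. snd w (s, x)))\<^sup>2))"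

definition Z_eq :: "real \<Rightarrow> real \<Rightarrow> 'n::finite Z \<Rightarrow> 'n Z \<Rightarrow> bool"
  where "Z_eq a b w z \<longleftrightarrow> (AE x\<in>{a..b} in lborel. fst w x = fst z x) \<and>
                           (AE y\<in>rect a b in lborel. snd w y = snd z y)"

definition Z_add :: "'n::finite Z \<Rightarrow> 'n Z \<Rightarrow> 'n Z"
  where "Z_add w z = (\<lambda>x. fst w x + fst z x, \<lambda>y. snd w y + snd z y)"

definition Z_scale :: "real \<Rightarrow> 'n::finite Z \<Rightarrow> 'n Z"
  where "Z_scale c w = (\<lambda>x. c *\<^sub>R fst w x, \<lambda>y. c *\<^sub>R snd w y)"

definition Z_opnorm :: "real \<Rightarrow> real \<Rightarrow> ('n::finite Z \<Rightarrow> 'n Z) \<Rightarrow> real"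
  where "Z_opnorm a b F = (SUP w\<in>Z_space a b. Z_norm a b (F w) / Z_norm a b w)"

text \<open>
  The adjoint is determined up to null sets, i.e. uniquely as an operator on classes; accordingly
  \<open>P = P\<^sup>*\<close> is expressed as \<open>is_adjoint a b P P\<close>, and \<open>Z_adjoint\<close> picks a version.
\<close>

definition is_adjoint :: "real \<Rightarrow> real \<Rightarrow> ('n::finite Z \<Rightarrow> 'n Z) \<Rightarrow> ('n Z \<Rightarrow> 'n Z) \<Rightarrow> bool"
  where "is_adjoint a b F G \<longleftrightarrow> F \<in> Z_space a b \<rightarrow> Z_space a b \<and> G \<in> Z_space a b \<rightarrow> Z_space a b \<and>
    (\<forall>w\<in>Z_space a b. \<forall>z\<in>Z_space a b. Z_inner a b (F w) z = Z_inner a b w (G z))"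

definition Z_adjoint :: "real \<Rightarrow> real \<Rightarrow> ('n::finite Z \<Rightarrow> 'n Z) \<Rightarrow> 'n Z \<Rightarrow> 'n Z"
  where "Z_adjoint a b F = (SOME G. is_adjoint a b F G)"

definition op_le :: "real \<Rightarrow> real \<Rightarrow> ('n::finite Z \<Rightarrow> 'n Z) \<Rightarrow> ('n Z \<Rightarrow> 'n Z) \<Rightarrow> bool"
  where "op_le a b F G \<longleftrightarrow>
    (\<forall>w\<in>Z_space a b. Z_inner a b w (F w) \<le> Z_inner a b w (G w))"


section \<open>PI operators\<close>

datatype ('n::finite) pi3 = PI3
  (par0: "real \<Rightarrow> real ^ 'n ^ 'n")
  (par1: "real \<times> real \<Rightarrow> real ^ 'n ^ 'n")
  (par2: "real \<times> real \<Rightarrow> real ^ 'n ^ 'n")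

definition pi3_op :: "real \<Rightarrow> real \<Rightarrow> 'n::finite pi3 \<Rightarrow> (real \<Rightarrow> real ^ 'n) \<Rightarrow> real \<Rightarrow> real ^ 'n"
  where "pi3_op a b R u x = par0 R x *v u x
           + (LINT \<theta>:{a..x}|lborel. par1 R (x, \<theta>) *v u \<theta>)
           + (LINT \<theta>:{x..b}|lborel. par2 R (x, \<theta>) *v u \<theta>)"

definition pi3_valid :: "real \<Rightarrow> real \<Rightarrow> 'n::finite pi3 \<Rightarrow> bool"
  where "pi3_valid a b R \<longleftrightarrow> par0 R \<in> Linf_space {a..b} \<and>
           par1 R \<in> L2_space ({a..b} \<times> {a..b}) \<and> par2 R \<in> L2_space ({a..b} \<times> {a..b})"

definition pi3_size :: "real \<Rightarrow> real \<Rightarrow> 'n::finite pi3 \<Rightarrow> real"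
  where "pi3_size a b R = Linf_norm {a..b} (par0 R) +
           L2_norm ({a..b} \<times> {a..b}) (par1 R) + L2_norm ({a..b} \<times> {a..b}) (par2 R)"

definition pi3_family ::
    "real \<Rightarrow> real \<Rightarrow> 'i::euclidean_space set \<Rightarrow> ('i \<Rightarrow> 'n::finite pi3) \<Rightarrow> bool"
  where "pi3_family a b I R \<longleftrightarrow>
    set_borel_measurable lborel (I \<times> {a..b}) (\<lambda>(i, x). par0 (R i) x) \<and>
    set_borel_measurable lborel (I \<times> ({a..b} \<times> {a..b})) (\<lambda>(i, z). par1 (R i) z) \<and>
    set_borel_measurable lborel (I \<times> ({a..b} \<times> {a..b})) (\<lambda>(i, z). par2 (R i) z) \<and>
    (\<exists>C. AE i\<in>I in lborel. pi3_valid a b (R i) \<and> pi3_size a b (R i) \<le> C)"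

definition PI_form :: "real \<Rightarrow> real \<Rightarrow> 'n::finite pi3 \<Rightarrow> (real \<Rightarrow> 'n pi3) \<Rightarrow> (real \<Rightarrow> 'n pi3) \<Rightarrow>
    (real \<Rightarrow> 'n pi3) \<Rightarrow> (real \<times> real \<Rightarrow> 'n pi3) \<Rightarrow> (real \<times> real \<Rightarrow> 'n pi3) \<Rightarrow> 'n Z \<Rightarrow> 'n Z"
  where "PI_form a b R11 R12 R21 N0 N1 N2 = (\<lambda>(u1, u2).
    (\<lambda>x. pi3_op a b R11 u1 x
         + (LINT \<nu>:{0..1}|lborel. pi3_op a b (R12 \<nu>) (\<lambda>y. u2 (\<nu>, y)) x),
     \<lambda>(s, x). pi3_op a b (R21 s) u1 x
         + pi3_op a b (N0 s) (\<lambda>y. u2 (s, y)) x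
         + (LINT \<nu>:{0..s}|lborel. pi3_op a b (N1 (s, \<nu>)) (\<lambda>y. u2 (\<nu>, y)) x)
         + (LINT \<nu>:{s..1}|lborel. pi3_op a b (N2 (s, \<nu>)) (\<lambda>y. u2 (\<nu>, y)) x)))"

definition PI_operator :: "real \<Rightarrow> real \<Rightarrow> ('n::finite Z \<Rightarrow> 'n Z) \<Rightarrow> bool"
  where "PI_operator a b P \<longleftrightarrow> (\<exists>R11 R12 R21 N0 N1 N2.
    pi3_valid a b R11 \<and>
    pi3_family a b {0..1} R12 \<and> pi3_family a b {0..1} R21 \<and> pi3_family a b {0..1} N0 \<and>
    pi3_family a b ({0..1} \<times> {0..1}) N1 \<and> pi3_family a b ({0..1} \<times> {0..1}) N2 \<and>
    (\<forall>w\<in>Z_space a b. Z_eq a b (P w) (PI_form a b R11 R12 R21 N0 N1 N2 w)))"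


section \<open>The operators of the PIE representation\<close>

text \<open>\<open>mat c\<close> is \<open>c I\<^sub>n\<close>, so \<open>mat 0\<close> is the zero block.\<close>

definition H_mat :: "real \<Rightarrow> real \<Rightarrow> real ^ ('n + 'n) ^ ('n::finite + 'n + 'n + 'n)"
  where "H_mat a b = (mat 1 \<parallel> mat 0) \<oplus> (mat 1 \<parallel> mat (b - a)) \<oplus> (mat 0 \<parallel> mat 1) \<oplus> (mat 0 \<parallel> mat 1)"

definition Q_mat :: "real \<Rightarrow> real \<Rightarrow> real ^ 'n ^ ('n::finite + 'n + 'n + 'n)"
  where "Q_mat b \<theta> = mat 0 \<oplus> mat (b - \<theta>) \<oplus> mat 0 \<oplus> mat 1"

definition K_mat :: "real \<Rightarrow> real \<Rightarrow> real ^ ('n + 'n) ^ 'n::finite"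
  where "K_mat a x = mat 1 \<parallel> mat (x - a)"

definition T2_ker :: "real \<Rightarrow> real \<Rightarrow> real ^ ('n + 'n + 'n + 'n) ^ ('n + 'n) \<Rightarrow>
    real \<times> real \<Rightarrow> real ^ 'n ^ 'n::finite"
  where "T2_ker a b B = (\<lambda>(x, \<theta>).
    - (K_mat a x ** matrix_inv (B ** H_mat a b) ** B ** Q_mat b \<theta>))"

definition T1_ker :: "real \<Rightarrow> real \<Rightarrow> real ^ ('n + 'n + 'n + 'n) ^ ('n + 'n) \<Rightarrow>
    real \<times> real \<Rightarrow> real ^ 'n ^ 'n::finite"
  where "T1_ker a b B = (\<lambda>(x, \<theta>). mat (x - \<theta>) + T2_ker a b B (x, \<theta>))"

definition A_ker :: "(real \<Rightarrow> real ^ ('n + 'n + 'n) ^ 'n) \<Rightarrow> (real \<times> real \<Rightarrow> real ^ 'n ^ 'n) \<Rightarrow>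
    real \<times> real \<Rightarrow> real ^ 'n ^ 'n::finite"
  where "A_ker A T = (\<lambda>(x, \<theta>).
    A x ** (T (x, \<theta>) \<oplus> vector_derivative (\<lambda>y. T (y, \<theta>)) (at x) \<oplus> mat 0))"

definition opT1 :: "real \<Rightarrow> real \<Rightarrow> real ^ ('n + 'n + 'n + 'n) ^ ('n + 'n) \<Rightarrow>
    (real \<Rightarrow> real ^ 'n::finite) \<Rightarrow> real \<Rightarrow> real ^ 'n"
  where "opT1 a b B = pi3_op a b (PI3 (\<lambda>x. 0) (T1_ker a b B) (T2_ker a b B))"

definition opA11 :: "real \<Rightarrow> real \<Rightarrow> real ^ ('n + 'n + 'n + 'n) ^ ('n + 'n) \<Rightarrow>
    (real \<Rightarrow> real ^ ('n + 'n + 'n) ^ 'n) \<Rightarrow> (real \<Rightarrow> real ^ 'n::finite) \<Rightarrow> real \<Rightarrow> real ^ 'n"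
  where "opA11 a b B A = pi3_op a b (PI3 (\<lambda>x. A x ** (mat 0 \<oplus> mat 0 \<oplus> mat 1))
           (A_ker A (T1_ker a b B)) (A_ker A (T2_ker a b B)))"

definition opT2 :: "real \<Rightarrow> real \<Rightarrow> real ^ ('n + 'n + 'n + 'n) ^ ('n + 'n) \<Rightarrow>
    (real \<times> real \<Rightarrow> real ^ 'n::finite) \<Rightarrow> real \<times> real \<Rightarrow> real ^ 'n"
  where "opT2 a b B v = (\<lambda>(s, x). LINT \<theta>:{0..s}|lborel. opT1 a b B (\<lambda>y. v (\<theta>, y)) x)"

definition opA12 :: "real \<Rightarrow> real \<Rightarrow> real ^ ('n + 'n + 'n + 'n) ^ ('n + 'n) \<Rightarrow>
    (real \<Rightarrow> real ^ ('n + 'n + 'n) ^ 'n) \<Rightarrow> (real \<times> real \<Rightarrow> real ^ 'n::finite) \<Rightarrow> real \<Rightarrow> real ^ 'n"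
  where "opA12 a b B Ad v x = (LINT s:{0..1}|lborel. opA11 a b B Ad (\<lambda>y. v (s, y)) x)"

definition opA22 :: "real \<Rightarrow> real \<Rightarrow> real ^ ('n + 'n + 'n + 'n) ^ ('n + 'n) \<Rightarrow> real \<Rightarrow>
    (real \<times> real \<Rightarrow> real ^ 'n::finite) \<Rightarrow> real \<times> real \<Rightarrow> real ^ 'n"
  where "opA22 a b B \<tau> v = (\<lambda>(s, x). - (1 / \<tau>) *\<^sub>R opT1 a b B (\<lambda>y. v (s, y)) x)"

definition opT :: "real \<Rightarrow> real \<Rightarrow> real ^ ('n + 'n + 'n + 'n) ^ ('n + 'n) \<Rightarrow> 'n::finite Z \<Rightarrow> 'n Z"
  where "opT a b B = (\<lambda>(v, v'). (opT1 a b B v, \<lambda>(s, x). opT1 a b B v x + opT2 a b B v' (s, x)))"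

definition opA :: "real \<Rightarrow> real \<Rightarrow> (real \<Rightarrow> real ^ ('n + 'n + 'n) ^ 'n) \<Rightarrow>
    (real \<Rightarrow> real ^ ('n + 'n + 'n) ^ 'n) \<Rightarrow> real ^ ('n + 'n + 'n + 'n) ^ ('n + 'n) \<Rightarrow> real \<Rightarrow>
    'n::finite Z \<Rightarrow> 'n Z"
  where "opA a b A Ad B \<tau> = (\<lambda>(v, v').
    (\<lambda>x. opA11 a b B A v x + opA11 a b B Ad v x + opA12 a b B Ad v' x, opA22 a b B \<tau> v'))"

end

theory Submission
  imports Defs "HOL-Real_Asymp.Real_Asymp"
begin

text \<open>
  Write \<open>U(t) = (u(t), \<phi>(t))\<close> for the state of a solution.  A state that satisfies the boundary
  conditions and \<open>\<phi>(0, \<cdot>) = u\<close> is determined by its derivatives of highest order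
  \<open>w = (u\<^sub>x\<^sub>x, \<partial>\<^sub>s \<partial>\<^sub>x\<^sup>2 \<phi>)\<close>: the operators are made such that \<open>U = \<T> w\<close> and such that the
  right-hand side of the equation is \<open>\<A> w\<close>, so that \<open>U' = \<A> w\<close> (lemma \<open>state_representation\<close>).
  The Lyapunov function \<open>V = \<langle>U, P U\<rangle>\<close> therefore satisfies
  \<open>V' = 2 \<langle>U', P U\<rangle> = 2 \<langle>\<A> w, P \<T> w\<rangle> = \<langle>w, (\<A>\<^sup>* P \<T> + \<T>\<^sup>* P \<A>) w\<rangle> \<le> - 2 \<alpha> \<langle>\<T> w, P \<T> w\<rangle> = - 2 \<alpha> V\<close>,
  hence \<open>V(t) \<le> V(0) e\<^sup>-\<^sup>2\<^sup>\<alpha>\<^sup>t\<close>, and the estimate follows from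
  \<open>\<epsilon>\<^sup>2 \<parallel>U(t)\<parallel>\<^sup>2 \<le> V(t)\<close> and \<open>V(0) \<le> \<parallel>P\<parallel> \<parallel>U(0)\<parallel>\<^sup>2\<close>.

  The representation \<open>U = \<T> w\<close> rests on the fundamental theorem of calculus for weak derivatives
  (\<open>eq_integral_weak_deriv\<close>).  For a single function \<open>u\<close> it gives Taylor's formula at \<open>a\<close>, and the
  boundary condition can be solved for \<open>u(a)\<close> and \<open>u\<^sub>x(a)\<close> because \<open>B H\<close> is invertible
  (\<open>X_space_representation\<close>).  For \<open>\<phi>\<close> it is applied in the variable \<open>s\<close> to the integrals of
  \<open>\<phi>(s, \<cdot>)\<close> against derivatives of a test function in \<open>x\<close> (\<open>slice_weak_deriv\<close>).  This shows that
  \<open>u\<^sub>x\<^sub>x + \<integral>\<^sub>0\<^sup>s \<partial>\<^sub>s \<partial>\<^sub>x\<^sup>2 \<phi>\<close> is the second derivative of \<open>\<phi>(s, \<cdot>)\<close> for every \<open>s\<close>, and as every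
  \<open>\<phi>(s, \<cdot>)\<close> satisfies the boundary conditions, the case of a single function applies to it.

  Two facts of functional analysis are used as well.  The adjoints \<open>\<T>\<^sup>*\<close> and \<open>\<A>\<^sup>*\<close> exist, because
  integral operators are composed of multiplications, averages and constant extensions, whose
  adjoints are explicit (\<open>adj_mult\<close>, \<open>adj_average\<close>, \<open>adj_swap\<close>).  And \<open>P\<close>, being symmetric and
  defined on all of the complete space \<open>Z\<close>, is bounded (\<open>Hellinger_Toeplitz\<close>, \<open>l2_complete\<close>); hence
  its operator norm is finite, and \<open>V\<close> is differentiable along a differentiable curve.
\<close>

section \<open>Symmetric operators on semi-inner product spaces\<close>

text \<open>
  Elements of \<open>L\<^sub>2\<close> are represented by functions, so the inner product is only positive semidefinite
  and vectors can be compared only through their inner products.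
\<close>

locale semi_inner_space =
  fixes V :: "'v set" and add :: "'v \<Rightarrow> 'v \<Rightarrow> 'v" and scale :: "real \<Rightarrow> 'v \<Rightarrow> 'v"
    and ip :: "'v \<Rightarrow> 'v \<Rightarrow> real"
  assumes add_in: "x \<in> V \<Longrightarrow> y \<in> V \<Longrightarrow> add x y \<in> V"
    and scale_in: "x \<in> V \<Longrightarrow> scale c x \<in> V"
    and ip_commute: "x \<in> V \<Longrightarrow> y \<in> V \<Longrightarrow> ip x y = ip y x"
    and ip_add_left: "x \<in> V \<Longrightarrow> y \<in> V \<Longrightarrow> z \<in> V \<Longrightarrow> ip (add x y) z = ip x z + ip y z"
    and ip_scale_left: "x \<in> V \<Longrightarrow> y \<in> V \<Longrightarrow> ip (scale c x) y = c * ip x y"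
    and ip_nonneg: "x \<in> V \<Longrightarrow> 0 \<le> ip x x"
begin

definition nrm :: "'v \<Rightarrow> real"
  where "nrm x = sqrt (ip x x)"

definition sub :: "'v \<Rightarrow> 'v \<Rightarrow> 'v"
  where "sub x y = add x (scale (- 1) y)"

lemma sub_in: "x \<in> V \<Longrightarrow> y \<in> V \<Longrightarrow> sub x y \<in> V"
  by (simp add: sub_def add_in scale_in)

lemma ip_add_right: "x \<in> V \<Longrightarrow> y \<in> V \<Longrightarrow> z \<in> V \<Longrightarrow> ip z (add x y) = ip z x + ip z y"
  by (metis add_in ip_add_left ip_commute)

lemma ip_scale_right: "x \<in> V \<Longrightarrow> y \<in> V \<Longrightarrow> ip y (scale c x) = c * ip y x"
  by (metis scale_in ip_scale_left ip_commute)

lemma ip_sub_left: "x \<in> V \<Longrightarrow> y \<in> V \<Longrightarrow> z \<in> V \<Longrightarrow> ip (sub x y) z = ip x z - ip y z"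
  by (simp add: sub_def ip_add_left ip_scale_left scale_in)

lemma ip_sub_right: "x \<in> V \<Longrightarrow> y \<in> V \<Longrightarrow> z \<in> V \<Longrightarrow> ip z (sub x y) = ip z x - ip z y"
  by (simp add: sub_def ip_add_right ip_scale_right scale_in)

lemma nrm_nonneg: "x \<in> V \<Longrightarrow> 0 \<le> nrm x"
  by (simp add: nrm_def ip_nonneg)

lemma nrm_power2: "x \<in> V \<Longrightarrow> (nrm x)\<^sup>2 = ip x x"
  by (simp add: nrm_def ip_nonneg)

lemma nrm_scale: "x \<in> V \<Longrightarrow> nrm (scale c x) = \<bar>c\<bar> * nrm x"
  by (simp add: nrm_def ip_scale_left ip_scale_right scale_in real_sqrt_mult flip: mult.assoc)

lemma Cauchy_Schwarz:
  assumes x: "x \<in> V" and y: "y \<in> V"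
  shows "\<bar>ip x y\<bar> \<le> nrm x * nrm y"
proof -
  have *: "0 \<le> ip x x + 2 * c * ip x y + c\<^sup>2 * ip y y" for c
  proof -
    have "0 \<le> ip (add x (scale c y)) (add x (scale c y))"
      by (intro ip_nonneg add_in scale_in x y)
    also have "\<dots> = ip x x + 2 * c * ip x y + c\<^sup>2 * ip y y"
      using x y by (simp add: ip_add_left ip_add_right ip_scale_left ip_scale_right add_in scale_in
          ip_commute[of y x] power2_eq_square algebra_simps)
    finally show ?thesis .
  qed
  have "(ip x y)\<^sup>2 \<le> ip x x * ip y y"
  proof (cases "ip y y = 0")
    case True
    have "ip x y = 0"
    proof (rule ccontr)
      assume "ip x y \<noteq> 0"
      then show False
        using *[of "- (ip x x + 1) / (2 * ip x y)"] True by (simp add: field_simps)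
    qed
    then show ?thesis using True by simp
  next
    case False
    then have pos: "ip y y > 0" using ip_nonneg[OF y] by simp
    have "0 \<le> ip x x - (ip x y)\<^sup>2 / ip y y"
      using *[of "- ip x y / ip y y"] pos by (simp add: power2_eq_square field_simps)
    then show ?thesis using pos by (simp add: field_simps)
  qed
  then have "sqrt ((ip x y)\<^sup>2) \<le> sqrt (ip x x * ip y y)"
    by (rule real_sqrt_le_mono)
  then show ?thesis by (simp add: nrm_def real_sqrt_mult)
qed

lemma nrm_triangle:
  assumes x: "x \<in> V" and y: "y \<in> V"
  shows "nrm (add x y) \<le> nrm x + nrm y"
proof (rule power2_le_imp_le)
  have "(nrm (add x y))\<^sup>2 = (nrm x)\<^sup>2 + 2 * ip x y + (nrm y)\<^sup>2"
    using x y by (simp add: nrm_power2 add_in ip_add_left ip_add_right ip_commute[of y x])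
  also have "\<dots> \<le> (nrm x)\<^sup>2 + 2 * (nrm x * nrm y) + (nrm y)\<^sup>2"
    using Cauchy_Schwarz[OF x y] by simp
  finally show "(nrm (add x y))\<^sup>2 \<le> (nrm x + nrm y)\<^sup>2"
    by (simp add: power2_sum)
qed (simp add: nrm_nonneg x y)

text \<open>
  A gliding hump.  If \<open>P\<close> were unbounded, there would be \<open>x\<^sub>n\<close> with \<open>\<parallel>P x\<^sub>n\<parallel> > 4\<^sup>n \<parallel>x\<^sub>n\<parallel>\<close>.  With
  the unit vectors \<open>e\<^sub>n\<close> in the direction of \<open>P x\<^sub>n\<close> and suitable signs, the series \<open>\<Sum> \<plusminus>3\<^sup>-\<^sup>n e\<^sub>n\<close> converges to
  some \<open>y\<close> with \<open>\<bar>\<langle>e\<^sub>n, y\<rangle>\<bar> \<ge> 3\<^sup>-\<^sup>n / 2\<close>.  But by symmetry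
  \<open>\<bar>\<langle>e\<^sub>n, y\<rangle>\<bar> = \<bar>\<langle>x\<^sub>n, P y\<rangle>\<bar> / \<parallel>P x\<^sub>n\<parallel> \<le> 4\<^sup>-\<^sup>n \<parallel>P y\<parallel>\<close>, which is impossible for large \<open>n\<close>.
\<close>

lemma Hellinger_Toeplitz:
  assumes complete: "\<And>S. (\<And>n. S n \<in> V) \<Longrightarrow> (\<And>n. nrm (sub (S (Suc n)) (S n)) \<le> (1/3) ^ n)
      \<Longrightarrow> \<exists>y\<in>V. (\<lambda>n. nrm (sub y (S n))) \<longlonglongrightarrow> 0"
    and P_in: "\<And>x. x \<in> V \<Longrightarrow> P x \<in> V"
    and sym: "\<And>x y. x \<in> V \<Longrightarrow> y \<in> V \<Longrightarrow> ip (P x) y = ip x (P y)"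
  shows "\<exists>C. \<forall>x\<in>V. nrm (P x) \<le> C * nrm x"
proof (rule ccontr)
  assume "\<not> ?thesis"
  then have "\<exists>x\<in>V. nrm (P x) > 4 ^ n * nrm x" for n :: nat
    by (meson not_le)
  then obtain x where x: "\<And>n. x n \<in> V" and big: "\<And>n::nat. nrm (P (x n)) > 4 ^ n * nrm (x n)"
    by metis
  have pos: "nrm (P (x n)) > 0" for n
    using big[of n] nrm_nonneg[OF x[of n]] by (smt (verit) mult_nonneg_nonneg zero_le_power)
  define e where "e n = scale (1 / nrm (P (x n))) (P (x n))" for n
  have e: "e n \<in> V" for n
    by (simp add: e_def scale_in P_in x)
  have nrm_e: "nrm (e n) = 1" for n
    using pos[of n] by (simp add: e_def nrm_scale P_in x)
  \<comment> \<open>The sign is chosen so that the new term does not cancel what \<open>e n\<close> already sees of \<open>S n\<close>.\<close>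
  define S where "S = rec_nat (scale 0 (e 0))
      (\<lambda>n v. add v (scale ((if ip (e n) v \<ge> 0 then 1 else - 1) * (1/3) ^ n) (e n)))"
  have S_Suc: "S (Suc n) = add (S n) (scale ((if ip (e n) (S n) \<ge> 0 then 1 else - 1) * (1/3) ^ n) (e n))" for n
    by (simp add: S_def)
  have S: "S n \<in> V" for n
  proof (induction n)
    case 0 show ?case by (simp add: S_def scale_in e)
  next
    case (Suc n) then show ?case by (simp add: S_Suc add_in scale_in e)
  qed
  have S_big: "\<bar>ip (e n) (S (Suc n))\<bar> \<ge> (1/3) ^ n" for n
  proof -
    have "ip (e n) (e n) = 1" using nrm_power2[OF e, of n] nrm_e[of n] by simp
    moreover have "0 \<le> (1/3 :: real) ^ n" by simp
    ultimately show ?thesis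
      using e[of n] S[of n] by (simp add: S_Suc ip_add_right ip_scale_right scale_in del: zero_le_power)
  qed
  have nrm_S: "nrm (sub (S (Suc n)) (S n)) \<le> (1/3) ^ n" for n
  proof -
    define c where "c = (if ip (e n) (S n) \<ge> 0 then 1 else - 1) * (1/3 :: real) ^ n"
    have "(nrm (sub (S (Suc n)) (S n)))\<^sup>2 = (c * nrm (e n))\<^sup>2"
      using S[of n] e[of n] S[of "Suc n"] unfolding S_Suc c_def[symmetric]
      by (simp add: nrm_power2 sub_in ip_sub_left ip_sub_right ip_add_left ip_add_right add_in scale_in
          ip_scale_left ip_scale_right ip_commute[of "S n" "e n"] power_mult_distrib)
         (simp add: power2_eq_square algebra_simps)
    then have "\<bar>nrm (sub (S (Suc n)) (S n))\<bar> = \<bar>c\<bar>"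
      by (simp add: nrm_e power2_eq_iff abs_eq_iff)
    moreover have "\<bar>c\<bar> = (1/3) ^ n" by (simp add: c_def)
    ultimately show ?thesis by simp
  qed
  obtain y where y: "y \<in> V" and lim: "(\<lambda>n. nrm (sub y (S n))) \<longlonglongrightarrow> 0"
    using complete[OF S nrm_S] by blast
  have tri: "nrm (sub u w) \<le> nrm (sub u v) + nrm (sub v w)" if "u \<in> V" "v \<in> V" "w \<in> V" for u v w
  proof -
    have "nrm (sub u w) = nrm (add (sub u v) (sub v w))"
      using that by (simp add: nrm_def ip_sub_left ip_sub_right ip_add_left ip_add_right sub_in add_in)
    then show ?thesis using nrm_triangle[of "sub u v" "sub v w"] that by (simp add: sub_in)
  qed
  have tail: "nrm (sub (S (n + k)) (S n)) \<le> (3/2) * (1/3) ^ n - (3/2) * (1/3) ^ (n + k)" for n k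
  proof (induction k)
    case 0 show ?case using S[of n] by (simp add: nrm_def ip_sub_left ip_sub_right sub_in)
  next
    case (Suc k)
    show ?case
      using tri[of "S (n + Suc k)" "S (n + k)" "S n"] S nrm_S[of "n + k"] Suc by simp
  qed
  have y_tail: "nrm (sub y (S n)) \<le> (3/2) * (1/3) ^ n" for n
  proof (rule LIMSEQ_le_const)
    show "(\<lambda>k. nrm (sub y (S (n + k))) + (3/2) * (1/3) ^ n) \<longlonglongrightarrow> (3/2) * (1/3) ^ n"
      using tendsto_add[OF LIMSEQ_ignore_initial_segment[OF lim, of n] tendsto_const[of "(3/2) * (1/3 :: real) ^ n"]]
      by (simp add: add.commute)
    show "\<exists>N. \<forall>k\<ge>N. nrm (sub y (S n)) \<le> nrm (sub y (S (n + k))) + (3/2) * (1/3) ^ n"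
    proof (intro exI[of _ 0] allI impI)
      fix k
      show "nrm (sub y (S n)) \<le> nrm (sub y (S (n + k))) + (3/2) * (1/3) ^ n"
      proof -
        have "0 \<le> (1/3 :: real) ^ (n + k)" by simp
        then show ?thesis
          using tri[OF y S[of "n + k"] S[of n]] tail[of n k] by linarith
      qed
    qed
  qed
  have "(4/3) ^ n \<le> 2 * nrm (P y)" for n :: nat
  proof -
    have "\<bar>ip (e n) (sub y (S (Suc n)))\<bar> \<le> (1/2) * (1/3) ^ n"
      using Cauchy_Schwarz[OF e[of n] sub_in[OF y S[of "Suc n"]]] y_tail[of "Suc n"] nrm_e[of n] by simp
    then have "(1/2) * (1/3) ^ n \<le> \<bar>ip (e n) y\<bar>"
      using S_big[of n] ip_sub_right[OF y S[of "Suc n"] e[of n]] by linarith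
    also have "\<dots> = \<bar>ip (x n) (P y)\<bar> / nrm (P (x n))"
      using pos[of n] x[of n] y by (simp add: e_def ip_scale_left P_in sym abs_mult)
    also have "\<dots> \<le> nrm (x n) * nrm (P y) / nrm (P (x n))"
      using pos[of n] Cauchy_Schwarz[OF x[of n] P_in[OF y]] by (simp add: divide_right_mono)
    also have "\<dots> \<le> (1/4) ^ n * nrm (P y)"
    proof -
      have "nrm (x n) \<le> (1/4) ^ n * nrm (P (x n))"
        using big[of n] by (simp add: power_divide field_simps)
      then have "nrm (x n) * nrm (P y) \<le> (1/4) ^ n * nrm (P (x n)) * nrm (P y)"
        by (intro mult_right_mono nrm_nonneg P_in y)
      then show ?thesis using pos[of n] by (simp add: field_simps)
    qed
    finally have "(1/3) ^ n \<le> 2 * ((1/4) ^ n * nrm (P y))" by simp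
    then show ?thesis by (simp add: power_divide field_simps)
  qed
  moreover obtain n :: nat where "2 * nrm (P y) < (4/3) ^ n"
    using real_arch_pow[of "4/3" "2 * nrm (P y)"] by auto
  ultimately show False by (meson not_le)
qed

end


section \<open>Square integrable functions\<close>

text \<open>
  \<open>L\<^sub>2\<close> over an arbitrary measure: for restrictions of Lebesgue measure and their products the
  general theory of integration, in particular Fubini's theorem, applies without side conditions
  on sets.
\<close>

definition l2 :: "'a measure \<Rightarrow> ('a \<Rightarrow> 'e::euclidean_space) set"
  where "l2 M = {f \<in> borel_measurable M. integrable M (\<lambda>x. (norm (f x))\<^sup>2)}"

lemma l2_measurable: "f \<in> l2 M \<Longrightarrow> f \<in> borel_measurable M"
  and l2_integrable_power2: "f \<in> l2 M \<Longrightarrow> integrable M (\<lambda>x. (norm (f x))\<^sup>2)"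
  by (auto simp: l2_def)

lemma l2_boundedI:
  assumes f: "f \<in> borel_measurable M" and g: "integrable M g"
    and le: "AE x in M. (norm (f x))\<^sup>2 \<le> g x"
  shows "f \<in> l2 M"
proof -
  have "integrable M (\<lambda>x. (norm (f x))\<^sup>2)"
    by (rule Bochner_Integration.integrable_bound[OF g])
       (use f le in \<open>auto elim!: eventually_mono\<close>)
  then show ?thesis using f by (simp add: l2_def)
qed

lemma l2_scaleR: "f \<in> l2 M \<Longrightarrow> (\<lambda>x. c *\<^sub>R f x) \<in> l2 M"
  by (auto simp: l2_def power_mult_distrib)

lemma norm_power2_add_le: "(norm (x + y))\<^sup>2 \<le> 2 * (norm x)\<^sup>2 + 2 * (norm y)\<^sup>2"
  for x y :: "'e::real_normed_vector"
proof -
  have "(norm (x + y))\<^sup>2 \<le> (norm x + norm y)\<^sup>2"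
    by (intro power_mono norm_triangle_ineq) simp
  also have "\<dots> \<le> 2 * (norm x)\<^sup>2 + 2 * (norm y)\<^sup>2"
    using sum_squares_ge_zero[of "norm x - norm y" 0] by (simp add: power2_eq_square algebra_simps)
  finally show ?thesis .
qed

lemma l2_add:
  assumes f: "f \<in> l2 M" and g: "g \<in> l2 M"
  shows "(\<lambda>x. f x + g x) \<in> l2 M"
proof (rule l2_boundedI)
  show "(\<lambda>x. f x + g x) \<in> borel_measurable M"
    using f g by (intro borel_measurable_add l2_measurable)
  show "integrable M (\<lambda>x. 2 * (norm (f x))\<^sup>2 + 2 * (norm (g x))\<^sup>2)"
    using f g by (intro Bochner_Integration.integrable_add integrable_mult_right l2_integrable_power2)
qed (simp add: norm_power2_add_le)

lemma l2_diff:
  assumes f: "f \<in> l2 M" and g: "g \<in> l2 M"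
  shows "(\<lambda>x. f x - g x) \<in> l2 M"
  using l2_add[OF f l2_scaleR[OF g, of "- 1"]] by simp

lemma l2_sum:
  assumes "\<And>i. i \<in> I \<Longrightarrow> f i \<in> l2 M"
  shows "(\<lambda>x. \<Sum>i\<in>I. f i x) \<in> l2 M"
  using assms
proof (induction I rule: infinite_finite_induct)
  case (insert i I)
  then show ?case using l2_add[of "f i" M "\<lambda>x. \<Sum>i\<in>I. f i x"] by auto
qed (auto simp: l2_def)

lemma l2_norm: "f \<in> l2 M \<Longrightarrow> (\<lambda>x. norm (f x)) \<in> l2 M"
  by (auto simp: l2_def)

lemma l2_integrable_inner:
  fixes f g :: "'a \<Rightarrow> 'e::euclidean_space"
  assumes f: "f \<in> l2 M" and g: "g \<in> l2 M"
  shows "integrable M (\<lambda>x. f x \<bullet> g x)"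
proof (rule Bochner_Integration.integrable_bound)
  show "integrable M (\<lambda>x. (norm (f x))\<^sup>2 + (norm (g x))\<^sup>2)"
    using f g by (intro Bochner_Integration.integrable_add l2_integrable_power2)
  show "(\<lambda>x. f x \<bullet> g x) \<in> borel_measurable M"
    using f g by (intro borel_measurable_inner l2_measurable)
  have "\<bar>x \<bullet> y\<bar> \<le> (norm x)\<^sup>2 + (norm y)\<^sup>2" for x y :: 'e
  proof -
    have "\<bar>x \<bullet> y\<bar> \<le> norm x * norm y" by (rule Cauchy_Schwarz_ineq2)
    also have "\<dots> \<le> (norm x)\<^sup>2 + (norm y)\<^sup>2"
      using sum_squares_bound[of "norm x" "norm y"] mult_nonneg_nonneg[OF norm_ge_zero[of x] norm_ge_zero[of y]]
      by linarith
    finally show ?thesis .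
  qed
  then show "AE x in M. norm (f x \<bullet> g x) \<le> norm ((norm (f x))\<^sup>2 + (norm (g x))\<^sup>2)"
    by simp
qed

lemma l2_integrable_norm:
  assumes "finite_measure M" "f \<in> l2 M"
  shows "integrable M (\<lambda>x. norm (f x))"
proof -
  interpret finite_measure M by fact
  have "(\<lambda>_. 1::real) \<in> l2 M" by (simp add: l2_def)
  from l2_integrable_inner[OF l2_norm[OF assms(2)] this] show ?thesis by simp
qed

lemma l2_integrable:
  assumes "finite_measure M" "f \<in> l2 M"
  shows "integrable M f"
  using l2_integrable_norm[OF assms] l2_measurable[OF assms(2)] integrable_norm_iff by blast

definition ip_l2 :: "'a measure \<Rightarrow> ('a \<Rightarrow> 'e::euclidean_space) \<Rightarrow> ('a \<Rightarrow> 'e) \<Rightarrow> real"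
  where "ip_l2 M f g = (\<integral>x. f x \<bullet> g x \<partial>M)"

interpretation l2: semi_inner_space "l2 M" "\<lambda>f g x. f x + g x" "\<lambda>c f x. c *\<^sub>R f x" "ip_l2 M" for M
proof unfold_locales
  fix f g h :: "'a \<Rightarrow> 'e::euclidean_space" and c :: real
  assume f: "f \<in> l2 M" and g: "g \<in> l2 M"
  show "(\<lambda>x. f x + g x) \<in> l2 M" by (rule l2_add[OF f g])
  show "(\<lambda>x. c *\<^sub>R f x) \<in> l2 M" by (rule l2_scaleR[OF f])
  show "ip_l2 M f g = ip_l2 M g f" by (simp add: ip_l2_def inner_commute)
  show "ip_l2 M (\<lambda>x. c *\<^sub>R f x) g = c * ip_l2 M f g" by (simp add: ip_l2_def)
  show "0 \<le> ip_l2 M f f" by (simp add: ip_l2_def)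
  assume h: "h \<in> l2 M"
  show "ip_l2 M (\<lambda>x. f x + g x) h = ip_l2 M f h + ip_l2 M g h"
    by (simp add: ip_l2_def inner_add_left l2_integrable_inner f g h)
qed

lemma nrm_l2: "l2.nrm M f = sqrt (\<integral>x. (norm (f x))\<^sup>2 \<partial>M)"
  by (simp add: l2.nrm_def ip_l2_def power2_norm_eq_inner)

lemma l2_nrm_power2: "(l2.nrm M f)\<^sup>2 = (\<integral>x. (norm (f x))\<^sup>2 \<partial>M)"
  by (simp add: nrm_l2)

lemma l2_sub: "l2.sub f g = (\<lambda>x. f x - g x)"
  by (simp add: l2.sub_def)

lemma nn_integral_l2:
  "f \<in> l2 M \<Longrightarrow> (\<integral>\<^sup>+x. ennreal ((norm (f x))\<^sup>2) \<partial>M) = ennreal ((l2.nrm M f)\<^sup>2)"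
  by (simp add: l2_nrm_power2 nn_integral_eq_integral l2_integrable_power2)

lemma AE_zero_if_nrm_zero:
  assumes f: "f \<in> l2 M" and 0: "l2.nrm M f = 0"
  shows "AE x in M. f x = 0"
proof -
  have "AE x in M. (norm (f x))\<^sup>2 = 0"
    using 0 integral_nonneg_eq_0_iff_AE[OF l2_integrable_power2[OF f]] by (simp add: nrm_l2)
  then show ?thesis by simp
qed

lemma l2_nrm_sum_le:
  assumes "\<And>i. i \<in> I \<Longrightarrow> f i \<in> l2 M"
  shows "l2.nrm M (\<lambda>x. \<Sum>i\<in>I. norm (f i x)) \<le> (\<Sum>i\<in>I. l2.nrm M (f i))"
  using assms
proof (induction I rule: infinite_finite_induct)
  case (insert i I)
  have "l2.nrm M (\<lambda>x. norm (f i x) + (\<Sum>i\<in>I. norm (f i x)))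
      \<le> l2.nrm M (\<lambda>x. norm (f i x)) + l2.nrm M (\<lambda>x. \<Sum>i\<in>I. norm (f i x))"
    using insert.prems by (intro l2.nrm_triangle l2_norm l2_sum) auto
  moreover have "l2.nrm M (\<lambda>x. norm (f i x)) = l2.nrm M (f i)"
    by (simp add: nrm_l2)
  ultimately show ?case using insert by auto
qed (auto simp: nrm_l2)

text \<open>
  Minkowski's inequality for series, by monotone convergence from the finite one.
\<close>

lemma nn_integral_suminf_power2_le:
  assumes d: "\<And>n. d n \<in> l2 M" and c: "\<And>n. l2.nrm M (d n) \<le> c n" and "summable c"
  shows "(\<integral>\<^sup>+x. (\<Sum>n. ennreal (norm (d n x)))\<^sup>2 \<partial>M) \<le> ennreal ((suminf c)\<^sup>2)"
proof -
  have c0: "0 \<le> c n" for n using c[of n] l2.nrm_nonneg[OF d[of n]] by linarith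
  have [measurable]: "d n \<in> borel_measurable M" for n by (rule l2_measurable[OF d])
  define p where "p N x = (\<Sum>n<N. norm (d n x))" for N x
  have p: "p N \<in> l2 M" for N unfolding p_def by (intro l2_sum l2_norm d)
  have "(\<Sum>n. ennreal (norm (d n x)))\<^sup>2 = (SUP N. ennreal ((p N x)\<^sup>2))" for x
  proof -
    have 1: "(\<lambda>N. (\<Sum>n<N. ennreal (norm (d n x)))\<^sup>2) \<longlonglongrightarrow> (\<Sum>n. ennreal (norm (d n x)))\<^sup>2"
      unfolding power2_eq_square
      by (intro tendsto_mult_ennreal summable_LIMSEQ summableI) (auto simp: sum_nonneg)
    have 2: "(\<Sum>n<N. ennreal (norm (d n x)))\<^sup>2 = ennreal ((p N x)\<^sup>2)" for N
      by (simp add: p_def sum_ennreal sum_nonneg ennreal_power)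
    have "incseq (\<lambda>N. ennreal ((p N x)\<^sup>2))"
      unfolding incseq_Suc_iff p_def by (intro allI ennreal_leI power_mono) (auto intro: sum_nonneg)
    from LIMSEQ_SUP[OF this] 1 show ?thesis
      unfolding 2 using LIMSEQ_unique by blast
  qed
  then have "(\<integral>\<^sup>+x. (\<Sum>n. ennreal (norm (d n x)))\<^sup>2 \<partial>M) = (\<integral>\<^sup>+x. (SUP N. ennreal ((p N x)\<^sup>2)) \<partial>M)"
    by simp
  also have "\<dots> = (SUP N. \<integral>\<^sup>+x. ennreal ((p N x)\<^sup>2) \<partial>M)"
  proof (rule nn_integral_monotone_convergence_SUP)
    show "incseq (\<lambda>N x. ennreal ((p N x)\<^sup>2))"
      unfolding incseq_Suc_iff p_def le_fun_def
      by (intro allI ennreal_leI power_mono) (auto intro: sum_nonneg)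
  qed (simp add: p_def)
  also have "\<dots> \<le> ennreal ((suminf c)\<^sup>2)"
  proof (rule SUP_least)
    fix N
    have "l2.nrm M (p N) \<le> (\<Sum>n<N. l2.nrm M (d n))"
      unfolding p_def by (rule l2_nrm_sum_le) (simp add: d)
    also have "\<dots> \<le> (\<Sum>n<N. c n)" by (intro sum_mono c)
    also have "\<dots> \<le> suminf c" by (rule sum_le_suminf) (auto simp: assms c0)
    finally have "(l2.nrm M (p N))\<^sup>2 \<le> (suminf c)\<^sup>2"
      by (rule power_mono) (simp add: l2.nrm_nonneg p)
    then show "(\<integral>\<^sup>+x. ennreal ((p N x)\<^sup>2) \<partial>M) \<le> ennreal ((suminf c)\<^sup>2)"
      using nn_integral_l2[OF p[of N]] by (simp add: ennreal_leI)
  qed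
  finally show ?thesis .
qed

text \<open>
  The increments of the sequence form a series that converges absolutely almost everywhere, because
  the sum of their absolute values is square integrable by Minkowski's inequality.  The same bound
  for the tails of the series shows that its sum is the limit in \<open>L\<^sub>2\<close>.
\<close>

lemma l2_complete:
  fixes S :: "nat \<Rightarrow> 'a \<Rightarrow> 'e::euclidean_space"
  assumes S: "\<And>n. S n \<in> l2 M" and step: "\<And>n. l2.nrm M (l2.sub (S (Suc n)) (S n)) \<le> (1/3) ^ n"
  shows "\<exists>y\<in>l2 M. (\<lambda>n. l2.nrm M (l2.sub y (S n))) \<longlonglongrightarrow> 0"
proof -
  define d where "d n x = S (Suc n) x - S n x" for n x
  have d: "d n \<in> l2 M" for n unfolding d_def by (intro l2_diff S)
  have d_le: "l2.nrm M (d n) \<le> (1/3) ^ n" for n using step[of n] by (simp add: l2_sub d_def[abs_def])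
  have [measurable]: "d n \<in> borel_measurable M" "S n \<in> borel_measurable M" for n
    by (simp_all add: l2_measurable d S)
  \<comment> \<open>The dominating function of the tail after \<open>k\<close> steps.\<close>
  define h where "h k x = (\<Sum>n. ennreal (norm (d (n + k) x)))" for k x
  have h_le: "(\<integral>\<^sup>+x. (h k x)\<^sup>2 \<partial>M) \<le> ennreal (((3/2) * (1/3) ^ k)\<^sup>2)" for k
  proof -
    have "(\<lambda>n. (1/3 :: real) ^ (n + k)) sums ((3/2) * (1/3) ^ k)"
      using sums_mult[OF geometric_sums[of "1/3::real"], of "(1/3) ^ k"] by (simp add: power_add mult.commute)
    from nn_integral_suminf_power2_le[of "\<lambda>n. d (n + k)", OF d d_le sums_summable[OF this]] sums_unique[OF this]
    show ?thesis unfolding h_def by metis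
  qed
  have [measurable]: "h k \<in> borel_measurable M" for k unfolding h_def by measurable
  have "AE x in M. (h 0 x)\<^sup>2 \<noteq> \<infinity>"
  proof (rule nn_integral_PInf_AE)
    show "(\<integral>\<^sup>+x. (h 0 x)\<^sup>2 \<partial>M) \<noteq> \<infinity>"
      using h_le[of 0] by (auto simp: top_unique)
  qed simp
  then have summ: "AE x in M. summable (\<lambda>n. norm (d n x))"
  proof eventually_elim
    case (elim x)
    then have "h 0 x \<noteq> top"
      by (auto simp: power2_eq_square ennreal_mult_eq_top_iff)
    then show ?case unfolding h_def by (intro summable_suminf_not_top) auto
  qed
  define y where "y x = S 0 x + (\<Sum>n. d n x)" for x
  have [measurable]: "y \<in> borel_measurable M" unfolding y_def by measurable
  have le: "(\<integral>\<^sup>+x. ennreal ((norm (y x - S k x))\<^sup>2) \<partial>M) \<le> ennreal (((3/2) * (1/3) ^ k)\<^sup>2)" for k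
  proof -
    have "(\<integral>\<^sup>+x. ennreal ((norm (y x - S k x))\<^sup>2) \<partial>M) \<le> (\<integral>\<^sup>+x. (h k x)\<^sup>2 \<partial>M)"
    proof (rule nn_integral_mono_AE, use summ in eventually_elim)
      case (elim x)
      have "(\<Sum>n<k. d n x) = S k x - S 0 x"
        unfolding d_def by (induction k) auto
      then have "y x - S k x = (\<Sum>n. d (n + k) x)"
        using suminf_minus_initial_segment[OF summable_norm_cancel[OF elim], of k] by (simp add: y_def)
      also have "norm \<dots> \<le> (\<Sum>n. norm (d (n + k) x))"
        by (rule summable_norm) (use elim summable_ignore_initial_segment in blast)
      finally have "ennreal (norm (y x - S k x)) \<le> ennreal (\<Sum>n. norm (d (n + k) x))"
        by (rule ennreal_leI)
      also have "\<dots> = h k x"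
        unfolding h_def
        by (rule suminf_ennreal2[symmetric]) (use summable_ignore_initial_segment[OF elim] in auto)
      finally have "(ennreal (norm (y x - S k x)))\<^sup>2 \<le> (h k x)\<^sup>2"
        by (rule power_mono) simp
      then show ?case by (simp add: ennreal_power)
    qed
    then show ?thesis using h_le order_trans by blast
  qed
  have yS: "(\<lambda>x. y x - S k x) \<in> l2 M" for k
  proof -
    have "integrable M (\<lambda>x. (norm (y x - S k x))\<^sup>2)"
      by (rule integrableI_bounded) (use le[of k] le_less_trans[OF le[of k] ennreal_less_top] in simp_all)
    then show ?thesis by (simp add: l2_def)
  qed
  have "y \<in> l2 M" using l2_add[OF yS[of 0] S[of 0]] by simp
  moreover have "(\<lambda>n. l2.nrm M (l2.sub y (S n))) \<longlonglongrightarrow> 0"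
  proof (rule tendsto_sandwich)
    show "\<forall>\<^sub>F n in sequentially. 0 \<le> l2.nrm M (l2.sub y (S n))"
      by (simp add: l2_sub l2.nrm_nonneg yS)
    show "\<forall>\<^sub>F n in sequentially. l2.nrm M (l2.sub y (S n)) \<le> (3/2) * (1/3) ^ n"
    proof (intro always_eventually allI)
      fix n
      have "(l2.nrm M (l2.sub y (S n)))\<^sup>2 \<le> ((3/2) * (1/3) ^ n)\<^sup>2"
        using le[of n] unfolding nn_integral_l2[OF yS] l2_sub by (simp add: ennreal_le_iff)
      then show "l2.nrm M (l2.sub y (S n)) \<le> (3/2) * (1/3) ^ n"
        by (rule power2_le_imp_le) simp
    qed
    show "(\<lambda>n. (3/2) * (1/3 :: real) ^ n) \<longlonglongrightarrow> 0"
      by (intro tendsto_mult_right_zero LIMSEQ_power_zero) simp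
  qed simp
  ultimately show ?thesis by blast
qed


section \<open>Essentially bounded functions\<close>

definition ess_bounded :: "'a measure \<Rightarrow> ('a \<Rightarrow> 'e::euclidean_space) \<Rightarrow> bool"
  where "ess_bounded M f \<longleftrightarrow> f \<in> borel_measurable M \<and> (\<exists>C\<ge>0. AE x in M. norm (f x) \<le> C)"

lemma ess_boundedI:
  assumes "f \<in> borel_measurable M" "AE x in M. norm (f x) \<le> C"
  shows "ess_bounded M f"
  unfolding ess_bounded_def
proof (intro conjI exI)
  show "AE x in M. norm (f x) \<le> max C 0" using assms(2) by eventually_elim auto
qed (use assms in auto)

lemma ess_bounded_fst:
  assumes "finite_measure M" "finite_measure N" and f: "ess_bounded M f"
  shows "ess_bounded (M \<Otimes>\<^sub>M N) (\<lambda>z. f (fst z))"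
proof -
  interpret M: finite_measure M by fact
  interpret N: finite_measure N by fact
  interpret pair_sigma_finite M N ..
  obtain C where [measurable]: "f \<in> borel_measurable M" and C: "AE x in M. norm (f x) \<le> C"
    using f by (auto simp: ess_bounded_def)
  show ?thesis
  proof (rule ess_boundedI)
    show "AE z in M \<Otimes>\<^sub>M N. norm (f (fst z)) \<le> C"
      by (rule AE_pair_measure) (use C in \<open>auto elim!: eventually_mono\<close>)
  qed simp
qed

lemma ess_bounded_snd:
  assumes "finite_measure M" "finite_measure N" and f: "ess_bounded N f"
  shows "ess_bounded (M \<Otimes>\<^sub>M N) (\<lambda>z. f (snd z))"
proof -
  interpret M: finite_measure M by fact
  interpret N: finite_measure N by fact
  interpret pair_sigma_finite M N ..
  obtain C where [measurable]: "f \<in> borel_measurable N" and C: "AE x in N. norm (f x) \<le> C"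
    using f by (auto simp: ess_bounded_def)
  show ?thesis
  proof (rule ess_boundedI)
    show "AE z in M \<Otimes>\<^sub>M N. norm (f (snd z)) \<le> C"
      by (rule AE_pair_measure) (use C in \<open>auto elim!: eventually_mono\<close>)
  qed simp
qed

lemma ess_bounded_bilinear:
  assumes "bounded_bilinear h" and f: "ess_bounded M f" and g: "ess_bounded M g"
  shows "ess_bounded M (\<lambda>x. h (f x) (g x))"
proof -
  interpret h: bounded_bilinear h by fact
  obtain K where K: "0 < K" "\<And>a b. norm (h a b) \<le> norm a * norm b * K"
    using h.pos_bounded by blast
  obtain C D where C: "0 \<le> C" "AE x in M. norm (f x) \<le> C" and D: "0 \<le> D" "AE x in M. norm (g x) \<le> D"
    using f g by (auto simp: ess_bounded_def)
  show ?thesis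
  proof (rule ess_boundedI)
    show "(\<lambda>x. h (f x) (g x)) \<in> borel_measurable M"
    proof (rule borel_measurable_continuous_Pair[of f M g h])
      show "continuous_on UNIV (\<lambda>x. h (fst x) (snd x))"
        by (intro h.continuous_on continuous_on_fst continuous_on_snd continuous_on_id)
    qed (use f g in \<open>auto simp: ess_bounded_def\<close>)
    show "AE x in M. norm (h (f x) (g x)) \<le> C * D * K"
      using C(2) D(2)
    proof eventually_elim
      case (elim x)
      have "norm (f x) * norm (g x) * K \<le> C * D * K"
        using elim C(1) K(1) by (intro mult_right_mono mult_mono) auto
      then show ?case using K(2)[of "f x" "g x"] by linarith
    qed
  qed
qed

lemma ess_bounded_if:
  assumes "Measurable.pred M Q" "ess_bounded M f" "ess_bounded M g"
  shows "ess_bounded M (\<lambda>x. if Q x then f x else g x)"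
proof -
  obtain C D where "AE x in M. norm (f x) \<le> C" "AE x in M. norm (g x) \<le> D"
    using assms by (auto simp: ess_bounded_def)
  then have "AE x in M. norm (if Q x then f x else g x) \<le> max C D"
    by eventually_elim auto
  then show ?thesis
    using assms by (intro ess_boundedI measurable_If) (auto simp: ess_bounded_def)
qed

lemma bounded_bilinear_matrix_vector_mult:
  "bounded_bilinear (\<lambda>(A::real^'n^'m) x. A *v x)"
  unfolding bilinear_conv_bounded_bilinear[symmetric] bilinear_def
  by (auto intro!: linearI simp: matrix_vector_mult_def vec_eq_iff sum.distrib algebra_simps sum_distrib_left)

lemma bounded_bilinear_matrix_mult:
  "bounded_bilinear (\<lambda>(A::real^'n^'m) (B::real^'k^'n). A ** B)"
  unfolding bilinear_conv_bounded_bilinear[symmetric] bilinear_def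
  by (auto intro!: linearI simp: matrix_matrix_mult_def vec_eq_iff sum.distrib algebra_simps sum_distrib_left)

lemma norm_matrix_vector_mult_le: "norm (A *v x) \<le> norm A * norm x" for A :: "real^'n^'m"
proof -
  have "norm (A *v x) \<le> L2_set (\<lambda>i. norm (A $ i) * norm x) UNIV"
    unfolding norm_vec_def[of "A *v x"]
    by (intro L2_set_mono) (auto simp: matrix_vector_mul_component Cauchy_Schwarz_ineq2)
  then show ?thesis
    unfolding norm_vec_def[of A] by (simp add: L2_set_left_distrib)
qed

lemma ess_bounded_matrix_bound:
  fixes k :: "'a \<Rightarrow> real^'n^'m"
  assumes "ess_bounded M k"
  obtains C where "0 \<le> C" "AE x in M. \<forall>v. norm (k x *v v) \<le> C * norm v"
proof -
  obtain C where C: "0 \<le> C" "AE x in M. norm (k x) \<le> C" using assms by (auto simp: ess_bounded_def)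
  have "AE x in M. \<forall>v. norm (k x *v v) \<le> C * norm v"
    using C(2) by eventually_elim (meson mult_right_mono norm_ge_zero norm_matrix_vector_mult_le order_trans)
  then show ?thesis using C(1) that by blast
qed

lemma borel_measurable_matrix_vector_mult [measurable]:
  fixes A :: "'a \<Rightarrow> real^'n^'m"
  assumes "A \<in> borel_measurable M" "f \<in> borel_measurable M"
  shows "(\<lambda>x. A x *v f x) \<in> borel_measurable M"
proof (rule borel_measurable_continuous_Pair[OF assms])
  show "continuous_on UNIV (\<lambda>x. fst x *v snd x :: real^'m)" for x :: "real^'n^'m \<times> real^'n"
    by (intro bounded_bilinear.continuous_on[OF bounded_bilinear_matrix_vector_mult]
        continuous_on_fst continuous_on_snd continuous_on_id)
qed

lemma linear_transpose: "linear (transpose :: real^'n^'m \<Rightarrow> real^'m^'n)"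
  by (rule linearI) (auto simp: transpose_def vec_eq_iff)

lemma ess_bounded_transpose:
  fixes k :: "'a \<Rightarrow> real^'n^'m"
  assumes "ess_bounded M k"
  shows "ess_bounded M (\<lambda>x. transpose (k x))"
proof -
  interpret bounded_linear "transpose :: real^'n^'m \<Rightarrow> real^'m^'n"
    by (rule linear_conv_bounded_linear[THEN iffD1, OF linear_transpose])
  obtain C where C: "AE x in M. norm (k x) \<le> C" and k: "k \<in> borel_measurable M"
    using assms by (auto simp: ess_bounded_def)
  obtain K where K: "0 < K" "\<And>A :: real^'n^'m. norm (transpose A) \<le> norm A * K"
    using pos_bounded by blast
  show ?thesis
  proof (rule ess_boundedI)
    show "(\<lambda>x. transpose (k x)) \<in> borel_measurable M"
      using k by (intro borel_measurable_continuous_on[OF linear_continuous_on[OF bounded_linear_axioms]])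
    show "AE x in M. norm (transpose (k x)) \<le> C * K"
      using C
    proof eventually_elim
      case (elim x)
      then have "norm (k x) * K \<le> C * K" using K(1) by simp
      then show ?case using K(2)[of "k x"] by linarith
    qed
  qed
qed

lemma matrix_vector_inner: "(A *v x) \<bullet> y = x \<bullet> (transpose A *v y)" for A :: "real^'n^'m"
  by (metis dot_lmul_matrix inner_commute vector_transpose_matrix)


section \<open>Operators with an adjoint\<close>

text \<open>
  A relation between operators, because as an operator on functions (rather than classes) an
  adjoint is not unique.
\<close>

definition adj :: "'a measure \<Rightarrow> 'b measure \<Rightarrow> (('a \<Rightarrow> 'e::euclidean_space) \<Rightarrow> 'b \<Rightarrow> 'f::euclidean_space) \<Rightarrow>
    (('b \<Rightarrow> 'f) \<Rightarrow> 'a \<Rightarrow> 'e) \<Rightarrow> bool"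
  where "adj M N F G \<longleftrightarrow> (\<forall>f\<in>l2 M. F f \<in> l2 N) \<and> (\<forall>g\<in>l2 N. G g \<in> l2 M) \<and>
    (\<forall>f\<in>l2 M. \<forall>g\<in>l2 N. ip_l2 N (F f) g = ip_l2 M f (G g))"

lemma adj_commute: "adj M N F G \<Longrightarrow> adj N M G F"
  unfolding adj_def by (metis l2.ip_commute)

lemma adj_compose: "adj M N F G \<Longrightarrow> adj N R F' G' \<Longrightarrow> adj M R (\<lambda>f. F' (F f)) (\<lambda>g. G (G' g))"
  unfolding adj_def by simp

lemma adj_add:
  "adj M N F G \<Longrightarrow> adj M N F' G' \<Longrightarrow> adj M N (\<lambda>f x. F f x + F' f x) (\<lambda>g x. G g x + G' g x)"
  unfolding adj_def by (simp add: l2.ip_add_left l2.ip_add_right l2_add)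

lemma adj_scaleR: "adj M N F G \<Longrightarrow> adj M N (\<lambda>f x. c *\<^sub>R F f x) (\<lambda>g x. c *\<^sub>R G g x)"
  unfolding adj_def by (simp add: l2.ip_scale_left l2.ip_scale_right l2_scaleR)

lemma adj_cong:
  assumes "adj M N F G" and eq: "\<And>f x. x \<in> space N \<Longrightarrow> F' f x = F f x"
  shows "adj M N F' G"
proof -
  have 1: "F' f \<in> l2 N \<longleftrightarrow> F f \<in> l2 N" for f
    using measurable_cong[of N "F' f" "F f"] Bochner_Integration.integrable_cong[of N N "\<lambda>x. (norm (F' f x))\<^sup>2" "\<lambda>x. (norm (F f x))\<^sup>2"]
    by (simp add: l2_def eq)
  have 2: "ip_l2 N (F' f) g = ip_l2 N (F f) g" for f g
    unfolding ip_l2_def by (intro Bochner_Integration.integral_cong) (auto simp: eq)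
  show ?thesis using assms(1) by (simp add: adj_def 1 2)
qed

definition adjointable :: "'a measure \<Rightarrow> 'b measure \<Rightarrow>
    (('a \<Rightarrow> 'e::euclidean_space) \<Rightarrow> 'b \<Rightarrow> 'f::euclidean_space) \<Rightarrow> bool"
  where "adjointable M N F \<longleftrightarrow> (\<exists>G. adj M N F G)"

lemma adjointable_compose:
  "adjointable M N F \<Longrightarrow> adjointable N R F' \<Longrightarrow> adjointable M R (\<lambda>f. F' (F f))"
  unfolding adjointable_def using adj_compose by blast

lemma adjointable_add:
  "adjointable M N F \<Longrightarrow> adjointable M N F' \<Longrightarrow> adjointable M N (\<lambda>f x. F f x + F' f x)"
  unfolding adjointable_def using adj_add by blast

lemma adjointable_scaleR: "adjointable M N F \<Longrightarrow> adjointable M N (\<lambda>f x. c *\<^sub>R F f x)"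
  unfolding adjointable_def using adj_scaleR by blast

lemma adjointable_cong:
  "adjointable M N F \<Longrightarrow> (\<And>f x. x \<in> space N \<Longrightarrow> F' f x = F f x) \<Longrightarrow> adjointable M N F'"
  unfolding adjointable_def using adj_cong by blast

lemma l2_mult:
  fixes k :: "'a \<Rightarrow> real^'n^'m"
  assumes k: "ess_bounded M k" and f: "f \<in> l2 M"
  shows "(\<lambda>x. k x *v f x) \<in> l2 M"
proof -
  obtain C where C: "AE x in M. \<forall>v. norm (k x *v v) \<le> C * norm v" using ess_bounded_matrix_bound[OF k] by blast
  show ?thesis
  proof (rule l2_boundedI)
    show "(\<lambda>x. k x *v f x) \<in> borel_measurable M"
      using k l2_measurable[OF f] by (auto simp: ess_bounded_def)
    show "integrable M (\<lambda>x. (norm (C *\<^sub>R f x))\<^sup>2)"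
      by (rule l2_integrable_power2[OF l2_scaleR[OF f]])
    show "AE x in M. (norm (k x *v f x))\<^sup>2 \<le> (norm (C *\<^sub>R f x))\<^sup>2"
      using C
    proof eventually_elim
      case (elim x)
      then have "norm (k x *v f x) \<le> norm (C *\<^sub>R f x)"
        by (smt (verit) abs_ge_self mult_right_mono norm_ge_zero norm_scaleR)
      then show ?case by (rule power_mono) simp
    qed
  qed
qed

lemma integrable_mult:
  fixes k :: "'a \<Rightarrow> real^'n^'m"
  assumes k: "ess_bounded M k" and f: "integrable M f"
  shows "integrable M (\<lambda>x. k x *v f x)"
proof -
  obtain C where C: "0 \<le> C" "AE x in M. \<forall>v. norm (k x *v v) \<le> C * norm v"
    using ess_bounded_matrix_bound[OF k] by blast
  have "integrable M (\<lambda>x. C * norm (f x))" using f by simp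
  then show ?thesis
  proof (rule Bochner_Integration.integrable_bound)
    show "(\<lambda>x. k x *v f x) \<in> borel_measurable M"
      using k f by (auto simp: ess_bounded_def)
    show "AE x in M. norm (k x *v f x) \<le> norm (C * norm (f x))"
      using C(2) by eventually_elim (simp add: C(1))
  qed
qed

lemma adj_mult:
  fixes k :: "'a \<Rightarrow> real^'n^'m"
  assumes k: "ess_bounded M k"
  shows "adj M M (\<lambda>f x. k x *v f x) (\<lambda>g x. transpose (k x) *v g x)"
  unfolding adj_def ip_l2_def
  using l2_mult[OF k] l2_mult[OF ess_bounded_transpose[OF k]] by (simp add: matrix_vector_inner)

subsection \<open>Integral operators\<close>

lemma integral_norm_power2_le:
  assumes "finite_measure M" and f: "f \<in> l2 M"
  shows "(\<integral>x. norm (f x) \<partial>M)\<^sup>2 \<le> measure M (space M) * (\<integral>x. (norm (f x))\<^sup>2 \<partial>M)"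
proof -
  interpret finite_measure M by fact
  have 1: "(\<lambda>_. 1::real) \<in> l2 M" by (simp add: l2_def)
  have "\<bar>ip_l2 M (\<lambda>_. 1) (\<lambda>x. norm (f x))\<bar> \<le> l2.nrm M (\<lambda>_. 1::real) * l2.nrm M (\<lambda>x. norm (f x))"
    by (rule l2.Cauchy_Schwarz[OF 1 l2_norm[OF f]])
  then have "(ip_l2 M (\<lambda>_. 1) (\<lambda>x. norm (f x)))\<^sup>2 \<le> (l2.nrm M (\<lambda>_. 1::real) * l2.nrm M (\<lambda>x. norm (f x)))\<^sup>2"
    by (metis abs_le_square_iff abs_mult abs_of_nonneg l2.nrm_nonneg[OF 1] l2.nrm_nonneg[OF l2_norm[OF f]])
  then show ?thesis by (simp add: ip_l2_def power_mult_distrib l2_nrm_power2)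
qed

lemma l2_slice:
  assumes "finite_measure M" "finite_measure N" and w: "w \<in> l2 (M \<Otimes>\<^sub>M N)"
  shows "AE x in M. (\<lambda>y. w (x, y)) \<in> l2 N"
proof -
  interpret M: finite_measure M by fact
  interpret N: finite_measure N by fact
  interpret pair_sigma_finite M N ..
  have [measurable]: "w \<in> borel_measurable (M \<Otimes>\<^sub>M N)" using w by (rule l2_measurable)
  show ?thesis
    using AE_integrable_fst'[OF l2_integrable_power2[OF w]] AE_space
    by eventually_elim (auto simp: l2_def)
qed

lemma integrable_lift:
  fixes g :: "'a \<Rightarrow> 'e::{banach, second_countable_topology}"
  assumes "finite_measure M" "finite_measure N" and g: "integrable M g"
  shows "integrable (M \<Otimes>\<^sub>M N) (\<lambda>z. g (fst z))" "integrable (N \<Otimes>\<^sub>M M) (\<lambda>z. g (snd z))"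
proof -
  interpret M: finite_measure M by fact
  interpret N: finite_measure N by fact
  interpret NM: pair_sigma_finite N M ..
  interpret pair_sigma_finite M N ..
  have [measurable]: "g \<in> borel_measurable M" using g by auto
  show 1: "integrable (M \<Otimes>\<^sub>M N) (\<lambda>z. g (fst z))"
    by (rule Fubini_integrable) (use g in auto)
  show "integrable (N \<Otimes>\<^sub>M M) (\<lambda>z. g (snd z))"
    using integrable_product_swap[OF 1] by (simp add: split_beta')
qed

lemma l2_lift:
  assumes "finite_measure M" "finite_measure N" and g: "g \<in> l2 M"
  shows "(\<lambda>z. g (fst z)) \<in> l2 (M \<Otimes>\<^sub>M N)" "(\<lambda>z. g (snd z)) \<in> l2 (N \<Otimes>\<^sub>M M)"
  using integrable_lift[OF assms(1,2) l2_integrable_power2[OF g]] l2_measurable[OF g] by (auto simp: l2_def)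

lemma adj_swap:
  assumes "finite_measure M" "finite_measure N"
  shows "adj (M \<Otimes>\<^sub>M N) (N \<Otimes>\<^sub>M M)
    (\<lambda>f (y, x). f (x, y) :: 'e::euclidean_space) (\<lambda>g (x, y). g (y, x))"
proof -
  interpret M: finite_measure M by fact
  interpret N: finite_measure N by fact
  interpret NM: pair_sigma_finite N M ..
  interpret MN: pair_sigma_finite M N ..
  have 1: "(\<lambda>(y, x). f (x, y)) \<in> l2 (N \<Otimes>\<^sub>M M)" if f: "f \<in> l2 (M \<Otimes>\<^sub>M N)" for f :: "_ \<Rightarrow> 'e"
    using MN.integrable_product_swap[OF l2_integrable_power2[OF f]]
      measurable_pair_swap[OF l2_measurable[OF f]]
    by (simp add: l2_def split_beta')
  have 2: "(\<lambda>(y, x). f (x, y)) \<in> l2 (M \<Otimes>\<^sub>M N)" if f: "f \<in> l2 (N \<Otimes>\<^sub>M M)" for f :: "_ \<Rightarrow> 'e"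
    using NM.integrable_product_swap[OF l2_integrable_power2[OF f]]
      measurable_pair_swap[OF l2_measurable[OF f]]
    by (simp add: l2_def split_beta')
  have 3: "ip_l2 (N \<Otimes>\<^sub>M M) (\<lambda>(y, x). f (x, y)) g = ip_l2 (M \<Otimes>\<^sub>M N) f (\<lambda>(x, y). g (y, x))"
    if "f \<in> l2 (M \<Otimes>\<^sub>M N)" "g \<in> l2 (N \<Otimes>\<^sub>M M)" for f g :: "_ \<Rightarrow> 'e"
  proof -
    have "(\<integral>z. (case z of (y, x) \<Rightarrow> f (x, y) \<bullet> g (y, x)) \<partial>(N \<Otimes>\<^sub>M M))
        = (\<integral>z. f z \<bullet> (case z of (x, y) \<Rightarrow> g (y, x)) \<partial>(M \<Otimes>\<^sub>M N))"
      using MN.integral_product_swap[of "\<lambda>z. f z \<bullet> (case z of (x, y) \<Rightarrow> g (y, x))"]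
        l2_measurable[OF that(1)] l2_measurable[OF 2[OF that(2)]] by (simp add: split_beta')
    then show ?thesis by (simp add: ip_l2_def split_beta')
  qed
  show ?thesis using 1 2 3 by (simp add: adj_def)
qed

text \<open>
  Averaging over the first variable and constant extension in it are adjoint to each other by
  Fubini's theorem; the Cauchy-Schwarz inequality bounds averaging on \<open>L\<^sub>2\<close>.
\<close>

lemma adj_average:
  assumes "finite_measure M" "finite_measure N"
  shows "adj (N \<Otimes>\<^sub>M M) M (\<lambda>f x. \<integral>y. f (y, x) \<partial>N :: 'e::euclidean_space) (\<lambda>g z. g (snd z))"
proof -
  interpret M: finite_measure M by fact
  interpret N: finite_measure N by fact
  interpret MN: pair_sigma_finite M N ..
  interpret NM: pair_sigma_finite N M ..
  have avg: "(\<lambda>x. \<integral>y. f (y, x) \<partial>N) \<in> l2 M" if f: "f \<in> l2 (N \<Otimes>\<^sub>M M)" for f :: "_ \<Rightarrow> 'e"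
  proof (rule l2_boundedI)
    have [measurable]: "f \<in> borel_measurable (N \<Otimes>\<^sub>M M)" using f by (rule l2_measurable)
    show "(\<lambda>x. \<integral>y. f (y, x) \<partial>N) \<in> borel_measurable M" by measurable
    have swap: "(\<lambda>(x, y). f (y, x)) \<in> l2 (M \<Otimes>\<^sub>M N)"
      using adj_swap[OF assms(2,1)] f by (auto simp: adj_def)
    have "integrable M (\<lambda>x. \<integral>y. (norm (f (y, x)))\<^sup>2 \<partial>N)"
      using MN.integrable_fst'[OF l2_integrable_power2[OF swap]] by simp
    then show "integrable M (\<lambda>x. measure N (space N) * (\<integral>y. (norm (f (y, x)))\<^sup>2 \<partial>N))" by simp
    show "AE x in M. (norm (\<integral>y. f (y, x) \<partial>N))\<^sup>2 \<le> measure N (space N) * (\<integral>y. (norm (f (y, x)))\<^sup>2 \<partial>N)"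
      using l2_slice[OF assms swap]
    proof eventually_elim
      case (elim x)
      have "(norm (\<integral>y. f (y, x) \<partial>N))\<^sup>2 \<le> (\<integral>y. norm (f (y, x)) \<partial>N)\<^sup>2"
        by (intro power_mono integral_norm_bound) simp
      also have "\<dots> \<le> measure N (space N) * (\<integral>y. (norm (f (y, x)))\<^sup>2 \<partial>N)"
        using elim by (intro integral_norm_power2_le assms(2)) simp
      finally show ?case .
    qed
  qed
  have "ip_l2 M (\<lambda>x. \<integral>y. f (y, x) \<partial>N) g = ip_l2 (N \<Otimes>\<^sub>M M) f (\<lambda>z. g (snd z))"
    if f: "f \<in> l2 (N \<Otimes>\<^sub>M M)" and g: "g \<in> l2 M" for f and g :: "_ \<Rightarrow> 'e"
  proof -
    have int: "integrable (N \<Otimes>\<^sub>M M) (\<lambda>(y, x). f (y, x) \<bullet> g x)"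
      using l2_integrable_inner[OF f l2_lift(2)[OF assms g]] by (simp add: split_beta')
    have [measurable]: "f \<in> borel_measurable (N \<Otimes>\<^sub>M M)" "g \<in> borel_measurable M"
      using f g by (auto simp: l2_measurable)
    have "integrable (M \<Otimes>\<^sub>M N) (\<lambda>(x, y). f (y, x))"
      using NM.integrable_product_swap[OF l2_integrable[OF finite_measure_pair_measure[OF assms] f]] by simp
    then have "AE x in M. integrable N (\<lambda>y. f (y, x))"
      using MN.AE_integrable_fst'[of "\<lambda>(x, y). f (y, x)"] by simp
    then have "ip_l2 M (\<lambda>x. \<integral>y. f (y, x) \<partial>N) g = (\<integral>x. (\<integral>y. f (y, x) \<bullet> g x \<partial>N) \<partial>M)"
      unfolding ip_l2_def by (intro integral_cong_AE) (auto elim!: eventually_mono)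
    also have "\<dots> = ip_l2 (N \<Otimes>\<^sub>M M) f (\<lambda>z. g (snd z))"
      using NM.integral_snd[OF int] by (simp add: ip_l2_def split_beta')
    finally show ?thesis .
  qed
  moreover have "(\<lambda>z. g (snd z)) \<in> l2 (N \<Otimes>\<^sub>M M)" if "g \<in> l2 M" for g :: "_ \<Rightarrow> 'e"
    by (rule l2_lift(2)[OF assms that])
  ultimately show ?thesis using avg by (simp add: adj_def)
qed

lemma ess_bounded_swap_transpose:
  fixes k :: "'b \<times> 'a \<Rightarrow> real^'n^'m"
  assumes "finite_measure M" "finite_measure N" and k: "ess_bounded (N \<Otimes>\<^sub>M M) k"
  shows "ess_bounded (M \<Otimes>\<^sub>M N) (\<lambda>(x, y). transpose (k (y, x)))"
proof -
  interpret M: finite_measure M by fact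
  interpret N: finite_measure N by fact
  interpret MN: pair_sigma_finite M N ..
  interpret NM: pair_sigma_finite N M ..
  obtain C where C: "AE z in N \<Otimes>\<^sub>M M. norm (transpose (k z)) \<le> C"
    and m: "(\<lambda>z. transpose (k z)) \<in> borel_measurable (N \<Otimes>\<^sub>M M)"
    using ess_bounded_transpose[OF k] by (auto simp: ess_bounded_def)
  have m' [measurable]: "(\<lambda>(x, y). transpose (k (y, x))) \<in> borel_measurable (M \<Otimes>\<^sub>M N)"
    using measurable_pair_swap[OF m] by simp
  show ?thesis
  proof (rule ess_boundedI[OF m'])
    have "AE y in N. AE x in M. norm (transpose (k (y, x))) \<le> C"
      using NM.AE_pair[OF C] .
    then have "AE x in M. AE y in N. norm (transpose (k (y, x))) \<le> C"
      by (subst MN.AE_commute) (use m' in \<open>simp_all add: split_beta'\<close>)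
    then show "AE z in M \<Otimes>\<^sub>M N. norm (case z of (x, y) \<Rightarrow> transpose (k (y, x))) \<le> C"
      by (intro MN.AE_pair_measure) (use m' in simp_all)
  qed
qed

text \<open>
  An integral operator extends \<open>f\<close> constantly in \<open>y\<close>, multiplies by the kernel and averages over \<open>x\<close>;
  each of the three steps has a known adjoint.
\<close>

lemma adj_kernel:
  fixes k :: "'b \<times> 'a \<Rightarrow> real^'n^'m"
  assumes fin: "finite_measure M" "finite_measure N" and k: "ess_bounded (N \<Otimes>\<^sub>M M) k"
  shows "adj M N (\<lambda>f y. \<integral>x. k (y, x) *v f x \<partial>M) (\<lambda>g x. \<integral>y. transpose (k (y, x)) *v g y \<partial>N)"
proof -
  have "adj M (N \<Otimes>\<^sub>M M) (\<lambda>f z. k z *v f (snd z)) (\<lambda>g x. \<integral>y. transpose (k (y, x)) *v g (y, x) \<partial>N)"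
    using adj_compose[OF adj_commute[OF adj_average[OF fin]] adj_mult[OF k]] .
  moreover have "adj (N \<Otimes>\<^sub>M M) N (\<lambda>f y. \<integral>x. f (y, x) \<partial>M) (\<lambda>g z. g (fst z))"
    using adj_compose[OF adj_swap[OF fin(2,1)] adj_average[OF fin(2,1)]] by (simp add: split_beta')
  ultimately show ?thesis using adj_compose by fastforce
qed

text \<open>
  Slices of a square integrable function are square integrable for almost every \<open>p\<close> only; for the
  other \<open>p\<close> the integral may take the default value \<open>0\<close>, which does no harm to measurability.
\<close>

lemma l2_fibered_kernel:
  fixes k :: "'b \<times> 'a \<Rightarrow> real^'n^'m"
  assumes fin: "finite_measure P" "finite_measure M" "finite_measure N"
    and k: "ess_bounded (N \<Otimes>\<^sub>M M) k" and w: "w \<in> l2 (P \<Otimes>\<^sub>M M)"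
  shows "(\<lambda>(p, y). \<integral>x. k (y, x) *v w (p, x) \<partial>M) \<in> l2 (P \<Otimes>\<^sub>M N)"
proof -
  interpret P: finite_measure P by fact
  interpret M: finite_measure M by fact
  interpret N: finite_measure N by fact
  interpret PM: pair_sigma_finite P M ..
  interpret PN: pair_sigma_finite P N ..
  interpret NM: pair_sigma_finite N M ..
  obtain C where C: "0 \<le> C" "AE z in N \<Otimes>\<^sub>M M. \<forall>v. norm (k z *v v) \<le> C * norm v"
    using ess_bounded_matrix_bound[OF k] by blast
  have [measurable]: "k \<in> borel_measurable (N \<Otimes>\<^sub>M M)" using k by (simp add: ess_bounded_def)
  have [measurable]: "w \<in> borel_measurable (P \<Otimes>\<^sub>M M)" using w by (rule l2_measurable)
  let ?F = "\<lambda>(p, y). \<integral>x. k (y, x) *v w (p, x) \<partial>M"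
  define W where "W p = C\<^sup>2 * (measure M (space M) * (\<integral>x. (norm (w (p, x)))\<^sup>2 \<partial>M))" for p
  show ?thesis
  proof (rule l2_boundedI)
    show F: "?F \<in> borel_measurable (P \<Otimes>\<^sub>M N)" by measurable
    have W: "integrable P W"
      using PM.integrable_fst'[OF l2_integrable_power2[OF w]] by (simp add: W_def[abs_def])
    show "integrable (P \<Otimes>\<^sub>M N) (\<lambda>z. W (fst z))"
      by (rule integrable_lift(1)[OF fin(1,3) W])
    have [measurable]: "W \<in> borel_measurable P" using W by auto
    show "AE z in P \<Otimes>\<^sub>M N. (norm (?F z))\<^sup>2 \<le> W (fst z)"
    proof (rule PN.AE_pair_measure)
      show "{z \<in> space (P \<Otimes>\<^sub>M N). (norm (?F z))\<^sup>2 \<le> W (fst z)} \<in> sets (P \<Otimes>\<^sub>M N)"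
        using F by measurable
      show "AE p in P. AE y in N. (norm (?F (p, y)))\<^sup>2 \<le> W (fst (p, y))"
        using l2_slice[OF fin(1,2) w]
      proof eventually_elim
        case (elim p)
        note wp = elim
        from NM.AE_pair[OF C(2)] show ?case
        proof eventually_elim
          case (elim y)
          have "norm (\<integral>x. k (y, x) *v w (p, x) \<partial>M) \<le> (\<integral>x. norm (k (y, x) *v w (p, x)) \<partial>M)"
            by (rule integral_norm_bound)
          also have "\<dots> \<le> (\<integral>x. C * norm (w (p, x)) \<partial>M)"
            by (rule integral_mono_AE')
              (use elim l2_integrable_norm[OF fin(2) wp] C(1) in \<open>auto elim!: eventually_mono\<close>)
          finally have "(norm (\<integral>x. k (y, x) *v w (p, x) \<partial>M))\<^sup>2 \<le> (C * (\<integral>x. norm (w (p, x)) \<partial>M))\<^sup>2"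
            by (intro power_mono) simp_all
          also have "\<dots> = C\<^sup>2 * (\<integral>x. norm (w (p, x)) \<partial>M)\<^sup>2" by (simp add: power_mult_distrib)
          also have "\<dots> \<le> W p"
            unfolding W_def by (intro mult_left_mono integral_norm_power2_le[OF fin(2) wp]) simp
          finally show ?case by simp
        qed
      qed
    qed
  qed
qed

text \<open>
  The variable \<open>p\<close> is a parameter: the adjoint relation holds on almost every slice by \<open>adj_kernel\<close> and
  is integrated over \<open>p\<close>.
\<close>

lemma adjointable_fibered_kernel:
  fixes k :: "'b \<times> 'a \<Rightarrow> real^'n^'m"
  assumes fin: "finite_measure P" "finite_measure M" "finite_measure N"
    and k: "ess_bounded (N \<Otimes>\<^sub>M M) k"
  shows "adjointable (P \<Otimes>\<^sub>M M) (P \<Otimes>\<^sub>M N) (\<lambda>w (p, y). \<integral>x. k (y, x) *v w (p, x) \<partial>M)"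
proof -
  interpret P: finite_measure P by fact
  interpret M: finite_measure M by fact
  interpret N: finite_measure N by fact
  interpret PM: pair_sigma_finite P M ..
  interpret PN: pair_sigma_finite P N ..
  have k': "ess_bounded (M \<Otimes>\<^sub>M N) (\<lambda>(x, y). transpose (k (y, x)))"
    by (rule ess_bounded_swap_transpose[OF fin(2,3) k])
  let ?F = "\<lambda>w (p, y). \<integral>x. k (y, x) *v w (p, x) \<partial>M" and ?G = "\<lambda>z (p, x). \<integral>y. transpose (k (y, x)) *v z (p, y) \<partial>N"
  have F: "?F w \<in> l2 (P \<Otimes>\<^sub>M N)" if "w \<in> l2 (P \<Otimes>\<^sub>M M)" for w
    by (rule l2_fibered_kernel[OF fin k that])
  have G: "?G z \<in> l2 (P \<Otimes>\<^sub>M M)" if "z \<in> l2 (P \<Otimes>\<^sub>M N)" for z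
    using l2_fibered_kernel[OF fin(1,3,2) k' that] by simp
  have "ip_l2 (P \<Otimes>\<^sub>M N) (?F w) z = ip_l2 (P \<Otimes>\<^sub>M M) w (?G z)"
    if w: "w \<in> l2 (P \<Otimes>\<^sub>M M)" and z: "z \<in> l2 (P \<Otimes>\<^sub>M N)" for w z
  proof -
    have "ip_l2 (P \<Otimes>\<^sub>M N) (?F w) z = (\<integral>p. (\<integral>y. ?F w (p, y) \<bullet> z (p, y) \<partial>N) \<partial>P)"
      unfolding ip_l2_def by (rule PN.integral_fst'[OF l2_integrable_inner[OF F[OF w] z], symmetric])
    also have "\<dots> = (\<integral>p. (\<integral>x. w (p, x) \<bullet> ?G z (p, x) \<partial>M) \<partial>P)"
    proof (rule integral_cong_AE)
      show "(\<lambda>p. \<integral>y. ?F w (p, y) \<bullet> z (p, y) \<partial>N) \<in> borel_measurable P"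
        using PN.integrable_fst'[OF l2_integrable_inner[OF F[OF w] z]] by auto
      show "(\<lambda>p. \<integral>x. w (p, x) \<bullet> ?G z (p, x) \<partial>M) \<in> borel_measurable P"
        using PM.integrable_fst'[OF l2_integrable_inner[OF w G[OF z]]] by auto
      show "AE p in P. (\<integral>y. ?F w (p, y) \<bullet> z (p, y) \<partial>N) = (\<integral>x. w (p, x) \<bullet> ?G z (p, x) \<partial>M)"
        using l2_slice[OF fin(1,2) w] l2_slice[OF fin(1,3) z]
        by eventually_elim (use adj_kernel[OF fin(2,3) k] in \<open>simp add: adj_def ip_l2_def\<close>)
    qed
    also have "\<dots> = ip_l2 (P \<Otimes>\<^sub>M M) w (?G z)"
      unfolding ip_l2_def by (rule PM.integral_fst'[OF l2_integrable_inner[OF w G[OF z]]])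
    finally show ?thesis .
  qed
  then show ?thesis
    unfolding adjointable_def using F G by (intro exI[of _ ?G]) (simp add: adj_def)
qed


section \<open>Lebesgue measure on intervals and rectangles\<close>

abbreviation leb :: "'d::euclidean_space set \<Rightarrow> 'd measure"
  where "leb S \<equiv> restrict_space lborel S"

lemma space_leb [simp]: "space (leb S) = S"
  by (simp add: space_restrict_space)

lemma set_integral_leb:
  fixes f :: "'d::euclidean_space \<Rightarrow> 'e::euclidean_space"
  shows "S \<in> sets borel \<Longrightarrow> (LINT x:S|lborel. f x) = (\<integral>x. f x \<partial>leb S)"
  by (simp add: set_lebesgue_integral_def integral_restrict_space)

lemma set_integrable_leb:
  fixes f :: "'d::euclidean_space \<Rightarrow> 'e::euclidean_space"
  shows "S \<in> sets borel \<Longrightarrow> set_integrable lborel S f \<longleftrightarrow> integrable (leb S) f"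
  by (simp add: set_integrable_def integrable_restrict_space)

lemma set_measurable_leb:
  fixes f :: "'d::euclidean_space \<Rightarrow> 'e::euclidean_space"
  shows "S \<in> sets borel \<Longrightarrow> set_borel_measurable lborel S f \<longleftrightarrow> f \<in> borel_measurable (leb S)"
  by (simp add: set_borel_measurable_def borel_measurable_restrict_space_iff)

lemma AE_leb: "S \<in> sets borel \<Longrightarrow> (AE x in leb S. Q x) \<longleftrightarrow> (AE x\<in>S in lborel. Q x)"
  by (simp add: AE_restrict_space_iff)

lemma measurable_leb: "f \<in> borel_measurable borel \<Longrightarrow> f \<in> borel_measurable (leb S)"
  by (rule measurable_restrict_space1) simp

lemma ident_leb: "(\<lambda>x. x) \<in> borel_measurable (leb S)"
  by (rule measurable_leb) simp

lemma fst_leb: "fst \<in> borel_measurable (leb S \<Otimes>\<^sub>M M)"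
  and snd_leb: "snd \<in> borel_measurable (M \<Otimes>\<^sub>M leb S)"
  by (rule measurable_compose[OF measurable_fst ident_leb] measurable_compose[OF measurable_snd ident_leb])+

lemma AE_leb_mem: "AE x in leb S. x \<in> S"
  using AE_space[of "leb S"] by simp

lemma set_integral_subset_leb:
  fixes f :: "'d::euclidean_space \<Rightarrow> 'e::euclidean_space"
  assumes "S \<in> sets borel" "T \<in> sets borel" "S \<subseteq> T"
  shows "(LINT x:S|lborel. f x) = (\<integral>x. (if x \<in> S then f x else 0) \<partial>leb T)"
proof -
  have "indicator S x *\<^sub>R f x = indicator T x *\<^sub>R (if x \<in> S then f x else 0)" for x
    using assms(3) by (auto simp: indicator_def)
  then show ?thesis
    using assms(2) by (simp add: set_lebesgue_integral_def integral_restrict_space)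
qed

lemma L2_space_leb: "S \<in> sets borel \<Longrightarrow> L2_space S = l2 (leb S)"
  by (auto simp: L2_space_def l2_def set_integrable_leb set_measurable_leb)

lemma L2_inner_leb: "S \<in> sets borel \<Longrightarrow> L2_inner S = ip_l2 (leb S)"
  by (simp add: L2_inner_def ip_l2_def fun_eq_iff set_integral_leb)

lemma L2_norm_leb: "S \<in> sets borel \<Longrightarrow> L2_norm S = l2.nrm (leb S)"
  by (simp add: L2_norm_def nrm_l2 fun_eq_iff set_integral_leb)

lemma Linf_space_leb: "S \<in> sets borel \<Longrightarrow> f \<in> Linf_space S \<Longrightarrow> ess_bounded (leb S) f"
  by (auto simp: Linf_space_def set_measurable_leb AE_leb intro: ess_boundedI)

lemma finite_leb: "S \<in> sets borel \<Longrightarrow> bounded S \<Longrightarrow> finite_measure (leb S)"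
  using emeasure_bounded_finite[of S] by (intro finite_measureI) (simp add: emeasure_restrict_space less_top)

lemma finite_leb_interval: "finite_measure (leb {a..b :: real})"
  by (rule finite_leb) auto

interpretation interval: finite_measure "leb {a..b :: real}" for a b
  by (rule finite_leb_interval)

interpretation intervals: pair_sigma_finite "leb {a..b :: real}" "leb {c..d :: real}" for a b c d ..

text \<open>
  This makes Fubini's theorem for product measures available on rectangles.
\<close>

lemma leb_Times:
  fixes S :: "'d::euclidean_space set" and T :: "'f::euclidean_space set"
  assumes [measurable]: "S \<in> sets borel" "T \<in> sets borel"
  shows "leb (S \<times> T) = leb S \<Otimes>\<^sub>M leb T"
proof (rule pair_measure_eqI[symmetric])
  show "sigma_finite_measure (leb S)" "sigma_finite_measure (leb T)"
    by (auto intro!: sigma_finite_measure_restrict_space lborel.sigma_finite_measure_axioms)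
  have ST: "S \<times> T \<in> sets borel" by (simp add: borel_Times)
  show "sets (leb S \<Otimes>\<^sub>M leb T) = sets (leb (S \<times> T))"
  proof (rule antisym)
    show "sets (leb S \<Otimes>\<^sub>M leb T) \<subseteq> sets (leb (S \<times> T))"
    proof (rule sets_pair_in_sets)
      fix A B assume "A \<in> sets (leb S)" "B \<in> sets (leb T)"
      then show "A \<times> B \<in> sets (leb (S \<times> T))"
        by (auto simp: sets_restrict_space_iff ST borel_Times)
    qed
    have id: "(\<lambda>z. z) \<in> measurable (leb S \<Otimes>\<^sub>M leb T) (lborel \<Otimes>\<^sub>M lborel)"
    proof (rule measurable_Pair_compose_split[of "\<lambda>x y. (x, y)" lborel lborel "lborel \<Otimes>\<^sub>M lborel" fst _ snd, simplified])
      show "fst \<in> measurable (leb S \<Otimes>\<^sub>M leb T) borel" "snd \<in> measurable (leb S \<Otimes>\<^sub>M leb T) borel"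
        by (rule fst_leb snd_leb)+
    qed
    show "sets (leb (S \<times> T)) \<subseteq> sets (leb S \<Otimes>\<^sub>M leb T)"
    proof
      fix A assume "A \<in> sets (leb (S \<times> T))"
      then have A: "A \<subseteq> S \<times> T" "A \<in> sets lborel"
        by (auto simp: sets_restrict_space_iff ST)
      note A = A(1) A(2)[folded lborel_prod]
      have "(\<lambda>z. z) -` A \<inter> space (leb S \<Otimes>\<^sub>M leb T) \<in> sets (leb S \<Otimes>\<^sub>M leb T)"
        by (rule measurable_sets[OF id A(2)])
      moreover have "(\<lambda>z. z) -` A \<inter> space (leb S \<Otimes>\<^sub>M leb T) = A"
        using A(1) by (auto simp: space_pair_measure)
      ultimately show "A \<in> sets (leb S \<Otimes>\<^sub>M leb T)" by simp
    qed
  qed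
  fix A B assume "A \<in> sets (leb S)" "B \<in> sets (leb T)"
  then have *: "A \<subseteq> S" "B \<subseteq> T" "A \<in> sets borel" "B \<in> sets borel"
    by (auto simp: sets_restrict_space_iff)
  have "emeasure (lborel \<Otimes>\<^sub>M lborel) (A \<times> B) = emeasure lborel A * emeasure lborel B"
    using * by (intro lborel.emeasure_pair_measure_Times) auto
  then show "emeasure (leb S) A * emeasure (leb T) B = emeasure (leb (S \<times> T)) (A \<times> B)"
    using * ST by (subst emeasure_restrict_space) (auto simp: emeasure_restrict_space lborel_prod)
qed

lemma leb_rect: "leb (rect a b) = leb {0..1} \<Otimes>\<^sub>M leb {a..b}"
  by (rule leb_Times) auto

lemma rect_borel [measurable]: "rect a b \<in> sets borel"
  by (simp add: borel_Times)

lemma finite_leb_rect: "finite_measure (leb (rect a b))"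
  by (rule finite_leb) (auto intro: bounded_Times)

lemma ess_bounded_continuous:
  fixes k :: "'d::euclidean_space \<Rightarrow> 'e::euclidean_space"
  assumes "compact S" "continuous_on S k"
  shows "ess_bounded (leb S) k"
proof -
  have S: "S \<in> sets borel" using assms(1) by (simp add: borel_compact)
  obtain C where C: "\<And>x. x \<in> S \<Longrightarrow> norm (k x) \<le> C"
    using compact_imp_bounded[OF compact_continuous_image[OF assms(2,1)]] by (auto simp: bounded_iff)
  show ?thesis
  proof (rule ess_boundedI)
    show "k \<in> borel_measurable (leb S)"
      using borel_measurable_continuous_on_indicator[OF S assms(2)]
      by (simp add: borel_measurable_restrict_space_iff S)
    show "AE x in leb S. norm (k x) \<le> C" using C by (intro AE_I2) simp
  qed
qed

lemma l2_continuous: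
  fixes k :: "'d::euclidean_space \<Rightarrow> 'e::euclidean_space"
  assumes "compact S" "continuous_on S k"
  shows "k \<in> l2 (leb S)"
proof -
  have S: "S \<in> sets borel" using assms(1) by (simp add: borel_compact)
  interpret finite_measure "leb S" by (rule finite_leb[OF S compact_imp_bounded[OF assms(1)]])
  obtain C where k: "k \<in> borel_measurable (leb S)" and C: "AE x in leb S. norm (k x) \<le> C"
    using ess_bounded_continuous[OF assms] by (auto simp: ess_bounded_def)
  show ?thesis
    by (rule l2_boundedI[OF k, of "\<lambda>_. C\<^sup>2"]) (use C in \<open>auto elim!: eventually_mono intro!: power_mono\<close>)
qed


section \<open>Adjoints of 3-PI operators\<close>

text \<open>
  With the triangular parts of the kernels, the integrals over \<open>[a, x]\<close> and \<open>[x, b]\<close> in a 3-PI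
  operator become integrals over the fixed interval \<open>[a, b]\<close>.
\<close>

definition lower_part :: "(real \<times> real \<Rightarrow> real^'n^'m) \<Rightarrow> real \<times> real \<Rightarrow> real^'n^'m"
  where "lower_part k = (\<lambda>z. if snd z \<le> fst z then k z else 0)"

definition upper_part :: "(real \<times> real \<Rightarrow> real^'n^'m) \<Rightarrow> real \<times> real \<Rightarrow> real^'n^'m"
  where "upper_part k = (\<lambda>z. if fst z \<le> snd z then k z else 0)"

definition pi3_ess_bounded :: "real \<Rightarrow> real \<Rightarrow> 'n::finite pi3 \<Rightarrow> bool"
  where "pi3_ess_bounded a b R \<longleftrightarrow> ess_bounded (leb {a..b}) (par0 R) \<and>
    ess_bounded (leb {a..b} \<Otimes>\<^sub>M leb {a..b}) (par1 R) \<and> ess_bounded (leb {a..b} \<Otimes>\<^sub>M leb {a..b}) (par2 R)"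

lemma pred_le_pair:
  "Measurable.pred (leb {a..b :: real} \<Otimes>\<^sub>M leb {c..d :: real}) (\<lambda>z. snd z \<le> fst z)"
  "Measurable.pred (leb {a..b :: real} \<Otimes>\<^sub>M leb {c..d :: real}) (\<lambda>z. fst z \<le> snd z)"
proof -
  note [measurable] = fst_leb[of "{a..b}" "leb {c..d}"] snd_leb[of "leb {a..b}" "{c..d}"]
  show "Measurable.pred (leb {a..b :: real} \<Otimes>\<^sub>M leb {c..d :: real}) (\<lambda>z. snd z \<le> fst z)"
    "Measurable.pred (leb {a..b :: real} \<Otimes>\<^sub>M leb {c..d :: real}) (\<lambda>z. fst z \<le> snd z)"
    by measurable
qed

lemma ess_bounded_zero: "ess_bounded M (\<lambda>_. 0)"
  by (rule ess_boundedI[of _ _ 0]) auto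

lemma ess_bounded_triangular_parts:
  assumes "pi3_ess_bounded a b R"
  shows "ess_bounded (leb {a..b} \<Otimes>\<^sub>M leb {a..b}) (lower_part (par1 R))"
    "ess_bounded (leb {a..b} \<Otimes>\<^sub>M leb {a..b}) (upper_part (par2 R))"
  using assms unfolding lower_part_def upper_part_def pi3_ess_bounded_def
  by (auto intro!: ess_bounded_if pred_le_pair ess_bounded_zero)

lemma pi3_op_kernels:
  assumes x: "x \<in> {a..b}"
  shows "pi3_op a b R u x = par0 R x *v u x + (\<integral>\<theta>. lower_part (par1 R) (x, \<theta>) *v u \<theta> \<partial>leb {a..b})
      + (\<integral>\<theta>. upper_part (par2 R) (x, \<theta>) *v u \<theta> \<partial>leb {a..b})"
proof -
  have "(LINT \<theta>:{a..x}|lborel. par1 R (x, \<theta>) *v u \<theta>) = (\<integral>\<theta>. lower_part (par1 R) (x, \<theta>) *v u \<theta> \<partial>leb {a..b})"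
    using x by (subst set_integral_subset_leb[of _ "{a..b}"])
      (auto simp: lower_part_def if_distrib[where f="\<lambda>A. A *v _"] cong: if_cong intro!: Bochner_Integration.integral_cong)
  moreover have "(LINT \<theta>:{x..b}|lborel. par2 R (x, \<theta>) *v u \<theta>) = (\<integral>\<theta>. upper_part (par2 R) (x, \<theta>) *v u \<theta> \<partial>leb {a..b})"
    using x by (subst set_integral_subset_leb[of _ "{a..b}"])
      (auto simp: upper_part_def if_distrib[where f="\<lambda>A. A *v _"] cong: if_cong intro!: Bochner_Integration.integral_cong)
  ultimately show ?thesis by (simp add: pi3_op_def)
qed

lemma adjointable_pi3_op:
  assumes R: "pi3_ess_bounded a b R"
  shows "adjointable (leb {a..b}) (leb {a..b}) (pi3_op a b R)"
proof (rule adjointable_cong)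
  note fin = finite_leb_interval
  show "adjointable (leb {a..b}) (leb {a..b}) (\<lambda>u x. (par0 R x *v u x
      + (\<integral>\<theta>. lower_part (par1 R) (x, \<theta>) *v u \<theta> \<partial>leb {a..b})) + (\<integral>\<theta>. upper_part (par2 R) (x, \<theta>) *v u \<theta> \<partial>leb {a..b}))"
    using adj_mult[of "leb {a..b}" "par0 R"] adj_kernel[OF fin fin ess_bounded_triangular_parts(1)[OF R]]
      adj_kernel[OF fin fin ess_bounded_triangular_parts(2)[OF R]] R
    by (intro adjointable_add) (auto simp: adjointable_def pi3_ess_bounded_def)
qed (simp add: pi3_op_kernels)

lemma adjointable_fibered_pi3_op:
  assumes R: "pi3_ess_bounded a b R"
  shows "adjointable (leb (rect a b)) (leb (rect a b)) (\<lambda>w (s, x). pi3_op a b R (\<lambda>y. w (s, y)) x)"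
proof (rule adjointable_cong)
  note fin = finite_leb_interval
  let ?L = "\<lambda>w (s, x). \<integral>\<theta>. lower_part (par1 R) (x, \<theta>) *v w (s, \<theta>) \<partial>leb {a..b}"
  let ?U = "\<lambda>w (s, x). \<integral>\<theta>. upper_part (par2 R) (x, \<theta>) *v w (s, \<theta>) \<partial>leb {a..b}"
  have "ess_bounded (leb (rect a b)) (\<lambda>z. par0 R (snd z))"
    unfolding leb_rect using R by (intro ess_bounded_snd fin) (simp add: pi3_ess_bounded_def)
  then show "adjointable (leb (rect a b)) (leb (rect a b)) (\<lambda>w z. (par0 R (snd z) *v w z + ?L w z) + ?U w z)"
    using adj_mult[of "leb (rect a b)" "\<lambda>z. par0 R (snd z)"]
      adjointable_fibered_kernel[OF fin[of 0 1] fin fin ess_bounded_triangular_parts(1)[OF R]]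
      adjointable_fibered_kernel[OF fin[of 0 1] fin fin ess_bounded_triangular_parts(2)[OF R]]
    unfolding leb_rect by (intro adjointable_add) (auto simp: adjointable_def)
qed (auto simp: pi3_op_kernels)


section \<open>Adjoints of the operators of the PIE\<close>

lemma Z_space_l2: "Z_space a b = l2 (leb {a..b}) \<times> l2 (leb (rect a b))"
  by (simp add: Z_space_def L2_space_leb)

lemma Z_inner_l2:
  "Z_inner a b w z = ip_l2 (leb {a..b}) (fst w) (fst z) + ip_l2 (leb (rect a b)) (snd w) (snd z)"
  by (simp add: Z_inner_def L2_inner_leb)

lemma ex_adjoint_block:
  assumes "adjointable (leb {a..b}) (leb {a..b}) F11" "adjointable (leb (rect a b)) (leb {a..b}) F12"
    "adjointable (leb {a..b}) (leb (rect a b)) F21" "adjointable (leb (rect a b)) (leb (rect a b)) F22"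
  shows "\<exists>G. is_adjoint a b (\<lambda>(v, w). (\<lambda>x. F11 v x + F12 w x, \<lambda>z. F21 v z + F22 w z)) G"
proof -
  obtain G11 G12 G21 G22 where G: "adj (leb {a..b}) (leb {a..b}) F11 G11" "adj (leb (rect a b)) (leb {a..b}) F12 G12"
    "adj (leb {a..b}) (leb (rect a b)) F21 G21" "adj (leb (rect a b)) (leb (rect a b)) F22 G22"
    using assms by (auto simp: adjointable_def)
  let ?G = "\<lambda>(p, q). (\<lambda>x. G11 p x + G21 q x, \<lambda>z. G12 p z + G22 q z)"
  have "is_adjoint a b (\<lambda>(v, w). (\<lambda>x. F11 v x + F12 w x, \<lambda>z. F21 v z + F22 w z)) ?G"
    using G unfolding is_adjoint_def Z_space_l2 Z_inner_l2 adj_def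
    by (auto intro!: l2_add simp: l2.ip_add_left l2.ip_add_right)
  then show ?thesis by blast
qed

lemma adjointable_zero: "adjointable M N (\<lambda>_ _. 0)"
  unfolding adjointable_def adj_def by (intro exI[of _ "\<lambda>_ _. 0"]) (simp add: ip_l2_def l2_def)

lemma mat_eq_scaleR: "(mat c :: real^'n^'n) = c *\<^sub>R mat 1"
  by (auto simp: mat_def vec_eq_iff)

lemma K_mat_affine: "K_mat a x = K_mat a a + (x - a) *\<^sub>R (mat 0 \<parallel> mat 1)"
  unfolding K_mat_def by (auto simp: hstack_def vstack_def mat_def vec_eq_iff split: sum.split)

lemma Q_mat_affine: "Q_mat b \<theta> = Q_mat b b + (b - \<theta>) *\<^sub>R (mat 0 \<oplus> mat 1 \<oplus> mat 0 \<oplus> mat 0)"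
  unfolding Q_mat_def by (auto simp: vstack_def mat_def vec_eq_iff split: sum.split)

text \<open>
  The kernels \<open>\<partial>\<^sub>x T\<^sub>2\<close> and \<open>\<partial>\<^sub>x T\<^sub>1\<close>.
\<close>

definition T2x_ker :: "real \<Rightarrow> real \<Rightarrow> real ^ ('n + 'n + 'n + 'n) ^ ('n + 'n) \<Rightarrow> real \<times> real \<Rightarrow> real ^ 'n ^ 'n::finite"
  where "T2x_ker a b B = (\<lambda>(x, \<theta>). - ((mat 0 \<parallel> mat 1) ** (matrix_inv (B ** H_mat a b) ** B) ** Q_mat b \<theta>))"

definition T1x_ker :: "real \<Rightarrow> real \<Rightarrow> real ^ ('n + 'n + 'n + 'n) ^ ('n + 'n) \<Rightarrow> real \<times> real \<Rightarrow> real ^ 'n ^ 'n::finite"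
  where "T1x_ker a b B = (\<lambda>z. mat 1 + T2x_ker a b B z)"

text \<open>
  Since \<open>K(x)\<close> is affine in \<open>x\<close>, so is \<open>T\<^sub>2\<close>; its derivative in \<open>x\<close> and its continuity can be read off.
\<close>

lemma T2_ker_affine: "T2_ker a b B (x, \<theta>) = T2_ker a b B (a, \<theta>) + (x - a) *\<^sub>R T2x_ker a b B (x, \<theta>)"
proof -
  interpret bounded_bilinear "\<lambda>(A :: real^('n+'n)^'n) (B :: real^'n^('n+'n)). A ** B" by (rule bounded_bilinear_matrix_mult)
  show ?thesis
    unfolding T2_ker_def T2x_ker_def
    by (simp add: matrix_mul_assoc[symmetric] K_mat_affine[of a x] add_left scaleR_left)
qed

lemma T2_ker_deriv: "((\<lambda>y. T2_ker a b B (y, \<theta>)) has_vector_derivative T2x_ker a b B (x, \<theta>)) (at x)"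
proof -
  have "((\<lambda>y. T2_ker a b B (a, \<theta>) + (y - a) *\<^sub>R T2x_ker a b B (x, \<theta>)) has_vector_derivative T2x_ker a b B (x, \<theta>)) (at x)"
    by (auto intro!: derivative_eq_intros)
  moreover have "T2x_ker a b B (y, \<theta>) = T2x_ker a b B (x, \<theta>)" for y by (simp add: T2x_ker_def)
  then have "(\<lambda>y. T2_ker a b B (a, \<theta>) + (y - a) *\<^sub>R T2x_ker a b B (x, \<theta>)) = (\<lambda>y. T2_ker a b B (y, \<theta>))"
    by (intro ext) (metis T2_ker_affine)
  ultimately show ?thesis by simp
qed

lemma T1_ker_deriv: "((\<lambda>y. T1_ker a b B (y, \<theta>)) has_vector_derivative T1x_ker a b B (x, \<theta>)) (at x)"
proof -
  have "((\<lambda>y. (y - \<theta>) *\<^sub>R mat 1 + T2_ker a b B (y, \<theta>)) has_vector_derivative 1 *\<^sub>R mat 1 + T2x_ker a b B (x, \<theta>)) (at x)"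
    by (auto intro!: derivative_eq_intros T2_ker_deriv)
  then show ?thesis
    unfolding T1_ker_def T1x_ker_def by (simp add: mat_eq_scaleR[symmetric])
qed

lemma A_ker_T1: "A_ker A (T1_ker a b B) = (\<lambda>z. A (fst z) ** (T1_ker a b B z \<oplus> T1x_ker a b B z \<oplus> mat 0))"
  and A_ker_T2: "A_ker A (T2_ker a b B) = (\<lambda>z. A (fst z) ** (T2_ker a b B z \<oplus> T2x_ker a b B z \<oplus> mat 0))"
  unfolding A_ker_def
  by (auto simp: fun_eq_iff vector_derivative_at[OF T1_ker_deriv] vector_derivative_at[OF T2_ker_deriv])

lemma continuous_on_vstack:
  "continuous_on S f \<Longrightarrow> continuous_on S g \<Longrightarrow> continuous_on S (\<lambda>x. f x \<oplus> g x)"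
  for f :: "'a::topological_space \<Rightarrow> 'e::real_normed_vector ^ 'p" and g :: "'a \<Rightarrow> 'e ^ 'q"
  unfolding vstack_def
proof (intro continuous_on_vec_lambda)
  fix i assume "continuous_on S f" "continuous_on S g"
  then show "continuous_on S (\<lambda>x. case i of Inl j \<Rightarrow> f x $ j | Inr j \<Rightarrow> g x $ j)"
    by (cases i) (auto intro!: continuous_intros)
qed

lemma continuous_on_T2x_ker: "continuous_on S (T2x_ker a b B :: _ \<Rightarrow> real^'n^'n)"
proof -
  interpret bounded_bilinear "\<lambda>(A :: real^('n+'n+'n+'n)^'n) (B :: real^'n^('n+'n+'n+'n)). A ** B"
    by (rule bounded_bilinear_matrix_mult)
  have "(T2x_ker a b B :: _ \<Rightarrow> real^'n^'n) = (\<lambda>z. - ((mat 0 \<parallel> mat 1) ** (matrix_inv (B ** H_mat a b) ** B) **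
      (Q_mat b b + (b - snd z) *\<^sub>R (mat 0 \<oplus> mat 1 \<oplus> mat 0 \<oplus> mat 0))))"
    unfolding T2x_ker_def by (subst Q_mat_affine) (simp add: split_beta')
  then show ?thesis by (auto intro!: continuous_intros continuous_on)
qed

lemma continuous_on_T2_ker: "continuous_on S (T2_ker a b B :: _ \<Rightarrow> real^'n^'n)"
proof -
  interpret bounded_bilinear "\<lambda>(A :: real^('n+'n+'n+'n)^'n) (B :: real^'n^('n+'n+'n+'n)). A ** B"
    by (rule bounded_bilinear_matrix_mult)
  have "(T2_ker a b B :: _ \<Rightarrow> real^'n^'n) = (\<lambda>z. - (K_mat a a ** matrix_inv (B ** H_mat a b) ** B **
      (Q_mat b b + (b - snd z) *\<^sub>R (mat 0 \<oplus> mat 1 \<oplus> mat 0 \<oplus> mat 0))) + (fst z - a) *\<^sub>R T2x_ker a b B z)"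
  proof
    fix z :: "real \<times> real"
    show "T2_ker a b B z = - (K_mat a a ** matrix_inv (B ** H_mat a b) ** B **
      (Q_mat b b + (b - snd z) *\<^sub>R (mat 0 \<oplus> mat 1 \<oplus> mat 0 \<oplus> mat 0))) + (fst z - a) *\<^sub>R T2x_ker a b B z"
      unfolding Q_mat_affine[of b "snd z", symmetric]
      using T2_ker_affine[of a b B "fst z" "snd z"] by (simp add: T2_ker_def[of a b B] split_beta')
  qed
  then show ?thesis by (auto intro!: continuous_intros continuous_on continuous_on_T2x_ker)
qed

lemma continuous_on_T1_ker: "continuous_on S (T1_ker a b B :: _ \<Rightarrow> real^'n^'n)"
proof -
  have "(T1_ker a b B :: _ \<Rightarrow> real^'n^'n) = (\<lambda>z. (fst z - snd z) *\<^sub>R mat 1 + T2_ker a b B z)"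
    unfolding T1_ker_def by (auto simp: fun_eq_iff mat_eq_scaleR[of "_ - _"])
  then show ?thesis by (auto intro!: continuous_intros continuous_on_T2_ker)
qed

lemma continuous_on_T1x_ker: "continuous_on S (T1x_ker a b B :: _ \<Rightarrow> real^'n^'n)"
  unfolding T1x_ker_def by (intro continuous_intros continuous_on_T2x_ker)

lemma ess_bounded_continuous_pair:
  fixes k :: "real \<times> real \<Rightarrow> 'e::euclidean_space"
  assumes "continuous_on UNIV k"
  shows "ess_bounded (leb {a..b} \<Otimes>\<^sub>M leb {c..d}) k"
  using ess_bounded_continuous[of "{a..b} \<times> {c..d}" k] continuous_on_subset[OF assms]
  by (simp add: leb_Times compact_Times)

definition T1_pi :: "real \<Rightarrow> real \<Rightarrow> real ^ ('n + 'n + 'n + 'n) ^ ('n + 'n) \<Rightarrow> 'n::finite pi3"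
  where "T1_pi a b B = PI3 (\<lambda>x. 0) (T1_ker a b B) (T2_ker a b B)"

definition A11_pi :: "real \<Rightarrow> real \<Rightarrow> real ^ ('n + 'n + 'n + 'n) ^ ('n + 'n) \<Rightarrow>
    (real \<Rightarrow> real ^ ('n + 'n + 'n) ^ 'n) \<Rightarrow> 'n::finite pi3"
  where "A11_pi a b B A = PI3 (\<lambda>x. A x ** (mat 0 \<oplus> mat 0 \<oplus> mat 1)) (A_ker A (T1_ker a b B)) (A_ker A (T2_ker a b B))"

lemma opT1_pi: "opT1 a b B = pi3_op a b (T1_pi a b B)"
  by (simp add: opT1_def T1_pi_def)

lemma opA11_pi: "opA11 a b B A = pi3_op a b (A11_pi a b B A)"
  by (simp add: opA11_def A11_pi_def)

lemma T1_pi_ess_bounded: "pi3_ess_bounded a b (T1_pi a b B)"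
  unfolding pi3_ess_bounded_def T1_pi_def
  by (simp add: ess_bounded_zero ess_bounded_continuous_pair continuous_on_T1_ker continuous_on_T2_ker)

lemma A11_pi_ess_bounded:
  fixes A :: "real \<Rightarrow> real ^ ('n + 'n + 'n) ^ 'n::finite"
  assumes "A \<in> Linf_space {a..b}"
  shows "pi3_ess_bounded a b (A11_pi a b B A)"
proof -
  have A: "ess_bounded (leb {a..b}) A" using assms by (intro Linf_space_leb) auto
  note A2 = ess_bounded_fst[OF finite_leb_interval finite_leb_interval A]
  note * = ess_bounded_bilinear[OF bounded_bilinear_matrix_mult]
  have "ess_bounded (leb {a..b}) (\<lambda>_. mat 0 \<oplus> mat 0 \<oplus> mat 1 :: real^'n^('n+'n+'n))"
    by (rule ess_bounded_continuous) (auto intro: continuous_on_const)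
  moreover have "ess_bounded (leb {a..b} \<Otimes>\<^sub>M leb {a..b}) (\<lambda>z. T1_ker a b B z \<oplus> T1x_ker a b B z \<oplus> mat 0)"
    "ess_bounded (leb {a..b} \<Otimes>\<^sub>M leb {a..b}) (\<lambda>z. T2_ker a b B z \<oplus> T2x_ker a b B z \<oplus> mat 0)"
    by (intro ess_bounded_continuous_pair continuous_on_vstack continuous_on_const
      continuous_on_T1_ker continuous_on_T2_ker continuous_on_T1x_ker continuous_on_T2x_ker)+
  ultimately show ?thesis
    unfolding pi3_ess_bounded_def A11_pi_def A_ker_T1 A_ker_T2 pi3.sel
    by (intro conjI *[OF A] *[OF A2])
qed

lemma lower_part_mat_1: "lower_part (\<lambda>_. mat 1) (s, \<theta>) *v y = (if \<theta> \<le> s then y else 0)"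
  by (simp add: lower_part_def)

text \<open>
  \<open>\<T>\<^sub>2\<close> applies \<open>\<T>\<^sub>1\<close> to every slice and then integrates from \<open>0\<close> to \<open>s\<close>.  The second step is a
  Volterra operator in the first variable; it is obtained from a fibered integral operator by
  exchanging the variables before and after.
\<close>

lemma adjointable_opT2:
  fixes B :: "real ^ ('n + 'n + 'n + 'n) ^ ('n::finite + 'n)"
  shows "adjointable (leb (rect a b)) (leb (rect a b)) (opT2 a b B)"
proof -
  note fin = finite_leb_interval
  let ?I = "leb {a..b}" and ?J = "leb {0..1::real}"
  let ?F = "\<lambda>w (s, x). pi3_op a b (T1_pi a b B) (\<lambda>y. w (s, y)) x"
  let ?V = "\<lambda>w (x, s). \<integral>\<theta>. lower_part (\<lambda>_. mat 1) (s, \<theta>) *v (w (x, \<theta>) :: real^'n) \<partial>?J"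
  have k: "ess_bounded (?J \<Otimes>\<^sub>M ?J) (lower_part (\<lambda>_. mat 1 :: real^'n^'n))"
    unfolding lower_part_def by (intro ess_bounded_if pred_le_pair ess_bounded_zero ess_bounded_continuous_pair continuous_on_const)
  let ?S = "\<lambda>f (y, x). f (x, y) :: real^'n"
  have V: "adjointable (?I \<Otimes>\<^sub>M ?J) (?I \<Otimes>\<^sub>M ?J) ?V"
    using adjointable_fibered_kernel[OF fin fin fin k] by blast
  have F: "adjointable (?J \<Otimes>\<^sub>M ?I) (?J \<Otimes>\<^sub>M ?I) ?F"
    using adjointable_fibered_pi3_op[OF T1_pi_ess_bounded[of a b B]] unfolding leb_rect .
  have S: "adjointable (?J \<Otimes>\<^sub>M ?I) (?I \<Otimes>\<^sub>M ?J) ?S" "adjointable (?I \<Otimes>\<^sub>M ?J) (?J \<Otimes>\<^sub>M ?I) ?S"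
    using adj_swap fin unfolding adjointable_def by blast+
  have "adjointable (?J \<Otimes>\<^sub>M ?I) (?J \<Otimes>\<^sub>M ?I)
      (\<lambda>w. ?S (?V (?S (?F w))))"
    by (rule adjointable_compose[OF adjointable_compose[OF adjointable_compose[OF F S(1)] V] S(2)])
  then show ?thesis
    unfolding leb_rect
  proof (rule adjointable_cong)
    fix w :: "real \<times> real \<Rightarrow> real^'n" and z :: "real \<times> real"
    assume "z \<in> space (?J \<Otimes>\<^sub>M ?I)"
    then obtain s x where z: "z = (s, x)" and s: "s \<in> {0..1}" by (cases z) (auto simp: space_pair_measure)
    have "opT2 a b B w z = (\<integral>\<theta>. (if \<theta> \<in> {0..s} then ?F w (\<theta>, x) else 0) \<partial>?J)"
      unfolding opT2_def z opT1_pi using s by (simp add: set_integral_subset_leb[of _ "{0..1}"] cong: if_cong)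
    also have "\<dots> = (\<integral>\<theta>. lower_part (\<lambda>_. mat 1) (s, \<theta>) *v (?F w (\<theta>, x)) \<partial>?J)"
      by (intro Bochner_Integration.integral_cong) (auto simp: lower_part_mat_1)
    finally show "opT2 a b B w z = ?S (?V (?S (?F w))) z"
      by (simp add: z)
  qed
qed

text \<open>
  \<open>Z_adjoint\<close> is a choice, about which something is known only if an adjoint exists.
\<close>

lemma ex_adjoint_opT:
  fixes B :: "real ^ ('n + 'n + 'n + 'n) ^ ('n::finite + 'n)"
  shows "\<exists>G. is_adjoint a b (opT a b B) G"
proof -
  let ?I = "leb {a..b}" and ?J = "leb {0..1::real}"
  have T1: "adjointable ?I ?I (opT1 a b B)"
    unfolding opT1_pi by (rule adjointable_pi3_op[OF T1_pi_ess_bounded])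
  have "adjointable ?I (leb (rect a b)) (\<lambda>v z. opT1 a b B v (snd z))"
    using adjointable_compose[OF T1] adj_commute[OF adj_average[OF finite_leb_interval[of a b] finite_leb_interval[of 0 1]]]
    unfolding leb_rect adjointable_def by blast
  from ex_adjoint_block[OF T1 adjointable_zero this adjointable_opT2] show ?thesis
    unfolding opT_def by (simp add: split_beta')
qed

lemma ex_adjoint_opA:
  fixes B :: "real ^ ('n + 'n + 'n + 'n) ^ ('n::finite + 'n)"
  assumes A: "A \<in> Linf_space {a..b}" and Ad: "Ad \<in> Linf_space {a..b}"
  shows "\<exists>G. is_adjoint a b (opA a b A Ad B \<tau>) G"
proof -
  let ?I = "leb {a..b}" and ?J = "leb {0..1::real}"
  have A11: "adjointable ?I ?I (opA11 a b B A)" "adjointable ?I ?I (opA11 a b B Ad)"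
    unfolding opA11_pi by (intro adjointable_pi3_op A11_pi_ess_bounded A Ad)+
  have "adjointable (leb (rect a b)) (leb (rect a b)) (\<lambda>w (s, x). opA11 a b B Ad (\<lambda>y. w (s, y)) x)"
    unfolding opA11_pi by (intro adjointable_fibered_pi3_op A11_pi_ess_bounded Ad)
  moreover have "adjointable (leb (rect a b)) ?I (\<lambda>(f :: _ \<Rightarrow> real^'n) x. \<integral>y. f (y, x) \<partial>?J)"
    using adj_average[OF finite_leb_interval[of a b] finite_leb_interval[of 0 1]]
    unfolding leb_rect adjointable_def by blast
  ultimately have "adjointable (leb (rect a b)) ?I
      (\<lambda>w x. \<integral>y. (\<lambda>(s, x). opA11 a b B Ad (\<lambda>y. w (s, y)) x) (y, x) \<partial>?J)"
    by (rule adjointable_compose)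
  then have A12: "adjointable (leb (rect a b)) ?I (opA12 a b B Ad)"
    by (rule adjointable_cong) (simp add: opA12_def set_integral_leb)
  have "adjointable (leb (rect a b)) (leb (rect a b))
      (\<lambda>w z. (- (1 / \<tau>)) *\<^sub>R (\<lambda>(s, x). pi3_op a b (T1_pi a b B) (\<lambda>y. w (s, y)) x) z)"
    by (intro adjointable_scaleR adjointable_fibered_pi3_op T1_pi_ess_bounded)
  then have A22: "adjointable (leb (rect a b)) (leb (rect a b)) (opA22 a b B \<tau>)"
    by (rule adjointable_cong) (auto simp: opA22_def opT1_pi)
  from ex_adjoint_block[OF adjointable_add[OF A11] A12 adjointable_zero A22] show ?thesis
    unfolding opA_def by (simp add: split_beta')
qed


section \<open>Smooth functions\<close>

lemma partial_deriv_eq: "(f has_derivative f') (at x) \<Longrightarrow> partial_deriv i f x = f' i"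
  unfolding partial_deriv_def using frechet_derivative_at by metis

lemma has_derivative_frechet: "f differentiable at x \<Longrightarrow> (f has_derivative frechet_derivative f (at x)) (at x)"
  by (simp add: frechet_derivative_works[symmetric])

lemma partial_deriv_real: "(g has_real_derivative d) (at x) \<Longrightarrow> partial_deriv 1 g x = d"
  by (simp add: partial_deriv_eq[of g "(*) d"] has_field_derivative_def)

lemma has_real_derivative_partial_deriv:
  "g differentiable at x \<Longrightarrow> (g has_real_derivative partial_deriv 1 g x) (at x)" for x :: real
  using partial_deriv_real real_differentiable_def by metis

lemma C_k_continuous: "C_k k f \<Longrightarrow> continuous_on UNIV f"
  by (cases k) (auto intro!: continuous_at_imp_continuous_on differentiable_imp_continuous_within)

lemma C_k_Suc_imp: "C_k (Suc k) f \<Longrightarrow> C_k k f"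
proof (induction k arbitrary: f)
  case 0
  from C_k_continuous[OF 0] show ?case by simp
next
  case (Suc k)
  then show ?case by (meson C_k.simps(2))
qed

lemma C_k_const: "C_k k (\<lambda>_. c)"
proof (induction k arbitrary: c)
  case (Suc k)
  have "partial_deriv i (\<lambda>_. c) = (\<lambda>_. 0)" for i :: 'a
    by (intro ext) (simp add: partial_deriv_def)
  then show ?case using Suc by simp
qed simp

lemma C_k_add: "C_k k f \<Longrightarrow> C_k k g \<Longrightarrow> C_k k (\<lambda>x. f x + g x)"
proof (induction k arbitrary: f g)
  case 0
  then show ?case by (simp add: continuous_on_add)
next
  case (Suc k)
  have "partial_deriv i (\<lambda>x. f x + g x) = (\<lambda>x. partial_deriv i f x + partial_deriv i g x)" for i
    using Suc.prems unfolding partial_deriv_def[of i f] partial_deriv_def[of i g]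
    by (intro ext partial_deriv_eq has_derivative_add has_derivative_frechet) auto
  then show ?case using Suc by auto
qed

lemma C_k_mult: "C_k k f \<Longrightarrow> C_k k g \<Longrightarrow> C_k k (\<lambda>x. f x * g x)"
proof (induction k arbitrary: f g)
  case 0
  then show ?case by (simp add: continuous_on_mult)
next
  case (Suc k)
  have "partial_deriv i (\<lambda>x. f x * g x) = (\<lambda>x. f x * partial_deriv i g x + partial_deriv i f x * g x)" for i
    using Suc.prems unfolding partial_deriv_def[of i f] partial_deriv_def[of i g]
    by (intro ext partial_deriv_eq has_derivative_mult has_derivative_frechet) auto
  moreover have "C_k k f" "C_k k g" using Suc.prems C_k_Suc_imp by blast+
  ultimately show ?case using Suc by (auto intro!: C_k_add)
qed

lemma C_k_uminus: "C_k k f \<Longrightarrow> C_k k (\<lambda>x. - f x)"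
  using C_k_mult[OF C_k_const[of k "- 1"]] by fastforce

lemma C_k_inverse: "C_k k f \<Longrightarrow> (\<And>x. f x \<noteq> 0) \<Longrightarrow> C_k k (\<lambda>x. inverse (f x))"
proof (induction k)
  case 0
  then show ?case by (simp add: continuous_on_inverse)
next
  case (Suc k)
  have "partial_deriv i (\<lambda>x. inverse (f x)) = (\<lambda>x. - (inverse (f x) * partial_deriv i f x * inverse (f x)))" for i
    using Suc.prems unfolding partial_deriv_def[of i f]
    by (intro ext) (subst partial_deriv_eq[OF Deriv.has_derivative_inverse[OF _ has_derivative_frechet]]; simp)
  moreover have "C_k k f" using Suc.prems C_k_Suc_imp by blast
  ultimately show ?case using Suc by (auto intro!: C_k_mult C_k_uminus simp: differentiable_inverse)
qed

lemma C_k_affine_comp: "C_k k g \<Longrightarrow> C_k k (\<lambda>x. g (c + m * (x \<bullet> e)))" for g :: "real \<Rightarrow> real"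
proof (induction k arbitrary: g)
  case 0
  then show ?case by (auto intro!: continuous_intros continuous_on_compose2[of UNIV g])
next
  case (Suc k)
  have d: "((\<lambda>x. g (c + m * (x \<bullet> e))) has_derivative (\<lambda>h. partial_deriv 1 g (c + m * (x \<bullet> e)) * (m * (h \<bullet> e)))) (at x)" for x
  proof -
    have 1: "((\<lambda>x. c + m * (x \<bullet> e)) has_derivative (\<lambda>h. m * (h \<bullet> e))) (at x)"
      by (auto intro!: derivative_eq_intros)
    have 2: "(g has_derivative (\<lambda>h. partial_deriv 1 g (c + m * (x \<bullet> e)) * h)) (at (c + m * (x \<bullet> e)))"
      using has_real_derivative_partial_deriv[of g] Suc.prems by (simp add: has_field_derivative_def)
    from has_derivative_compose[OF 1 2] show ?thesis .
  qed
  then have "partial_deriv i (\<lambda>x. g (c + m * (x \<bullet> e))) = (\<lambda>x. partial_deriv 1 g (c + m * (x \<bullet> e)) * (m * (i \<bullet> e)))" for i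
    by (intro ext partial_deriv_eq)
  moreover have "C_k k (\<lambda>x. partial_deriv 1 g (c + m * (x \<bullet> e)))"
    using Suc by simp
  moreover have "(\<lambda>x. g (c + m * (x \<bullet> e))) differentiable at x" for x
    using d differentiableI by blast
  ultimately show ?case by (auto intro!: C_k_mult C_k_const)
qed

lemma C_k_prod: "(\<And>i. i \<in> I \<Longrightarrow> C_k k (f i)) \<Longrightarrow> C_k k (\<lambda>x. \<Prod>i\<in>I. f i x)"
  by (induction I rule: infinite_finite_induct) (auto intro!: C_k_const C_k_mult)

subsection \<open>A smooth step\<close>

text \<open>
  Together with \<open>e\<^sup>-\<^sup>1\<^sup>/\<^sup>t\<close> the family contains its derivatives, up to linear combinations; hence all its
  members are smooth.
\<close>

definition flat_exp :: "nat \<Rightarrow> real \<Rightarrow> real"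
  where "flat_exp n t = (if t > 0 then (1 / t) ^ n * exp (- (1 / t)) else 0)"

lemma flat_exp_tendsto_0: "(flat_exp n \<longlongrightarrow> 0) (at 0)"
proof (rule filterlim_split_at)
  show "(flat_exp n \<longlongrightarrow> 0) (at_left 0)"
    by (rule tendsto_eventually) (auto simp: flat_exp_def eventually_at_filter)
  have "((\<lambda>t. (inverse t) ^ n / exp (inverse t)) \<longlongrightarrow> 0) (at_right (0::real))"
    by (rule filterlim_compose[OF tendsto_power_div_exp_0 filterlim_inverse_at_top_right])
  then show "(flat_exp n \<longlongrightarrow> 0) (at_right 0)"
  proof (rule Lim_transform_eventually)
    show "\<forall>\<^sub>F t in at_right 0. (inverse t) ^ n / exp (inverse t) = flat_exp n t"
      by (auto simp: flat_exp_def eventually_at_filter exp_minus divide_simps)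
  qed
qed

lemma flat_exp_deriv:
  "(flat_exp n has_real_derivative flat_exp (n + 2) t - real n * flat_exp (n + 1) t) (at t)"
proof (cases "t = 0")
  case True
  have "((\<lambda>h. (flat_exp n (0 + h) - flat_exp n 0) / h) \<longlongrightarrow> 0) (at 0)"
  proof (rule Lim_transform_eventually[OF flat_exp_tendsto_0[of "n + 1"]])
    show "\<forall>\<^sub>F h in at 0. flat_exp (n + 1) h = (flat_exp n (0 + h) - flat_exp n 0) / h"
      by (auto simp: flat_exp_def eventually_at_filter)
  qed
  then show ?thesis using True by (simp add: DERIV_def flat_exp_def)
next
  case False
  then consider "t < 0" | "t > 0" by linarith
  then show ?thesis
  proof cases
    case 1
    have "((\<lambda>_. 0) has_real_derivative 0) (at t)" by simp
    then have "(flat_exp n has_real_derivative 0) (at t)"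
      by (rule DERIV_cong_ev[OF refl _ refl, THEN iffD1, rotated])
        (use 1 eventually_nhds_in_open[of "{..<0}" t] in \<open>auto simp: flat_exp_def elim!: eventually_mono\<close>)
    then show ?thesis using 1 by (simp add: flat_exp_def)
  next
    case 2
    have "((\<lambda>t. (1 / t) ^ n * exp (- (1 / t))) has_real_derivative
        (1 / t) ^ (n + 2) * exp (- (1 / t)) - real n * ((1 / t) ^ (n + 1) * exp (- (1 / t)))) (at t)"
    proof -
      have a: "((\<lambda>y. y ^ n * exp (- y)) has_real_derivative real n * y ^ (n - 1) * exp (- y) - y ^ n * exp (- y)) (at y)" for y :: real
        by (auto intro!: derivative_eq_intros)
      have b: "((\<lambda>t. 1 / t) has_real_derivative - ((1 / t) * (1 / t))) (at t)"
        using 2 by (auto intro!: derivative_eq_intros)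
      have eq: "(real n * y ^ (n - 1) * e - y ^ n * e) * - (y * y) = y ^ (n + 2) * e - real n * (y ^ (n + 1) * e)" for y e :: real
        by (cases n) (auto simp: algebra_simps)
      from DERIV_chain2[OF a b] show ?thesis by (simp only: eq)
    qed
    then have "(flat_exp n has_real_derivative
        (1 / t) ^ (n + 2) * exp (- (1 / t)) - real n * ((1 / t) ^ (n + 1) * exp (- (1 / t)))) (at t)"
      by (rule DERIV_cong_ev[OF refl _ refl, THEN iffD1, rotated])
        (use 2 eventually_nhds_in_open[of "{0<..}" t] in \<open>auto simp: flat_exp_def elim!: eventually_mono\<close>)
    then show ?thesis using 2 by (simp add: flat_exp_def)
  qed
qed

lemma C_k_flat_exp: "C_k k (flat_exp n)"
proof (induction k arbitrary: n)
  case 0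
  show ?case
    using DERIV_isCont[OF flat_exp_deriv] by (auto intro: continuous_at_imp_continuous_on)
next
  case (Suc k)
  have "partial_deriv 1 (flat_exp n) = (\<lambda>t. flat_exp (n + 2) t + (- real n) * flat_exp (n + 1) t)"
    by (intro ext) (simp add: partial_deriv_real[OF flat_exp_deriv])
  moreover have "C_k k (\<lambda>t. flat_exp (n + 2) t + (- real n) * flat_exp (n + 1) t)"
    by (intro C_k_add C_k_mult C_k_const Suc)
  moreover have "flat_exp n differentiable at x" for x
    using flat_exp_deriv real_differentiable_def by blast
  ultimately show ?case by simp
qed

definition smooth_step :: "real \<Rightarrow> real"
  where "smooth_step t = flat_exp 0 t * inverse (flat_exp 0 t + flat_exp 0 (1 - t))"

lemma flat_exp_0_nonneg: "0 \<le> flat_exp 0 t"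
  by (simp add: flat_exp_def)

lemma flat_exp_sum_pos: "0 < flat_exp 0 t + flat_exp 0 (1 - t)"
  using flat_exp_0_nonneg[of t] flat_exp_0_nonneg[of "1 - t"]
  by (cases "t > 0") (auto simp: flat_exp_def add_pos_nonneg)

lemma C_k_smooth_step: "C_k k smooth_step"
proof -
  have "C_k k (\<lambda>t. flat_exp 0 (1 + (- 1) * (t \<bullet> (1::real))))"
    by (rule C_k_affine_comp[OF C_k_flat_exp])
  then have "C_k k (\<lambda>t. flat_exp 0 t * inverse (flat_exp 0 t + flat_exp 0 (1 - t)))"
    using flat_exp_sum_pos by (intro C_k_mult C_k_inverse C_k_add C_k_flat_exp) (auto simp: less_le)
  then show ?thesis by (simp add: smooth_step_def[abs_def])
qed

lemma smooth_step_bounds: "0 \<le> smooth_step t" "smooth_step t \<le> 1"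
  using flat_exp_0_nonneg[of t] flat_exp_0_nonneg[of "1 - t"] flat_exp_sum_pos[of t]
  by (auto simp: smooth_step_def divide_simps)

lemma smooth_step_eq_0: "t \<le> 0 \<Longrightarrow> smooth_step t = 0"
  by (simp add: smooth_step_def flat_exp_def)

lemma smooth_step_eq_1: "t \<ge> 1 \<Longrightarrow> smooth_step t = 1"
  using flat_exp_sum_pos[of t] by (simp add: smooth_step_def flat_exp_def)

definition smooth_step' :: "real \<Rightarrow> real"
  where "smooth_step' = partial_deriv 1 smooth_step"

lemma DERIV_smooth_step: "(smooth_step has_real_derivative smooth_step' t) (at t)"
  unfolding smooth_step'_def using C_k_smooth_step[of 1] by (intro has_real_derivative_partial_deriv) simp

lemma isCont_smooth_step_deriv: "isCont smooth_step' t"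
  using C_k_smooth_step[of 1] by (simp add: smooth_step'_def continuous_on_eq_continuous_at)

lemma smooth_step_deriv_eq_0: assumes "t < 0 \<or> t > 1" shows "smooth_step' t = 0"
proof -
  have "\<forall>\<^sub>F x in nhds t. x \<in> (if t < 0 then {..<0} else {1<..})"
    using assms by (intro eventually_nhds_in_open) auto
  then have ev: "\<forall>\<^sub>F x in nhds t. smooth_step x = (if t < 0 then 0 else 1)"
    by eventually_elim (auto simp: smooth_step_eq_0 smooth_step_eq_1 split: if_splits)
  have "((\<lambda>_. (if t < 0 then 0 else 1)) has_real_derivative 0) (at t)" by simp
  then have "(smooth_step has_real_derivative 0) (at t)"
    by (rule DERIV_cong_ev[OF refl _ refl, THEN iffD1, rotated]) (use ev in \<open>auto elim!: eventually_mono\<close>)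
  then show ?thesis using DERIV_smooth_step DERIV_unique by blast
qed

lemma integral_smooth_step_deriv: "integrable lborel smooth_step'" "integral\<^sup>L lborel smooth_step' = 1"
proof -
  have eq: "smooth_step' = (\<lambda>t. smooth_step' t * indicator {0..1} t)"
  proof
    fix t show "smooth_step' t = smooth_step' t * indicator {0..1} t"
      by (cases "t \<in> {0..1}") (auto intro!: smooth_step_deriv_eq_0)
  qed
  have "integrable lborel (\<lambda>t. smooth_step' t * indicator {0..1} t)" 
    using borel_integrable_compact[of "{0..1::real}" smooth_step'] isCont_smooth_step_deriv
    by (simp add: continuous_at_imp_continuous_on mult.commute)
  then show "integrable lborel smooth_step'" using eq by simp
  have "integral\<^sup>L lborel (\<lambda>t. smooth_step' t * indicator {0..1} t) = smooth_step 1 - smooth_step 0"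
    by (rule integral_FTC_Icc_real) (auto simp: DERIV_smooth_step isCont_smooth_step_deriv)
  then show "integral\<^sup>L lborel smooth_step' = 1" using eq by (simp add: smooth_step_eq_0 smooth_step_eq_1)
qed

subsection \<open>Test functions that approximate indicators of boxes\<close>

text \<open>
  With \<open>\<delta> = (d - c) / (n + 4)\<close> the function rises from \<open>0\<close> to \<open>1\<close> on \<open>[c + \<delta>, c + 2\<delta>]\<close> and falls to \<open>0\<close> on
  \<open>[d - 2\<delta>, d - \<delta>]\<close>.  The summand \<open>4\<close> keeps the two intervals apart for every \<open>n\<close>.
\<close>

definition plateau :: "real \<Rightarrow> real \<Rightarrow> nat \<Rightarrow> real \<Rightarrow> real"
  where "plateau c d n t = smooth_step ((real n + 4) / (d - c) * (t - c) - 1) - smooth_step ((real n + 4) / (d - c) * (t - d) + 2)"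

lemma plateau_support:
  assumes "c < d" "plateau c d n t \<noteq> 0"
  shows "c + (d - c) / (real n + 4) \<le> t" "t \<le> d - (d - c) / (real n + 4)"
proof -
  define m where "m = (real n + 4) / (d - c)"
  have m: "m > 0" "m * (d - c) = real n + 4" using assms(1) by (auto simp: m_def)
  have 1: "(d - c) / (real n + 4) = 1 / m" by (simp add: m_def)
  have p: "plateau c d n t = smooth_step (m * (t - c) - 1) - smooth_step (m * (t - d) + 2)"
    by (simp add: plateau_def m_def)
  have md: "m * (t - d) = m * (t - c) - (real n + 4)" using m(2) by (simp add: algebra_simps)
  have "m * (t - c) \<ge> 1"
  proof (rule ccontr)
    assume "\<not> ?thesis"
    then show False using assms(2) by (simp add: p md smooth_step_eq_0)
  qed
  then show "c + (d - c) / (real n + 4) \<le> t" using m(1) by (simp add: 1 field_simps)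
  have "m * (t - d) \<le> - 1"
  proof (rule ccontr)
    assume "\<not> ?thesis"
    then have *: "m * (t - d) + 2 \<ge> 1" by simp
    then have "m * (t - c) - 1 \<ge> 1" using md by simp
    then show False using assms(2) * by (simp add: p smooth_step_eq_1)
  qed
  then show "t \<le> d - (d - c) / (real n + 4)" using m(1) by (simp add: 1 field_simps)
qed

lemma plateau_le_1: "\<bar>plateau c d n t\<bar> \<le> 1"
  using smooth_step_bounds[of "(real n + 4) / (d - c) * (t - c) - 1"] smooth_step_bounds[of "(real n + 4) / (d - c) * (t - d) + 2"]
  unfolding plateau_def by linarith

lemma plateau_tendsto:
  assumes "c < d"
  shows "(\<lambda>n. plateau c d n t) \<longlonglongrightarrow> indicator {c<..<d} t"
proof (cases "t \<in> {c<..<d}")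
  case True
  have lim: "filterlim (\<lambda>n. (real n + 4) / (d - c) * e) at_top sequentially" if "e > 0" for e
    using that assms by real_asymp
  have 1: "\<forall>\<^sub>F n in sequentially. (real n + 4) / (d - c) * (t - c) \<ge> 2"
    and 2: "\<forall>\<^sub>F n in sequentially. (real n + 4) / (d - c) * (d - t) \<ge> 2"
    using lim[of "t - c"] lim[of "d - t"] True unfolding filterlim_at_top by auto
  have "\<forall>\<^sub>F n in sequentially. plateau c d n t = 1"
    using 1 2
  proof eventually_elim
    case (elim n)
    have "(real n + 4) / (d - c) * (t - d) = - ((real n + 4) / (d - c) * (d - t))"
      by (metis minus_diff_eq mult_minus_right)
    then show ?case using elim by (simp add: plateau_def smooth_step_eq_0 smooth_step_eq_1)
  qed
  then show ?thesis using True by (simp add: tendsto_eventually)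
next
  case False
  have "plateau c d n t = 0" for n
  proof (rule ccontr)
    assume "plateau c d n t \<noteq> 0"
    moreover have "(d - c) / (real n + 4) > 0" using assms by simp
    ultimately show False using plateau_support[OF assms, of n t] False by auto
  qed
  then show ?thesis using False by simp
qed

lemma C_k_plateau: "C_k k (\<lambda>x. plateau c d n (x \<bullet> e))"
proof -
  define m where "m = (real n + 4) / (d - c)"
  have "C_k k (\<lambda>x. smooth_step ((- m * c - 1) + m * (x \<bullet> e)) + (- 1) * smooth_step ((2 - m * d) + m * (x \<bullet> e)))"
    by (intro C_k_add C_k_mult C_k_const C_k_affine_comp C_k_smooth_step)
  moreover have "(\<lambda>x. plateau c d n (x \<bullet> e))
      = (\<lambda>x. smooth_step ((- m * c - 1) + m * (x \<bullet> e)) + (- 1) * smooth_step ((2 - m * d) + m * (x \<bullet> e)))"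
    by (intro ext) (simp add: plateau_def m_def[symmetric] algebra_simps)
  ultimately show ?thesis by simp
qed

lemma test_functionI:
  assumes "\<And>k. C_k k \<psi>" "{x. \<psi> x \<noteq> 0} \<subseteq> cbox p q" "cbox p q \<subseteq> S"
  shows "test_function S \<psi>"
proof -
  have "closure {x. \<psi> x \<noteq> 0} \<subseteq> cbox p q"
    by (rule closure_minimal[OF assms(2) closed_cbox])
  then show ?thesis
    using assms compact_closure[of "{x. \<psi> x \<noteq> 0}"] bounded_subset[OF bounded_cbox assms(2)]
    by (auto simp: test_function_def)
qed

definition box_plateau :: "'d::euclidean_space \<Rightarrow> 'd \<Rightarrow> nat \<Rightarrow> 'd \<Rightarrow> real"
  where "box_plateau c d n x = (\<Prod>i\<in>Basis. plateau (c \<bullet> i) (d \<bullet> i) n (x \<bullet> i))"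

lemma test_function_box_plateau:
  assumes cd: "\<And>i. i \<in> Basis \<Longrightarrow> c \<bullet> i < d \<bullet> i" and sub: "box c d \<subseteq> S"
  shows "test_function S (box_plateau c d n)"
proof (rule test_functionI)
  show "C_k k (box_plateau c d n)" for k
    unfolding box_plateau_def[abs_def] by (intro C_k_prod C_k_plateau)
  define p where "p = (\<Sum>i\<in>Basis. (c \<bullet> i + (d \<bullet> i - c \<bullet> i) / (real n + 4)) *\<^sub>R i)"
  define q where "q = (\<Sum>i\<in>Basis. (d \<bullet> i - (d \<bullet> i - c \<bullet> i) / (real n + 4)) *\<^sub>R i)"
  show "{x. box_plateau c d n x \<noteq> 0} \<subseteq> cbox p q"
    using plateau_support[OF cd] by (auto simp: box_plateau_def mem_box p_def q_def)
  have "x \<in> box c d" if "x \<in> cbox p q" for x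
    unfolding mem_box
  proof
    fix i :: 'a assume i: "i \<in> Basis"
    have "(d \<bullet> i - c \<bullet> i) / (real n + 4) > 0" using cd[OF i] by simp
    then show "c \<bullet> i < x \<bullet> i \<and> x \<bullet> i < d \<bullet> i"
      using that i by (auto simp: mem_box p_def q_def dest!: bspec[OF _ i])
  qed
  then show "cbox p q \<subseteq> S" using sub by auto
qed

lemma box_plateau_le_1: "\<bar>box_plateau c d n x\<bar> \<le> 1"
  unfolding box_plateau_def abs_prod by (intro prod_le_1) (auto simp: plateau_le_1)

lemma box_plateau_tendsto:
  assumes cd: "\<And>i. i \<in> Basis \<Longrightarrow> c \<bullet> i < d \<bullet> i"
  shows "(\<lambda>n. box_plateau c d n x) \<longlonglongrightarrow> indicator (box c d) x"
proof -
  have "(\<lambda>n. box_plateau c d n x) \<longlonglongrightarrow> (\<Prod>i\<in>Basis. indicator {c \<bullet> i<..<d \<bullet> i} (x \<bullet> i))"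
    unfolding box_plateau_def by (intro tendsto_prod plateau_tendsto cd)
  also have "(\<Prod>i\<in>Basis. indicator {c \<bullet> i<..<d \<bullet> i} (x \<bullet> i)) = (indicator (box c d) x :: real)"
    by (auto simp: indicator_def mem_box)
  finally show ?thesis .
qed

lemma borel_measurable_test_function: "test_function S \<psi> \<Longrightarrow> \<psi> \<in> borel_measurable borel"
  unfolding test_function_def using C_k_continuous borel_measurable_continuous_onI by blast


subsection \<open>The fundamental lemma of the calculus of variations\<close>

text \<open>
  Boxes are stable under intersection and generate the Borel sets, so the finite measures with
  densities \<open>g\<^sup>+\<close> and \<open>g\<^sup>-\<close> agree.
\<close>

lemma AE_zero_if_box_integrals_zero:
  fixes g :: "'d::euclidean_space \<Rightarrow> real"
  assumes g: "integrable lborel g" and 0: "\<And>c d. (\<integral>x. indicator (box c d) x * g x \<partial>lborel) = 0"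
  shows "AE x in lborel. g x = 0"
proof -
  have [measurable]: "g \<in> borel_measurable borel" using g by auto
  let ?M = "density lborel (\<lambda>x. ennreal (g x))" and ?N = "density lborel (\<lambda>x. ennreal (- g x))"
  have fin: "(\<integral>\<^sup>+x. ennreal (g x) \<partial>lborel) \<noteq> \<infinity>" "(\<integral>\<^sup>+x. ennreal (- g x) \<partial>lborel) \<noteq> \<infinity>"
    using g by (auto simp: real_integrable_def)
  have eq: "emeasure ?M (box c d) = emeasure ?N (box c d)" for c d
  proof -
    have i: "integrable lborel (\<lambda>x. indicator (box c d) x * g x)"
      using integrable_mult_indicator[OF _ g, of "box c d"] by simp
    have 1: "(\<integral>\<^sup>+x. ennreal (indicator (box c d) x * g x) \<partial>lborel) \<noteq> \<infinity>"
      "(\<integral>\<^sup>+x. ennreal (- (indicator (box c d) x * g x)) \<partial>lborel) \<noteq> \<infinity>"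
      using i by (auto simp: real_integrable_def)
    have "enn2real (\<integral>\<^sup>+x. ennreal (indicator (box c d) x * g x) \<partial>lborel)
        = enn2real (\<integral>\<^sup>+x. ennreal (- (indicator (box c d) x * g x)) \<partial>lborel)"
      using 0[of c d] unfolding real_lebesgue_integral_def[OF i] by simp
    then have "(\<integral>\<^sup>+x. ennreal (indicator (box c d) x * g x) \<partial>lborel)
        = (\<integral>\<^sup>+x. ennreal (- (indicator (box c d) x * g x)) \<partial>lborel)"
      using 1 ennreal_enn2real[unfolded less_top] by (simp add: less_top) (metis ennreal_enn2real)
    moreover have "ennreal (indicator (box c d) x * g x) = ennreal (g x) * indicator (box c d) x"
      "ennreal (- (indicator (box c d) x * g x)) = ennreal (- g x) * indicator (box c d) x" for x
      by (auto simp: indicator_def)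
    ultimately show ?thesis by (simp add: emeasure_density)
  qed
  have "?M = ?N"
  proof (rule measure_eqI_generator_eq[where A="\<lambda>n::nat. box (- (real n *\<^sub>R One)) (real n *\<^sub>R One)"])
    show "Int_stable (range (\<lambda>(a, b). box a b) :: 'd set set)"
      by (auto simp: Int_stable_def box_Int_box)
    show "range (\<lambda>(a, b). box a b) \<subseteq> Pow (UNIV :: 'd set)" by simp
    show "emeasure ?M X = emeasure ?N X" if "X \<in> range (\<lambda>(a, b). box a b)" for X
      using that eq by auto
    show "sets ?M = sigma_sets UNIV (range (\<lambda>(a, b). box a b))"
      "sets ?N = sigma_sets UNIV (range (\<lambda>(a, b). box a b))"
      by (simp_all add: borel_eq_box)
    show "range (\<lambda>n::nat. box (- (real n *\<^sub>R One)) (real n *\<^sub>R One)) \<subseteq> range (\<lambda>(a, b). box a b :: 'd set)"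
      by auto
    show "(\<Union>n::nat. box (- (real n *\<^sub>R One)) (real n *\<^sub>R One)) = (UNIV :: 'd set)"
      by (rule UN_box_eq_UNIV)
    fix n :: nat
    have "emeasure ?M (box (- (real n *\<^sub>R One)) (real n *\<^sub>R One)) \<le> (\<integral>\<^sup>+x. ennreal (g x) \<partial>lborel)"
      by (auto simp: emeasure_density indicator_def intro!: nn_integral_mono)
    then show "emeasure ?M (box (- (real n *\<^sub>R One)) (real n *\<^sub>R One)) \<noteq> \<infinity>"
      using fin(1) by (auto simp: top_unique)
  qed
  then have "AE x in lborel. ennreal (g x) = ennreal (- g x)"
    by (intro sigma_finite_measure.density_unique[OF lborel.sigma_finite_measure_axioms]) auto
  then show ?thesis
  proof eventually_elim
    case (elim x)
    then show ?case by (metis ennreal_eq_0_iff ennreal_inj linear neg_0_le_iff_le neg_equal_zero neg_le_0_iff_le)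
  qed
qed

text \<open>
  Test functions tend boundedly to the indicator of any box, so the integrals of \<open>f\<close> over boxes vanish.
\<close>

lemma fundamental_lemma:
  fixes f :: "'d::euclidean_space \<Rightarrow> 'e::euclidean_space"
  assumes f: "integrable (leb (cbox l u)) f"
    and 0: "\<And>\<psi>. test_function (box l u) \<psi> \<Longrightarrow> (\<integral>x. \<psi> x *\<^sub>R f x \<partial>leb (cbox l u)) = 0"
  shows "AE x in leb (cbox l u). f x = 0"
proof -
  have fint: "integrable lborel (\<lambda>x. indicator (cbox l u) x *\<^sub>R f x)"
    using f by (simp add: integrable_restrict_space)
  have inner0: "AE x in lborel. (indicator (cbox l u) x *\<^sub>R f x) \<bullet> e = 0" for e
  proof (rule AE_zero_if_box_integrals_zero)
    show "integrable lborel (\<lambda>x. (indicator (cbox l u) x *\<^sub>R f x) \<bullet> e)"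
      using fint by (rule integrable_inner_left) 
    fix c d :: 'd
    \<comment> \<open>The given box is cut down to \<open>box l u\<close>; what is lost lies in the boundary of \<open>cbox l u\<close>.\<close>
    define c' where "c' = (\<Sum>i\<in>Basis. max (c \<bullet> i) (l \<bullet> i) *\<^sub>R i)"
    define d' where "d' = (\<Sum>i\<in>Basis. min (d \<bullet> i) (u \<bullet> i) *\<^sub>R i)"
    have box': "box c' d' = box c d \<inter> box l u"
      by (simp add: box_Int_box c'_def d'_def)
    have null: "AE x in lborel. x \<notin> cbox l u - box l u"
      by (intro AE_not_in null_setsI) (auto simp: emeasure_Diff box_subset_cbox emeasure_lborel_cbox_eq emeasure_lborel_box_eq)
    have "(\<integral>x. indicator (box c' d') x *\<^sub>R f x \<partial>leb (cbox l u)) = 0"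
    proof (cases "\<forall>i\<in>Basis. c' \<bullet> i < d' \<bullet> i")
      case True
      have test: "test_function (box l u) (box_plateau c' d' n)" for n
        using True box' by (intro test_function_box_plateau) auto
      have [measurable]: "box_plateau c' d' n \<in> borel_measurable (leb (cbox l u))" for n
        using borel_measurable_test_function[OF test] by (intro measurable_leb)
      have [measurable]: "f \<in> borel_measurable (leb (cbox l u))" using f by auto
      have "(\<lambda>n. \<integral>x. box_plateau c' d' n x *\<^sub>R f x \<partial>leb (cbox l u)) \<longlonglongrightarrow> (\<integral>x. indicator (box c' d') x *\<^sub>R f x \<partial>leb (cbox l u))"
      proof (rule integral_dominated_convergence[where w="\<lambda>x. norm (f x)"])
        have "(indicator (box c' d') :: 'd \<Rightarrow> real) \<in> borel_measurable (leb (cbox l u))"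
          by (intro measurable_leb) simp
        then show "(\<lambda>x. indicator (box c' d') x *\<^sub>R f x) \<in> borel_measurable (leb (cbox l u))" by measurable
        show "integrable (leb (cbox l u)) (\<lambda>x. norm (f x))" using f by simp
        show "AE x in leb (cbox l u). (\<lambda>n. box_plateau c' d' n x *\<^sub>R f x) \<longlonglongrightarrow> indicator (box c' d') x *\<^sub>R f x"
          using True by (intro AE_I2 tendsto_scaleR box_plateau_tendsto) auto
        show "AE x in leb (cbox l u). norm (box_plateau c' d' n x *\<^sub>R f x) \<le> norm (f x)" for n
          using mult_right_mono[OF box_plateau_le_1 norm_ge_zero, of c' d' n] by (intro AE_I2) simp
      qed measurable
      moreover have "(\<integral>x. box_plateau c' d' n x *\<^sub>R f x \<partial>leb (cbox l u)) = 0" for n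
        by (rule 0[OF test])
      ultimately show ?thesis by (simp add: LIMSEQ_const_iff)
    next
      case False
      then have "box c' d' = {}" by (auto simp: box_eq_empty not_less)
      then show ?thesis by simp
    qed
    then have "(\<integral>x. indicator (cbox l u) x *\<^sub>R indicator (box c' d') x *\<^sub>R f x \<partial>lborel) = 0"
      by (simp add: integral_restrict_space)
    moreover have "integrable lborel (\<lambda>x. indicator (cbox l u) x *\<^sub>R indicator (box c' d') x *\<^sub>R f x)"
      using integrable_mult_indicator[OF _ fint, of "box c' d'"] by (simp add: mult.commute)
    ultimately have "(\<integral>x. (indicator (cbox l u) x *\<^sub>R indicator (box c' d') x *\<^sub>R f x) \<bullet> e \<partial>lborel) = 0"
      by (subst integral_inner_left) auto
    also have "(\<integral>x. (indicator (cbox l u) x *\<^sub>R indicator (box c' d') x *\<^sub>R f x) \<bullet> e \<partial>lborel)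
        = (\<integral>x. indicator (box c d) x * ((indicator (cbox l u) x *\<^sub>R f x) \<bullet> e) \<partial>lborel)"
    proof (rule integral_cong_AE)
      have [measurable]: "(\<lambda>x. indicator (cbox l u) x *\<^sub>R f x) \<in> borel_measurable borel" using fint by auto
      show "(\<lambda>x. indicator (box c d) x * ((indicator (cbox l u) x *\<^sub>R f x) \<bullet> e)) \<in> borel_measurable lborel" by measurable
      have "(\<lambda>x. (indicator (box c' d') x *\<^sub>R (indicator (cbox l u) x *\<^sub>R f x)) \<bullet> e) \<in> borel_measurable lborel" by measurable
      then show "(\<lambda>x. (indicator (cbox l u) x *\<^sub>R indicator (box c' d') x *\<^sub>R f x) \<bullet> e) \<in> borel_measurable lborel"
        by (simp add: mult.commute)
      show "AE x in lborel. (indicator (cbox l u) x *\<^sub>R indicator (box c' d') x *\<^sub>R f x) \<bullet> e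
          = indicator (box c d) x * ((indicator (cbox l u) x *\<^sub>R f x) \<bullet> e)"
        using null by eventually_elim (auto simp: box' indicator_def)
    qed
    finally show "(\<integral>x. indicator (box c d) x * ((indicator (cbox l u) x *\<^sub>R f x) \<bullet> e) \<partial>lborel) = 0" .
  qed
  have "AE x in lborel. \<forall>e\<in>Basis. (indicator (cbox l u) x *\<^sub>R f x) \<bullet> e = 0"
    by (intro AE_finite_allI inner0) simp
  then have "AE x in lborel. x \<in> cbox l u \<longrightarrow> f x = 0"
    by eventually_elim (auto simp: euclidean_eq_iff[of "f _"])
  then show ?thesis by (simp add: AE_restrict_space_iff)
qed

subsection \<open>Weak derivatives in one variable\<close>

text \<open>
  The derivative of the step has integral \<open>1\<close> and lives on \<open>[0, 1]\<close>, so this is an average of values of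
  \<open>f\<close> at points that tend to \<open>z\<close>.
\<close>

lemma smooth_step_deriv_averages_tendsto:
  fixes f :: "real \<Rightarrow> 'e::euclidean_space"
  assumes f: "continuous_on {a..b} f" and y: "\<And>n r. r \<in> {0..1} \<Longrightarrow> y n r \<in> {a..b}"
    and ym: "\<And>n. y n \<in> borel_measurable borel"
    and lim: "\<And>r. r \<in> {0..1} \<Longrightarrow> (\<lambda>n. y n r) \<longlonglongrightarrow> z" and z: "z \<in> {a..b}"
  shows "(\<lambda>n. \<integral>r. smooth_step' r *\<^sub>R indicator {a..b} (y n r) *\<^sub>R f (y n r) \<partial>lborel) \<longlonglongrightarrow> f z"
proof -
  obtain C where C: "\<And>x. x \<in> {a..b} \<Longrightarrow> norm (f x) \<le> C"
    using compact_imp_bounded[OF compact_continuous_image[OF f]] by (metis bounded_iff compact_Icc imageI)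
  have [measurable]: "(\<lambda>x. indicator {a..b} x *\<^sub>R f x) \<in> borel_measurable borel"
    using borel_measurable_continuous_on_indicator[OF _ f] by simp
  note ym [measurable]
  have [measurable]: "smooth_step' \<in> borel_measurable borel"
    using borel_measurable_integrable[OF integral_smooth_step_deriv(1)] by simp
  have "(\<lambda>n. \<integral>r. smooth_step' r *\<^sub>R indicator {a..b} (y n r) *\<^sub>R f (y n r) \<partial>lborel) \<longlonglongrightarrow> (\<integral>r. smooth_step' r *\<^sub>R f z \<partial>lborel)"
  proof (rule integral_dominated_convergence[where w="\<lambda>r. norm (smooth_step' r) * C"])
    show "(\<lambda>r. smooth_step' r *\<^sub>R f z) \<in> borel_measurable lborel" by measurable
    show "(\<lambda>r. smooth_step' r *\<^sub>R indicator {a..b} (y n r) *\<^sub>R f (y n r)) \<in> borel_measurable lborel" for n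
      using measurable_compose[OF ym[of n], of "\<lambda>x. indicator {a..b} x *\<^sub>R f x" borel] by measurable
    show "integrable lborel (\<lambda>r. norm (smooth_step' r) * C)" using integral_smooth_step_deriv(1) by simp
    show "AE r in lborel. (\<lambda>n. smooth_step' r *\<^sub>R indicator {a..b} (y n r) *\<^sub>R f (y n r)) \<longlonglongrightarrow> smooth_step' r *\<^sub>R f z"
    proof (rule AE_I2)
      fix r :: real
      show "(\<lambda>n. smooth_step' r *\<^sub>R indicator {a..b} (y n r) *\<^sub>R f (y n r)) \<longlonglongrightarrow> smooth_step' r *\<^sub>R f z"
      proof (cases "r \<in> {0..1}")
        case True
        have "(\<lambda>n. f (y n r)) \<longlonglongrightarrow> f z"
          using f lim[OF True] z y[OF True] by (intro continuous_on_tendsto_compose[OF f]) auto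
        then show ?thesis using y[OF True] by (auto intro!: tendsto_intros)
      next
        case False
        then have "smooth_step' r = 0" by (intro smooth_step_deriv_eq_0) auto
        then show ?thesis by simp
      qed
    qed
    show "AE r in lborel. norm (smooth_step' r *\<^sub>R indicator {a..b} (y n r) *\<^sub>R f (y n r)) \<le> norm (smooth_step' r) * C" for n
    proof (rule AE_I2)
      fix r :: real
      show "norm (smooth_step' r *\<^sub>R indicator {a..b} (y n r) *\<^sub>R f (y n r)) \<le> norm (smooth_step' r) * C"
        using C[of "y n r"] order_trans[OF norm_ge_zero C[OF z]] by (auto simp: indicator_def intro!: mult_left_mono)
    qed
  qed
  also have "(\<integral>r. smooth_step' r *\<^sub>R f z \<partial>lborel) = f z"
    using integral_smooth_step_deriv by simp
  finally show ?thesis .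
qed

lemma plateau_deriv:
  "partial_deriv 1 (plateau c d n) t = (real n + 4) / (d - c) * smooth_step' ((real n + 4) / (d - c) * (t - c) - 1)
      - (real n + 4) / (d - c) * smooth_step' ((real n + 4) / (d - c) * (t - d) + 2)"
proof (rule partial_deriv_real)
  define m where "m = (real n + 4) / (d - c)"
  have "((\<lambda>t. smooth_step (m * (t - c) - 1) - smooth_step (m * (t - d) + 2)) has_real_derivative
      smooth_step' (m * (t - c) - 1) * m - smooth_step' (m * (t - d) + 2) * m) (at t)"
    by (intro derivative_intros DERIV_chain2[OF DERIV_smooth_step]) (auto intro!: derivative_eq_intros)
  then show "(plateau c d n has_real_derivative (real n + 4) / (d - c) * smooth_step' ((real n + 4) / (d - c) * (t - c) - 1)
      - (real n + 4) / (d - c) * smooth_step' ((real n + 4) / (d - c) * (t - d) + 2)) (at t)"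
    by (simp add: plateau_def[abs_def] m_def mult.commute)
qed

lemma test_function_plateau:
  assumes "c < d" "a \<le> c" "d \<le> b"
  shows "test_function {a<..<b} (plateau c d n)"
proof -
  have "test_function {a<..<b} (box_plateau c d n)"
    using assms by (intro test_function_box_plateau) (auto simp: box_real)
  then show ?thesis by (simp add: box_plateau_def[abs_def])
qed

lemma AE_leb_neq: "S \<in> sets borel \<Longrightarrow> AE t in leb S. t \<noteq> c"
  using AE_lborel_singleton[of c] by (subst AE_leb) (auto elim: eventually_mono)

text \<open>
  Test with the plateaus on \<open>[a, x]\<close>.  They tend to the indicator of \<open>(a, x)\<close>, and their derivatives are
  differences of two approximate identities, at \<open>a\<close> and at \<open>x\<close>.
\<close>

lemma eq_integral_weak_deriv:
  fixes f g :: "real \<Rightarrow> 'e::euclidean_space"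
  assumes f: "continuous_on {a..b} f" and g: "integrable (leb {a..b}) g"
    and weak: "is_weak_deriv {a..b} [1] f g" and x: "x \<in> {a..b}"
  shows "f x = f a + (LINT t:{a..x}|lborel. g t)"
proof (cases "a < x")
  case False
  then have "{a..x} = {a}" "x = a" using x by auto
  moreover have "(LINT t:{a}|lborel. g t) = 0"
    unfolding set_lebesgue_integral_def using AE_lborel_singleton[of a]
    by (intro integral_eq_zero_AE) (auto elim!: eventually_mono)
  ultimately show ?thesis by simp
next
  case True
  define m where "m n = (real n + 4) / (x - a)" for n
  have m: "m n > 0" for n using True by (simp add: m_def)
  have mx: "1 / m n \<le> (x - a) / 4" for n using True by (simp add: m_def field_simps mult_right_mono)
  have mlim: "(\<lambda>n. 1 / m n) \<longlonglongrightarrow> 0" unfolding m_def using True by real_asymp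
  have test: "test_function (interior {a..b}) (plateau a x n)" for n
    using test_function_plateau[OF True, of a b n] x by (simp add: interior_atLeastAtMost_real)
  define f' where "f' t = indicator {a..b} t *\<^sub>R f t" for t
  have f'm [measurable]: "f' \<in> borel_measurable borel"
    unfolding f'_def using borel_measurable_continuous_on_indicator[OF _ f] by simp
  have [measurable]: "smooth_step' \<in> borel_measurable borel"
    using borel_measurable_integrable[OF integral_smooth_step_deriv(1)] by simp
  obtain C where C: "\<And>x. x \<in> {a..b} \<Longrightarrow> norm (f x) \<le> C"
    using compact_imp_bounded[OF compact_continuous_image[OF f]] by (metis bounded_iff compact_Icc imageI)
  have f'C: "norm (f' t) \<le> max C 0" for t using C[of t] by (auto simp: f'_def indicator_def)
  have int: "integrable lborel (\<lambda>r. smooth_step' r *\<^sub>R f' (p + q * r))" for p q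
  proof (rule Bochner_Integration.integrable_bound)
    show "integrable lborel (\<lambda>r. norm (smooth_step' r) * max C 0)" using integral_smooth_step_deriv(1) by simp
    show "AE r in lborel. norm (smooth_step' r *\<^sub>R f' (p + q * r)) \<le> norm (norm (smooth_step' r) * max C 0)"
      using f'C by (auto intro!: mult_left_mono)
  qed measurable
  \<comment> \<open>The substitution \<open>r = m (t - p) + q\<close> brings both transition intervals to \<open>[0, 1]\<close>.\<close>
  have subst: "(\<integral>t. (m n * smooth_step' (m n * (t - p) + q)) *\<^sub>R f' t \<partial>lborel) = (\<integral>r. smooth_step' r *\<^sub>R f' ((p - q / m n) + (1 / m n) * r) \<partial>lborel)"
    "integrable lborel (\<lambda>t. (m n * smooth_step' (m n * (t - p) + q)) *\<^sub>R f' t)" for n p q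
  proof -
    have "m n * ((p - q / m n) + (1 / m n) * r - p) + q = r" for r
      using m[of n] by (simp add: field_simps)
    then have e: "(m n * smooth_step' (m n * ((p - q / m n) + (1 / m n) * r - p) + q)) *\<^sub>R v = m n *\<^sub>R (smooth_step' r *\<^sub>R v)"
      for r and v :: 'e by simp
    have m0: "1 / m n \<noteq> 0" using m[of n] by simp
    have "(\<integral>t. (m n * smooth_step' (m n * (t - p) + q)) *\<^sub>R f' t \<partial>lborel)
        = \<bar>1 / m n\<bar> *\<^sub>R (\<integral>r. m n *\<^sub>R (smooth_step' r *\<^sub>R f' ((p - q / m n) + (1 / m n) * r)) \<partial>lborel)"
      using lborel_integral_real_affine[OF m0, of "\<lambda>t. (m n * smooth_step' (m n * (t - p) + q)) *\<^sub>R f' t" "p - q / m n"]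
      unfolding e .
    also have "\<dots> = (\<integral>r. smooth_step' r *\<^sub>R f' ((p - q / m n) + (1 / m n) * r) \<partial>lborel)"
      unfolding integral_scaleR_right using m[of n] by simp
    finally show "(\<integral>t. (m n * smooth_step' (m n * (t - p) + q)) *\<^sub>R f' t \<partial>lborel) = (\<integral>r. smooth_step' r *\<^sub>R f' ((p - q / m n) + (1 / m n) * r) \<partial>lborel)" .
    have "integrable lborel (\<lambda>r. (m n * smooth_step' (m n * ((p - q / m n) + (1 / m n) * r - p) + q)) *\<^sub>R f' ((p - q / m n) + (1 / m n) * r))"
      unfolding e by (intro integrable_scaleR_right int)
    then show "integrable lborel (\<lambda>t. (m n * smooth_step' (m n * (t - p) + q)) *\<^sub>R f' t)"
      by (rule lborel_integrable_real_affine_iff[OF m0, THEN iffD1])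
  qed
  have lhs: "(LINT t:{a..b}|lborel. foldr partial_deriv [1] (plateau a x n) t *\<^sub>R f t)
      = (\<integral>r. smooth_step' r *\<^sub>R f' ((a + 1 / m n) + (1 / m n) * r) \<partial>lborel)
      - (\<integral>r. smooth_step' r *\<^sub>R f' ((x - 2 / m n) + (1 / m n) * r) \<partial>lborel)" for n
  proof -
    have "(LINT t:{a..b}|lborel. foldr partial_deriv [1] (plateau a x n) t *\<^sub>R f t)
        = (\<integral>t. (m n * smooth_step' (m n * (t - a) + (- 1))) *\<^sub>R f' t - (m n * smooth_step' (m n * (t - x) + 2)) *\<^sub>R f' t \<partial>lborel)"
      unfolding set_lebesgue_integral_def
      by (intro Bochner_Integration.integral_cong)
        (auto simp: plateau_deriv m_def f'_def scaleR_left_diff_distrib algebra_simps)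
    also have "\<dots> = (\<integral>t. (m n * smooth_step' (m n * (t - a) + (- 1))) *\<^sub>R f' t \<partial>lborel) - (\<integral>t. (m n * smooth_step' (m n * (t - x) + 2)) *\<^sub>R f' t \<partial>lborel)"
      by (intro Bochner_Integration.integral_diff subst)
    finally show ?thesis using subst(1)[of n a "- 1"] subst(1)[of n x 2] by simp
  qed
  have lim1: "(\<lambda>n. \<integral>r. smooth_step' r *\<^sub>R f' ((a + 1 / m n) + (1 / m n) * r) \<partial>lborel) \<longlonglongrightarrow> f a"
    unfolding f'_def
  proof (rule smooth_step_deriv_averages_tendsto[OF f])
    fix n and r :: real assume r: "r \<in> {0..1}"
    have "0 \<le> 1 / m n" "(1 / m n) * r \<le> 1 / m n * 1" "0 \<le> (1 / m n) * r"
      using m[of n] r by (auto intro!: divide_right_mono)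
    then show "(a + 1 / m n) + (1 / m n) * r \<in> {a..b}" using mx[of n] x by auto
    have "(\<lambda>n. (a + 1 / m n) + (1 / m n) * r) \<longlonglongrightarrow> (a + 0) + 0 * r" by (intro tendsto_intros mlim)
    then show "(\<lambda>n. (a + 1 / m n) + (1 / m n) * r) \<longlonglongrightarrow> a" by simp
  qed (use x in auto)
  have lim2: "(\<lambda>n. \<integral>r. smooth_step' r *\<^sub>R f' ((x - 2 / m n) + (1 / m n) * r) \<partial>lborel) \<longlonglongrightarrow> f x"
    unfolding f'_def
  proof (rule smooth_step_deriv_averages_tendsto[OF f])
    fix n and r :: real assume r: "r \<in> {0..1}"
    have "0 \<le> 1 / m n" "(1 / m n) * r \<le> 1 / m n * 1" "0 \<le> (1 / m n) * r"
      using m[of n] r by (auto intro!: divide_right_mono)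
    moreover have "2 / m n = 2 * (1 / m n)" by simp
    ultimately show "(x - 2 / m n) + (1 / m n) * r \<in> {a..b}" using mx[of n] x by auto
    have "(\<lambda>n. (x - 2 * (1 / m n)) + (1 / m n) * r) \<longlonglongrightarrow> (x - 2 * 0) + 0 * r" by (intro tendsto_intros mlim)
    then show "(\<lambda>n. (x - 2 / m n) + (1 / m n) * r) \<longlonglongrightarrow> x" by simp
  qed (use x in auto)
  have rhs: "(\<lambda>n. LINT t:{a..b}|lborel. plateau a x n t *\<^sub>R g t) \<longlonglongrightarrow> (\<integral>t. indicator {a<..<x} t *\<^sub>R g t \<partial>leb {a..b})"
    unfolding set_integral_leb[OF borel_closed[OF closed_atLeastAtMost]]
  proof (rule integral_dominated_convergence[where w="\<lambda>x. norm (g x)"])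
    have [measurable]: "plateau a x n \<in> borel_measurable (leb {a..b})" for n
      using borel_measurable_test_function[OF test] by (intro measurable_leb)
    have [measurable]: "g \<in> borel_measurable (leb {a..b})" using g by auto
    have "(indicator {a<..<x} :: real \<Rightarrow> real) \<in> borel_measurable (leb {a..b})"
      by (intro measurable_leb) simp
    then show "(\<lambda>t. indicator {a<..<x} t *\<^sub>R g t) \<in> borel_measurable (leb {a..b})" by measurable
    show "(\<lambda>t. plateau a x n t *\<^sub>R g t) \<in> borel_measurable (leb {a..b})" for n by measurable
    show "integrable (leb {a..b}) (\<lambda>x. norm (g x))" using g by simp
    show "AE t in leb {a..b}. (\<lambda>n. plateau a x n t *\<^sub>R g t) \<longlonglongrightarrow> indicator {a<..<x} t *\<^sub>R g t"
      using True by (intro AE_I2 tendsto_scaleR plateau_tendsto) auto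
    show "AE t in leb {a..b}. norm (plateau a x n t *\<^sub>R g t) \<le> norm (g t)" for n
      using mult_right_mono[OF plateau_le_1 norm_ge_zero, of a x n] by (intro AE_I2) simp
  qed
  have eq: "(LINT t:{a..b}|lborel. foldr partial_deriv [1] (plateau a x n) t *\<^sub>R f t) = - (LINT t:{a..b}|lborel. plateau a x n t *\<^sub>R g t)" for n
    using weak test[of n] unfolding is_weak_deriv_def by force
  have "f a - f x = - (\<integral>t. indicator {a<..<x} t *\<^sub>R g t \<partial>leb {a..b})"
  proof (rule LIMSEQ_unique[OF tendsto_diff[OF lim1 lim2]])
    from tendsto_minus[OF rhs]
    show "(\<lambda>n. (\<integral>r. smooth_step' r *\<^sub>R f' ((a + 1 / m n) + (1 / m n) * r) \<partial>lborel)
        - (\<integral>r. smooth_step' r *\<^sub>R f' ((x - 2 / m n) + (1 / m n) * r) \<partial>lborel)) \<longlonglongrightarrow> - (\<integral>t. indicator {a<..<x} t *\<^sub>R g t \<partial>leb {a..b})"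
      unfolding eq[unfolded lhs] .
  qed
  also have "(\<integral>t. indicator {a<..<x} t *\<^sub>R g t \<partial>leb {a..b}) = (LINT t:{a..x}|lborel. g t)"
  proof -
    have "(\<integral>t. indicator {a<..<x} t *\<^sub>R g t \<partial>leb {a..b}) = (\<integral>t. (if t \<in> {a..x} then g t else 0) \<partial>leb {a..b})"
    proof (rule integral_cong_AE)
      have [measurable]: "g \<in> borel_measurable (leb {a..b})" using g by auto
      have 1: "(indicator {a<..<x} :: real \<Rightarrow> real) \<in> borel_measurable (leb {a..b})"
        "(indicator {a..x} :: real \<Rightarrow> real) \<in> borel_measurable (leb {a..b})"
        by (intro measurable_leb; simp)+
      then show "(\<lambda>t. indicator {a<..<x} t *\<^sub>R g t) \<in> borel_measurable (leb {a..b})" by measurable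
      have "(\<lambda>t. indicator {a..x} t *\<^sub>R g t) \<in> borel_measurable (leb {a..b})" using 1(2) by measurable
      moreover have "(\<lambda>t. indicator {a..x} t *\<^sub>R g t) = (\<lambda>t. if t \<in> {a..x} then g t else 0)"
        by (auto simp: indicator_def)
      ultimately show "(\<lambda>t. if t \<in> {a..x} then g t else 0) \<in> borel_measurable (leb {a..b})" by simp
      have "AE t in leb {a..b}. t \<noteq> a" "AE t in leb {a..b}. t \<noteq> x"
        by (rule AE_leb_neq; simp)+
      then show "AE t in leb {a..b}. indicator {a<..<x} t *\<^sub>R g t = (if t \<in> {a..x} then g t else 0)"
        by eventually_elim (auto simp: indicator_def)
    qed
    also have "\<dots> = (LINT t:{a..x}|lborel. g t)"
      using x by (intro set_integral_subset_leb[symmetric]) auto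
    finally show ?thesis .
  qed
  finally show ?thesis by (simp add: algebra_simps)
qed


section \<open>Uniqueness of weak derivatives\<close>

lemma test_function_compactI:
  assumes "\<And>k. C_k k \<psi>" "{x. \<psi> x \<noteq> 0} \<subseteq> K" "compact K" "K \<subseteq> S"
  shows "test_function S \<psi>"
proof -
  have "closure {x. \<psi> x \<noteq> 0} \<subseteq> K"
    by (rule closure_minimal[OF assms(2) compact_imp_closed[OF assms(3)]])
  then show ?thesis
    using assms compact_closure[of "{x. \<psi> x \<noteq> 0}"] bounded_subset[OF compact_imp_bounded assms(2)]
    by (auto simp: test_function_def)
qed

lemma C_k_test_function: "test_function S \<psi> \<Longrightarrow> C_k k \<psi>"
  by (simp add: test_function_def)

lemma integrable_continuous_scaleR:
  fixes \<psi> :: "'d::euclidean_space \<Rightarrow> real" and g :: "'d \<Rightarrow> 'e::euclidean_space"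
  assumes "continuous_on UNIV \<psi>" "bounded S" and g: "integrable (leb S) g"
  shows "integrable (leb S) (\<lambda>x. \<psi> x *\<^sub>R g x)"
proof -
  have "bounded (\<psi> ` closure S)"
    using assms(1,2) by (meson compact_closure compact_continuous_image compact_imp_bounded continuous_on_subset top_greatest)
  then obtain C where C: "\<And>x. x \<in> closure S \<Longrightarrow> \<bar>\<psi> x\<bar> \<le> C"
    unfolding bounded_iff by auto
  have [measurable]: "\<psi> \<in> borel_measurable (leb S)"
    by (intro measurable_leb borel_measurable_continuous_onI assms)
  have [measurable]: "g \<in> borel_measurable (leb S)" using g by auto
  have "integrable (leb S) (\<lambda>x. C * norm (g x))" using g by simp
  then show ?thesis
  proof (rule Bochner_Integration.integrable_bound)
    show "AE x in leb S. norm (\<psi> x *\<^sub>R g x) \<le> norm (C * norm (g x))"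
    proof (rule AE_I2)
      fix x assume "x \<in> space (leb S)"
      then have "\<bar>\<psi> x\<bar> \<le> C" using C[of x] closure_subset[of S] by auto
      then show "norm (\<psi> x *\<^sub>R g x) \<le> norm (C * norm (g x))"
        by (auto simp: abs_mult intro!: mult_right_mono)
    qed
  qed measurable
qed

lemma integrable_test_function:
  fixes g :: "'d::euclidean_space \<Rightarrow> 'e::euclidean_space"
  assumes "test_function T \<psi>" "bounded S" "integrable (leb S) g"
  shows "integrable (leb S) (\<lambda>x. \<psi> x *\<^sub>R g x)"
  using assms by (intro integrable_continuous_scaleR C_k_continuous[of 0] C_k_test_function)

lemma is_weak_deriv_leb:
  fixes f g :: "'d::euclidean_space \<Rightarrow> 'e::euclidean_space"
  shows "is_weak_deriv (cbox l u) is f g \<longleftrightarrow> (\<forall>\<psi>. test_function (box l u) \<psi> \<longrightarrow>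
    (\<integral>x. foldr partial_deriv is \<psi> x *\<^sub>R f x \<partial>leb (cbox l u)) = (- 1) ^ length is *\<^sub>R (\<integral>x. \<psi> x *\<^sub>R g x \<partial>leb (cbox l u)))"
  by (simp add: is_weak_deriv_def set_integral_leb interior_cbox)

lemma finite_leb_cbox: "finite_measure (leb (cbox l u))"
  by (rule finite_leb) auto

lemma weak_deriv_unique:
  fixes f g h :: "'d::euclidean_space \<Rightarrow> 'e::euclidean_space"
  assumes g: "integrable (leb (cbox l u)) g" "is_weak_deriv (cbox l u) is f g"
    and h: "integrable (leb (cbox l u)) h" "is_weak_deriv (cbox l u) is f h"
  shows "AE x in leb (cbox l u). g x = h x"
proof -
  have "AE x in leb (cbox l u). g x - h x = 0"
  proof (rule fundamental_lemma)
    show "integrable (leb (cbox l u)) (\<lambda>x. g x - h x)" using g h by simp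
    fix \<psi> :: "'d \<Rightarrow> real" assume \<psi>: "test_function (box l u) \<psi>"
    have "(\<integral>x. \<psi> x *\<^sub>R g x \<partial>leb (cbox l u)) = (\<integral>x. \<psi> x *\<^sub>R h x \<partial>leb (cbox l u))"
      using g(2) h(2) \<psi> unfolding is_weak_deriv_leb by force
    then show "(\<integral>x. \<psi> x *\<^sub>R (g x - h x) \<partial>leb (cbox l u)) = 0"
      using integrable_test_function[OF \<psi> bounded_cbox g(1)] integrable_test_function[OF \<psi> bounded_cbox h(1)]
      by (simp add: scaleR_diff_right)
  qed
  then show ?thesis by simp
qed

text \<open>
  The choice in the definition of \<open>weak_deriv\<close> is determined up to null sets.
\<close>

lemma weak_deriv_l2:
  fixes f :: "'d::euclidean_space \<Rightarrow> 'e::euclidean_space"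
  assumes "g \<in> l2 (leb (cbox l u))" "is_weak_deriv (cbox l u) is f g"
  shows "weak_deriv (cbox l u) is f \<in> l2 (leb (cbox l u))"
    and "is_weak_deriv (cbox l u) is f (weak_deriv (cbox l u) is f)"
    and "AE x in leb (cbox l u). weak_deriv (cbox l u) is f x = g x"
proof -
  have "weak_deriv (cbox l u) is f \<in> L2_space (cbox l u) \<and> is_weak_deriv (cbox l u) is f (weak_deriv (cbox l u) is f)"
    unfolding weak_deriv_def by (rule someI[of _ g]) (use assms in \<open>simp add: L2_space_leb\<close>)
  then show *: "weak_deriv (cbox l u) is f \<in> l2 (leb (cbox l u))"
    "is_weak_deriv (cbox l u) is f (weak_deriv (cbox l u) is f)"
    by (simp_all add: L2_space_leb)
  show "AE x in leb (cbox l u). weak_deriv (cbox l u) is f x = g x"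
    using * assms by (intro weak_deriv_unique l2_integrable[OF finite_leb_cbox])
qed

lemma is_weak_deriv_Nil: "is_weak_deriv S [] f f"
  by (simp add: is_weak_deriv_def)

lemma interval_cbox: "{a..b} = cbox a b" for a b :: real
  by (simp add: box_real)

lemma rect_cbox: "rect a b = cbox (0, a) (1, b)"
  by (auto simp: cbox_Pair_eq)

lemma C_k_partial_deriv: "(\<And>k. C_k k \<psi>) \<Longrightarrow> i \<in> Basis \<Longrightarrow> C_k k (partial_deriv i \<psi>)"
  by (meson C_k.simps(2))

lemma partial_deriv_support: "{x. partial_deriv i \<psi> x \<noteq> 0} \<subseteq> closure {x. \<psi> x \<noteq> 0}"
proof
  fix x assume x: "x \<in> {x. partial_deriv i \<psi> x \<noteq> 0}"
  show "x \<in> closure {x. \<psi> x \<noteq> 0}"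
  proof (rule ccontr)
    assume "x \<notin> closure {x. \<psi> x \<noteq> 0}"
    then have ev: "\<forall>\<^sub>F y in nhds x. y \<in> - closure {x. \<psi> x \<noteq> 0}"
      by (intro eventually_nhds_in_open) auto
    have "((\<lambda>_. 0) has_derivative (\<lambda>_. 0)) (at x)" by simp
    then have "(\<psi> has_derivative (\<lambda>_. 0)) (at x)"
    proof (rule has_derivative_transform_eventually)
      show "\<forall>\<^sub>F y in at x. 0 = \<psi> y"
        using ev closure_subset[of "{x. \<psi> x \<noteq> 0}"] by (auto simp: eventually_at_filter elim!: eventually_mono)
      show "0 = \<psi> x"
        using eventually_nhds_x_imp_x[OF ev] closure_subset[of "{x. \<psi> x \<noteq> 0}"] by auto
    qed simp
    then show False using x partial_deriv_eq by fastforce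
  qed
qed

lemma test_function_partial_deriv:
  assumes "test_function S \<psi>" "i \<in> Basis"
  shows "test_function S (partial_deriv i \<psi>)"
  using assms partial_deriv_support[of i \<psi>]
  by (intro test_function_compactI[where K="closure {x. \<psi> x \<noteq> 0}"] C_k_partial_deriv) (auto simp: test_function_def)


section \<open>Recovering a function from its second derivative\<close>

text \<open>
  Derivatives of test functions are test functions, so \<open>u\<close> can be tested with \<open>\<psi>'\<close> in the first
  assumption.
\<close>

lemma is_weak_deriv_second:
  fixes u ux m :: "real \<Rightarrow> 'e::euclidean_space"
  assumes "is_weak_deriv {a..b} [1] u ux" "is_weak_deriv {a..b} [1, 1] u m"
  shows "is_weak_deriv {a..b} [1] ux m"
  unfolding is_weak_deriv_def
proof (intro allI impI)
  fix \<psi> :: "real \<Rightarrow> real" assume \<psi>: "test_function (interior {a..b}) \<psi>"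
  have \<psi>': "test_function (interior {a..b}) (partial_deriv 1 \<psi>)"
    by (rule test_function_partial_deriv[OF \<psi>]) simp
  have "(LINT x:{a..b}|lborel. partial_deriv 1 (partial_deriv 1 \<psi>) x *\<^sub>R u x) = - (LINT x:{a..b}|lborel. partial_deriv 1 \<psi> x *\<^sub>R ux x)"
    using assms(1) \<psi>' unfolding is_weak_deriv_def by force
  moreover have "(LINT x:{a..b}|lborel. partial_deriv 1 (partial_deriv 1 \<psi>) x *\<^sub>R u x) = (LINT x:{a..b}|lborel. \<psi> x *\<^sub>R m x)"
    using assms(2) \<psi> unfolding is_weak_deriv_def by force
  ultimately show "(LINT x:{a..b}|lborel. foldr partial_deriv [1] \<psi> x *\<^sub>R ux x) =
      (- 1) ^ length [1::real] *\<^sub>R (LINT x:{a..b}|lborel. \<psi> x *\<^sub>R m x)"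
    by simp
qed

text \<open>
  Cauchy's formula for repeated integration.
\<close>

lemma integral_integral_Icc:
  fixes m :: "real \<Rightarrow> 'e::euclidean_space"
  assumes m: "integrable (leb {a..x}) m" and "a \<le> x"
  shows "(LINT t:{a..x}|lborel. (LINT \<theta>:{a..t}|lborel. m \<theta>)) = (LINT \<theta>:{a..x}|lborel. (x - \<theta>) *\<^sub>R m \<theta>)"
proof -
  let ?I = "leb {a..x}"
  have [measurable]: "m \<in> borel_measurable ?I" using m by auto
  note [measurable] = pred_le_pair(1)[of a x a x]
  have int: "integrable (?I \<Otimes>\<^sub>M ?I) (\<lambda>(t, \<theta>). if \<theta> \<le> t then m \<theta> else 0)"
  proof (rule Bochner_Integration.integrable_bound[OF integrable_lift(2)[OF finite_leb_interval finite_leb_interval m]])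
    have "(\<lambda>z. if snd z \<le> fst z then m (snd z) else 0) \<in> borel_measurable (?I \<Otimes>\<^sub>M ?I)"
      by measurable
    then show "(\<lambda>(t, \<theta>). if \<theta> \<le> t then m \<theta> else 0) \<in> borel_measurable (?I \<Otimes>\<^sub>M ?I)"
      by (simp add: split_beta')
  qed auto
  have "(LINT t:{a..x}|lborel. (LINT \<theta>:{a..t}|lborel. m \<theta>)) = (\<integral>t. (\<integral>\<theta>. (if \<theta> \<le> t then m \<theta> else 0) \<partial>?I) \<partial>?I)"
    unfolding set_integral_leb[OF borel_closed[OF closed_atLeastAtMost], of a x]
  proof (intro Bochner_Integration.integral_cong refl)
    fix t assume "t \<in> space ?I"
    then show "(LINT \<theta>:{a..t}|lborel. m \<theta>) = (\<integral>\<theta>. (if \<theta> \<le> t then m \<theta> else 0) \<partial>?I)"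
      by (subst set_integral_subset_leb[of _ "{a..x}"]) (auto intro!: Bochner_Integration.integral_cong)
  qed
  also have "\<dots> = (\<integral>\<theta>. (\<integral>t. (if \<theta> \<le> t then m \<theta> else 0) \<partial>?I) \<partial>?I)"
    using intervals.Fubini_integral[OF int] by simp
  also have "\<dots> = (\<integral>\<theta>. (x - \<theta>) *\<^sub>R m \<theta> \<partial>?I)"
  proof (intro Bochner_Integration.integral_cong refl)
    fix \<theta> assume "\<theta> \<in> space ?I"
    then have \<theta>: "a \<le> \<theta>" "\<theta> \<le> x" by auto
    have "(\<integral>t. (if \<theta> \<le> t then m \<theta> else 0) \<partial>?I) = (LINT t:{\<theta>..x}|lborel. m \<theta>)"
      using \<theta> by (subst set_integral_subset_leb[of _ "{a..x}"]) (auto intro!: Bochner_Integration.integral_cong)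
    also have "\<dots> = (x - \<theta>) *\<^sub>R m \<theta>"
      using \<theta> by (simp add: set_integral_const)
    finally show "(\<integral>t. (if \<theta> \<le> t then m \<theta> else 0) \<partial>?I) = (x - \<theta>) *\<^sub>R m \<theta>" .
  qed
  finally show ?thesis by (simp add: set_integral_leb)
qed

lemma mat_mult_vec: "mat c *v y = c *\<^sub>R y" for y :: "real^'n"
  by (subst mat_eq_scaleR) (simp add: scaleR_matrix_vector_assoc[symmetric])

text \<open>
  The part \<open>N\<close> that both kernels share is integrated over the whole interval; it is counted twice
  only on the diagonal \<open>\<theta> = x\<close>.
\<close>

lemma triangular_kernels_split:
  fixes N :: "real \<Rightarrow> real^'n^'n" and m :: "real \<Rightarrow> real^'n"
  assumes x: "x \<in> {a..b}" and m: "integrable (leb {a..b}) m"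
    and N: "continuous_on UNIV N" and \<alpha>: "continuous_on UNIV \<alpha>"
    and k1: "\<And>\<theta>. k1 (x, \<theta>) = mat (\<alpha> \<theta>) + N \<theta>" and k2: "\<And>\<theta>. k2 (x, \<theta>) = N \<theta>"
  shows "(\<integral>\<theta>. lower_part k1 (x, \<theta>) *v m \<theta> \<partial>leb {a..b}) + (\<integral>\<theta>. upper_part k2 (x, \<theta>) *v m \<theta> \<partial>leb {a..b})
    = (LINT \<theta>:{a..x}|lborel. \<alpha> \<theta> *\<^sub>R m \<theta>) + (\<integral>\<theta>. N \<theta> *v m \<theta> \<partial>leb {a..b})"
proof -
  let ?I = "leb {a..b}"
  have bN: "ess_bounded ?I N" by (rule ess_bounded_continuous) (auto intro: continuous_on_subset[OF N])
  have b\<alpha>: "ess_bounded ?I (\<lambda>\<theta>. mat (\<alpha> \<theta>) :: real^'n^'n)"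
    by (subst mat_eq_scaleR, rule ess_bounded_continuous)
      (auto intro!: continuous_intros continuous_on_subset[OF \<alpha>])
  have p: "Measurable.pred ?I (\<lambda>\<theta>. \<theta> \<le> x)" "Measurable.pred ?I (\<lambda>\<theta>. x \<le> \<theta>)"
    using ident_leb by measurable
  note eb = ess_bounded_if[OF p(1) _ ess_bounded_zero] ess_bounded_if[OF p(2) _ ess_bounded_zero]
  note int = integrable_mult[OF _ m]
  have i1: "integrable ?I (\<lambda>\<theta>. (if \<theta> \<le> x then mat (\<alpha> \<theta>) else 0) *v m \<theta>)"
    and i2: "integrable ?I (\<lambda>\<theta>. (if \<theta> \<le> x then N \<theta> else 0) *v m \<theta>)"
    and i3: "integrable ?I (\<lambda>\<theta>. (if x \<le> \<theta> then N \<theta> else 0) *v m \<theta>)"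
    by (intro int eb bN b\<alpha>)+
  have "(\<integral>\<theta>. lower_part k1 (x, \<theta>) *v m \<theta> \<partial>?I) = (\<integral>\<theta>. (if \<theta> \<le> x then mat (\<alpha> \<theta>) else 0) *v m \<theta> + (if \<theta> \<le> x then N \<theta> else 0) *v m \<theta> \<partial>?I)"
    by (intro Bochner_Integration.integral_cong) (auto simp: lower_part_def k1 matrix_vector_mult_add_rdistrib)
  also have "\<dots> = (\<integral>\<theta>. (if \<theta> \<le> x then mat (\<alpha> \<theta>) else 0) *v m \<theta> \<partial>?I) + (\<integral>\<theta>. (if \<theta> \<le> x then N \<theta> else 0) *v m \<theta> \<partial>?I)"
    by (rule Bochner_Integration.integral_add[OF i1 i2])
  finally have 1: "(\<integral>\<theta>. lower_part k1 (x, \<theta>) *v m \<theta> \<partial>?I) = \<dots>" .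
  have 2: "(\<integral>\<theta>. upper_part k2 (x, \<theta>) *v m \<theta> \<partial>?I) = (\<integral>\<theta>. (if x \<le> \<theta> then N \<theta> else 0) *v m \<theta> \<partial>?I)"
    by (intro Bochner_Integration.integral_cong) (auto simp: upper_part_def k2)
  have "(\<integral>\<theta>. (if \<theta> \<le> x then N \<theta> else 0) *v m \<theta> \<partial>?I) + (\<integral>\<theta>. (if x \<le> \<theta> then N \<theta> else 0) *v m \<theta> \<partial>?I)
      = (\<integral>\<theta>. (if \<theta> \<le> x then N \<theta> else 0) *v m \<theta> + (if x \<le> \<theta> then N \<theta> else 0) *v m \<theta> \<partial>?I)"
    by (rule Bochner_Integration.integral_add[OF i2 i3, symmetric])
  also have "\<dots> = (\<integral>\<theta>. N \<theta> *v m \<theta> \<partial>?I)"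
  proof (rule integral_cong_AE)
    have "AE \<theta> in ?I. \<theta> \<noteq> x" by (rule AE_leb_neq) simp
    then show "AE \<theta> in ?I. (if \<theta> \<le> x then N \<theta> else 0) *v m \<theta> + (if x \<le> \<theta> then N \<theta> else 0) *v m \<theta> = N \<theta> *v m \<theta>"
      by eventually_elim auto
  qed (use i2 i3 int[OF bN] in auto)
  finally have 3: "(\<integral>\<theta>. (if \<theta> \<le> x then N \<theta> else 0) *v m \<theta> \<partial>?I) + (\<integral>\<theta>. (if x \<le> \<theta> then N \<theta> else 0) *v m \<theta> \<partial>?I) = \<dots>" .
  have 4: "(\<integral>\<theta>. (if \<theta> \<le> x then mat (\<alpha> \<theta>) else 0) *v m \<theta> \<partial>?I) = (LINT \<theta>:{a..x}|lborel. \<alpha> \<theta> *\<^sub>R m \<theta>)"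
    using x by (subst set_integral_subset_leb[of _ "{a..b}"])
      (auto intro!: Bochner_Integration.integral_cong simp: mat_mult_vec)
  show ?thesis unfolding 1 2 using 3 4 by (simp add: add.assoc)
qed

lemma matrix_inv_left: "invertible A \<Longrightarrow> matrix_inv A ** A = mat 1" for A :: "real^'n^'m"
  unfolding matrix_inv_def invertible_def by (rule someI2_ex) auto

lemma matrix_vector_minus: "A *v (- x) = - (A *v x)" "(- A) *v x = - (A *v x)" for A :: "real^'n^'m"
  by (simp_all add: matrix_vector_mult_def vec_eq_iff sum_negf)

lemma vstack_add: "(x \<oplus> y) + (x' \<oplus> y') = (x + x') \<oplus> (y + y')"
  for x x' :: "'e::real_vector ^ 'p" and y y' :: "'e ^ 'q"
  by (auto simp: vstack_def vec_eq_iff split: sum.split)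

lemma vstack_scaleR: "c *\<^sub>R (x \<oplus> y) = (c *\<^sub>R x) \<oplus> (c *\<^sub>R y)"
  for x :: "'e::real_vector ^ 'p" and y :: "'e ^ 'q"
  by (auto simp: vstack_def vec_eq_iff split: sum.split)

lemma sum_UNIV_sum: "(\<Sum>i\<in>UNIV. f i) = (\<Sum>j\<in>UNIV. f (Inl j)) + (\<Sum>k\<in>UNIV. f (Inr k))"
  for f :: "'p::finite + 'q::finite \<Rightarrow> 'e::comm_monoid_add"
  using sum.Plus[of UNIV UNIV f] by (simp add: comp_def)

lemma hstack_mult: "(M \<parallel> N) *v (x \<oplus> y) = M *v x + N *v y" for x :: "real^'p"
  by (auto simp: hstack_def vstack_def matrix_vector_mult_def vec_eq_iff sum_UNIV_sum)

lemma vstack_mult: "(M \<oplus> N) *v x = (M *v x) \<oplus> (N *v x)" for x :: "real^'p"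
  by (auto simp: vstack_def matrix_vector_mult_def vec_eq_iff split: sum.split)

lemma vstack_0: "0 \<oplus> 0 = 0"
  by (auto simp: vstack_def vec_eq_iff split: sum.split)

lemma continuous_on_Q_mat: "continuous_on S (\<lambda>\<theta>. Q_mat b \<theta> :: real^'n^_)"
  by (subst Q_mat_affine) (auto intro!: continuous_intros)

lemma
  fixes f :: "'a \<Rightarrow> real^'p" and g :: "'a \<Rightarrow> real^'q"
  assumes f: "integrable M f" and g: "integrable M g"
  shows integrable_vstack: "integrable M (\<lambda>x. f x \<oplus> g x)"
    and integral_vstack: "(\<integral>x. f x \<oplus> g x \<partial>M) = (\<integral>x. f x \<partial>M) \<oplus> (\<integral>x. g x \<partial>M)"
proof -
  have bl: "bounded_linear (\<lambda>x. x \<oplus> 0 :: real^('p+'q))" "bounded_linear (\<lambda>y. 0 \<oplus> y :: real^('p+'q))"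
    unfolding linear_conv_bounded_linear[symmetric]
    by (auto intro!: linearI simp: vstack_add vstack_scaleR)
  have eq: "x \<oplus> y = (x \<oplus> 0) + (0 \<oplus> y)" for x :: "real^'p" and y :: "real^'q"
    by (simp add: vstack_add)
  show "integrable M (\<lambda>x. f x \<oplus> g x)"
    by (subst eq) (intro Bochner_Integration.integrable_add integrable_bounded_linear[OF bl(1) f] integrable_bounded_linear[OF bl(2) g])
  show "(\<integral>x. f x \<oplus> g x \<partial>M) = (\<integral>x. f x \<partial>M) \<oplus> (\<integral>x. g x \<partial>M)"
    by (subst (1 2) eq) (simp only: Bochner_Integration.integral_add[OF integrable_bounded_linear[OF bl(1) f] integrable_bounded_linear[OF bl(2) g]]
        integral_bounded_linear[OF bl(1) f] integral_bounded_linear[OF bl(2) g])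
qed

lemma integral_Q_mat:
  fixes m :: "real \<Rightarrow> real^'n"
  assumes m: "integrable (leb {a..b}) m"
  shows "(\<integral>\<theta>. Q_mat b \<theta> *v m \<theta> \<partial>leb {a..b})
    = 0 \<oplus> (LINT \<theta>:{a..b}|lborel. (b - \<theta>) *\<^sub>R m \<theta>) \<oplus> 0 \<oplus> (LINT \<theta>:{a..b}|lborel. m \<theta>)"
proof -
  have "integrable (leb {a..b}) (\<lambda>\<theta>. (b - \<theta>) *\<^sub>R m \<theta>)"
    by (intro integrable_continuous_scaleR m) (auto intro!: continuous_intros)
  then show ?thesis
    using m by (simp add: Q_mat_def vstack_mult mat_mult_vec integral_vstack integrable_vstack set_integral_leb del: mat_0)
qed

text \<open>
  By Taylor's formula \<open>u(x) = u(a) + (x - a) u\<^sub>x(a) + \<integral>\<^sub>a\<^sup>x (x - \<theta>) m(\<theta>) d\<theta>\<close>.  In terms of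
  \<open>w = (u(a), u\<^sub>x(a))\<close> the four boundary values are \<open>H w + \<integral>\<^sub>a\<^sup>b Q m\<close>, and the boundary condition
  \<open>B H w + B \<integral>\<^sub>a\<^sup>b Q m = 0\<close> determines \<open>w = - (B H)\<^sup>-\<^sup>1 B \<integral>\<^sub>a\<^sup>b Q m\<close>.  Inserting this into the
  formulas for \<open>u\<close> and \<open>u\<^sub>x\<close> produces the kernels \<open>T\<^sub>1, T\<^sub>2\<close> and their derivatives.
\<close>

lemma X_space_representation:
  fixes B :: "real ^ ('n + 'n + 'n + 'n) ^ ('n::finite + 'n)"
  assumes u: "u \<in> X_space a b B" and ab: "a < b" and inv: "invertible (B ** H_mat a b)"
    and m: "m \<in> l2 (leb {a..b})" and um: "is_weak_deriv {a..b} [1, 1] u m"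
  shows "\<exists>ux. continuous_on {a..b} ux \<and> is_weak_deriv {a..b} [1] u ux \<and>
    (\<forall>x\<in>{a..b}. u x = opT1 a b B m x \<and> ux x = pi3_op a b (PI3 (\<lambda>_. 0) (T1x_ker a b B) (T2x_ker a b B)) m x)"
proof -
  let ?I = "leb {a..b}"
  obtain ux where ux: "continuous_on {a..b} ux" "is_weak_deriv {a..b} [1] u ux"
    and bc: "B *v (u a \<oplus> u b \<oplus> ux a \<oplus> ux b) = 0" and uc: "continuous_on {a..b} u"
    using u by (auto simp: X_space_def H2_space_def)
  have mi: "integrable ?I m" by (rule l2_integrable[OF finite_leb_interval m])
  have uxi: "integrable ?I ux"
    by (rule l2_integrable[OF finite_leb_interval l2_continuous[OF _ ux(1)]]) simp
  note uxm = is_weak_deriv_second[OF ux(2) um]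
  have ux_eq: "ux x = ux a + (LINT t:{a..x}|lborel. m t)" if "x \<in> {a..b}" for x
    by (rule eq_integral_weak_deriv[OF ux(1) mi uxm that])
  have u_eq: "u x = u a + (x - a) *\<^sub>R ux a + (LINT \<theta>:{a..x}|lborel. (x - \<theta>) *\<^sub>R m \<theta>)" if x: "x \<in> {a..b}" for x
  proof -
    have mx: "integrable (leb {a..x}) m"
      using mi x by (auto simp: set_integrable_leb[symmetric] intro: set_integrable_subset)
    have "(LINT t:{a..x}|lborel. ux t) = (LINT t:{a..x}|lborel. ux a + (LINT \<theta>:{a..t}|lborel. m \<theta>))"
      by (intro set_lebesgue_integral_cong allI impI ux_eq) (use x in auto)
    also have "\<dots> = (LINT t:{a..x}|lborel. ux a) + (LINT t:{a..x}|lborel. (LINT \<theta>:{a..t}|lborel. m \<theta>))"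
    proof (rule set_integral_add)
      show c: "set_integrable lborel {a..x} (\<lambda>t. ux a)"
        by (simp add: set_integrable_leb finite_measure.integrable_const[OF finite_leb_interval])
      have "set_integrable lborel {a..x} (\<lambda>t. ux t - ux a)"
        using uxi x by (intro set_integral_diff c) (auto simp: set_integrable_leb[symmetric] intro: set_integrable_subset)
      moreover have "ux t - ux a = (LINT \<theta>:{a..t}|lborel. m \<theta>)" if "t \<in> {a..x}" for t
        using ux_eq[of t] that x by auto
      ultimately show "set_integrable lborel {a..x} (\<lambda>t. LINT \<theta>:{a..t}|lborel. m \<theta>)"
        by (subst (asm) set_integrable_cong) auto
    qed
    also have "(LINT t:{a..x}|lborel. (LINT \<theta>:{a..t}|lborel. m \<theta>)) = (LINT \<theta>:{a..x}|lborel. (x - \<theta>) *\<^sub>R m \<theta>)"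
      using x by (intro integral_integral_Icc mx) auto
    also have "(LINT t:{a..x}|lborel. ux a) = (x - a) *\<^sub>R ux a"
      using x by (simp add: set_integral_const)
    finally show ?thesis using eq_integral_weak_deriv[OF uc uxi ux(2) x] by simp
  qed
  define w where "w = u a \<oplus> ux a"
  define e where "e = (\<integral>\<theta>. Q_mat b \<theta> *v m \<theta> \<partial>?I)"
  have "u a \<oplus> u b \<oplus> ux a \<oplus> ux b = H_mat a b *v w + e"
    using ux_eq[of b] u_eq[of b] ab
    by (simp add: H_mat_def w_def e_def integral_Q_mat[OF mi] vstack_mult hstack_mult mat_mult_vec vstack_add del: mat_0)
  then have "(B ** H_mat a b) *v w + B *v e = 0"
    using bc by (simp add: matrix_vector_right_distrib matrix_vector_mul_assoc)
  then have "(B ** H_mat a b) *v w = - (B *v e)" by (simp add: eq_neg_iff_add_eq_0)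
  then have "matrix_inv (B ** H_mat a b) *v ((B ** H_mat a b) *v w) = matrix_inv (B ** H_mat a b) *v (- (B *v e))"
    by simp
  then have w_eq: "w = - ((matrix_inv (B ** H_mat a b) ** B) *v e)"
    using matrix_inv_left[OF inv]
    by (simp add: matrix_vector_mul_assoc matrix_vector_minus)
  have Qb: "ess_bounded ?I (\<lambda>\<theta>. Q_mat b \<theta> :: real^'n^_)"
    by (rule ess_bounded_continuous) (auto intro: continuous_on_Q_mat)
  \<comment> \<open>\<open>G\<close> will be \<open>K(x)\<close> for the value \<open>u(x)\<close> and \<open>(0 I)\<close> for \<open>u\<^sub>x(x)\<close>.\<close>
  have boundary: "G *v w = (\<integral>\<theta>. (- (G ** (matrix_inv (B ** H_mat a b) ** B) ** Q_mat b \<theta>)) *v m \<theta> \<partial>?I)" for G :: "real^('n+'n)^'n"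
  proof -
    let ?L = "\<lambda>y. - ((G ** (matrix_inv (B ** H_mat a b) ** B)) *v y)"
    have bl: "bounded_linear ?L"
      unfolding linear_conv_bounded_linear[symmetric]
      by (auto intro!: linearI simp: matrix_vector_right_distrib matrix_vector_mult_scaleR)
    have "G *v w = ?L e"
      by (simp add: w_eq matrix_vector_mul_assoc matrix_vector_minus)
    also have "\<dots> = (\<integral>\<theta>. ?L (Q_mat b \<theta> *v m \<theta>) \<partial>?I)"
      unfolding e_def by (rule integral_bounded_linear[OF bl integrable_mult[OF Qb mi], symmetric])
    finally show ?thesis
      by (simp add: matrix_vector_mul_assoc matrix_vector_minus)
  qed
  have cont: "continuous_on UNIV (\<lambda>\<theta>. - (G ** (matrix_inv (B ** H_mat a b) ** B) ** Q_mat b \<theta>))" for G :: "real^('n+'n)^'n"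
    by (intro continuous_intros bounded_bilinear.continuous_on[OF bounded_bilinear_matrix_mult] continuous_on_Q_mat)
  have "u x = opT1 a b B m x \<and> ux x = pi3_op a b (PI3 (\<lambda>_. 0) (T1x_ker a b B) (T2x_ker a b B)) m x" if x: "x \<in> {a..b}" for x
  proof
    have "opT1 a b B m x = (LINT \<theta>:{a..x}|lborel. (x - \<theta>) *\<^sub>R m \<theta>) + K_mat a x *v w"
      unfolding boundary opT1_pi pi3_op_kernels[OF x] T1_pi_def pi3.sel matrix_vector_mult_0 add_0
      by (rule triangular_kernels_split[OF x mi cont]) (auto intro!: continuous_intros simp: T1_ker_def T2_ker_def matrix_mul_assoc)
    also have "K_mat a x *v w = u a + (x - a) *\<^sub>R ux a"
      by (simp add: K_mat_def w_def hstack_mult mat_mult_vec)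
    finally show "u x = opT1 a b B m x" using u_eq[OF x] by simp
    have "pi3_op a b (PI3 (\<lambda>_. 0) (T1x_ker a b B) (T2x_ker a b B)) m x = (LINT \<theta>:{a..x}|lborel. 1 *\<^sub>R m \<theta>) + (mat 0 \<parallel> mat 1) *v w"
      unfolding boundary pi3_op_kernels[OF x] pi3.sel matrix_vector_mult_0 add_0
      by (rule triangular_kernels_split[OF x mi cont]) (auto intro!: continuous_intros simp: T1x_ker_def T2x_ker_def matrix_mul_assoc)
    also have "(mat 0 \<parallel> mat 1) *v w = ux a"
      by (simp add: w_def hstack_mult mat_mult_vec del: mat_0)
    finally show "ux x = pi3_op a b (PI3 (\<lambda>_. 0) (T1x_ker a b B) (T2x_ker a b B)) m x" using ux_eq[OF x] by simp
  qed
  then show ?thesis using ux by blast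
qed

lemma integral_A_ker:
  fixes T T' :: "real \<times> real \<Rightarrow> real^'n^'n"
  assumes T: "continuous_on UNIV T" "continuous_on UNIV T'" and m: "integrable (leb {a..b}) m"
    and Q: "Measurable.pred (leb {a..b}) Q"
  shows "(\<integral>\<theta>. (if Q \<theta> then C ** (T (x, \<theta>) \<oplus> T' (x, \<theta>) \<oplus> mat 0) else 0) *v m \<theta> \<partial>leb {a..b})
    = C *v ((\<integral>\<theta>. (if Q \<theta> then T (x, \<theta>) else 0) *v m \<theta> \<partial>leb {a..b})
        \<oplus> (\<integral>\<theta>. (if Q \<theta> then T' (x, \<theta>) else 0) *v m \<theta> \<partial>leb {a..b}) \<oplus> 0)"
proof -
  let ?I = "leb {a..b}"
  have c: "continuous_on {a..b} (\<lambda>\<theta>. T (x, \<theta>))" "continuous_on {a..b} (\<lambda>\<theta>. T' (x, \<theta>))"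
    using T by (auto intro!: continuous_on_compose2[of UNIV T] continuous_on_compose2[of UNIV T'] continuous_intros)
  have i: "integrable ?I (\<lambda>\<theta>. (if Q \<theta> then T (x, \<theta>) else 0) *v m \<theta>)" "integrable ?I (\<lambda>\<theta>. (if Q \<theta> then T' (x, \<theta>) else 0) *v m \<theta>)"
    by (intro integrable_mult m ess_bounded_if Q ess_bounded_zero ess_bounded_continuous c compact_Icc)+
  let ?f = "\<lambda>\<theta>. ((if Q \<theta> then T (x, \<theta>) else 0) *v m \<theta>) \<oplus> ((if Q \<theta> then T' (x, \<theta>) else 0) *v m \<theta>) \<oplus> (0 :: real^'n)"
  have "(if Q \<theta> then C ** (T (x, \<theta>) \<oplus> T' (x, \<theta>) \<oplus> mat 0) else 0) *v m \<theta> = C *v ?f \<theta>" for \<theta>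
    by (auto simp: matrix_vector_mul_assoc[symmetric] vstack_mult vstack_0)
  then have "(\<integral>\<theta>. (if Q \<theta> then C ** (T (x, \<theta>) \<oplus> T' (x, \<theta>) \<oplus> mat 0) else 0) *v m \<theta> \<partial>?I) = (\<integral>\<theta>. C *v ?f \<theta> \<partial>?I)"
    by simp
  also have "\<dots> = C *v (\<integral>\<theta>. ?f \<theta> \<partial>?I)"
    by (intro integral_bounded_linear matrix_vector_mul_bounded_linear integrable_vstack i) simp
  finally show ?thesis using i by (simp add: integral_vstack integrable_vstack)
qed

text \<open>
  The kernels of \<open>\<A>\<^sub>1\<^sub>1\<close> are \<open>A(x)\<close> times the kernels that produce \<open>u\<close> and \<open>u\<^sub>x\<close> from \<open>m = u\<^sub>x\<^sub>x\<close>.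
\<close>

lemma opA11_eq_jet:
  fixes B :: "real ^ ('n + 'n + 'n + 'n) ^ ('n::finite + 'n)"
  assumes u: "u \<in> X_space a b B" and ab: "a < b" and inv: "invertible (B ** H_mat a b)"
    and m: "m \<in> l2 (leb {a..b})" and um: "is_weak_deriv {a..b} [1, 1] u m"
  shows "AE x in leb {a..b}. A x *v jet a b u x = opA11 a b B A m x"
proof -
  let ?I = "leb {a..b}"
  obtain ux where ux: "continuous_on {a..b} ux" "is_weak_deriv {a..b} [1] u ux"
    and u_eq: "\<And>x. x \<in> {a..b} \<Longrightarrow> u x = opT1 a b B m x"
    and ux_eq: "\<And>x. x \<in> {a..b} \<Longrightarrow> ux x = pi3_op a b (PI3 (\<lambda>_. 0) (T1x_ker a b B) (T2x_ker a b B)) m x"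
    using X_space_representation[OF assms] by blast
  have uxl: "ux \<in> l2 ?I" by (rule l2_continuous[OF _ ux(1)]) simp
  have mi: "integrable ?I m" by (rule l2_integrable[OF finite_leb_interval m])
  have 1: "AE x in ?I. weak_deriv {a..b} [1] u x = ux x"
    using weak_deriv_l2(3)[of ux a b "[1]" u, folded interval_cbox] uxl ux(2) by simp
  have 2: "AE x in ?I. weak_deriv {a..b} [1, 1] u x = m x"
    using weak_deriv_l2(3)[of m a b "[1, 1]" u, folded interval_cbox] m um by simp
  have 3: "AE x in ?I. x \<in> {a..b}" by (rule AE_leb_mem)
  have "Measurable.pred ?I (\<lambda>\<theta>. \<theta> \<le> x)" "Measurable.pred ?I (\<lambda>\<theta>. x \<le> \<theta>)" for x
    using ident_leb by measurable
  note A1 = integral_A_ker[OF continuous_on_T1_ker[of _ a b B] continuous_on_T1x_ker[of _ a b B] mi this(1)]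
    and A2 = integral_A_ker[OF continuous_on_T2_ker[of _ a b B] continuous_on_T2x_ker[of _ a b B] mi this(2)]
  show ?thesis
    using 1 2 3
  proof eventually_elim
    case (elim x)
    have "opA11 a b B A m x = A x *v (opT1 a b B m x \<oplus> ux x \<oplus> m x)"
      unfolding ux_eq[OF elim(3)] opA11_pi opT1_pi pi3_op_kernels[OF elim(3)] A11_pi_def T1_pi_def pi3.sel
        A_ker_T1 A_ker_T2 lower_part_def upper_part_def fst_conv snd_conv A1 A2
      by (simp add: matrix_vector_mul_assoc[symmetric] vstack_mult mat_mult_vec vstack_add
          matrix_vector_right_distrib[symmetric] del: mat_0)
    then show ?case using elim u_eq[OF elim(3)] by (simp add: jet_def)
  qed
qed


section \<open>Slices of functions with mixed weak derivatives\<close>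

lemma C_k_iterated_deriv:
  fixes \<eta> :: "real \<Rightarrow> real"
  assumes "\<And>k. C_k k \<eta>"
  shows "C_k k (foldr partial_deriv (replicate j 1) \<eta>)"
  by (induction j arbitrary: k) (auto intro: C_k_partial_deriv assms)

lemma has_derivative_product:
  fixes \<rho> \<eta> :: "real \<Rightarrow> real"
  assumes "C_k 1 \<rho>" "C_k 1 \<eta>"
  shows "((\<lambda>z. \<rho> (fst z) * \<eta> (snd z)) has_derivative
    (\<lambda>h. \<rho> (fst z) * (partial_deriv 1 \<eta> (snd z) * snd h) + (partial_deriv 1 \<rho> (fst z) * fst h) * \<eta> (snd z))) (at z)"
proof (rule has_derivative_mult)
  have d: "(f has_derivative (\<lambda>h. partial_deriv 1 f x * h)) (at x)" if "C_k 1 f" for f :: "real \<Rightarrow> real" and x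
    using has_real_derivative_partial_deriv[of f x] that by (simp add: has_field_derivative_def)
  show "((\<lambda>z. \<rho> (fst z)) has_derivative (\<lambda>h. partial_deriv 1 \<rho> (fst z) * fst h)) (at z)"
    by (rule has_derivative_compose[OF has_derivative_fst[OF has_derivative_ident] d[OF assms(1)]])
  show "((\<lambda>z. \<eta> (snd z)) has_derivative (\<lambda>h. partial_deriv 1 \<eta> (snd z) * snd h)) (at z)"
    by (rule has_derivative_compose[OF has_derivative_snd[OF has_derivative_ident] d[OF assms(2)]])
qed

lemma partial_deriv_product:
  fixes \<rho> \<eta> :: "real \<Rightarrow> real"
  assumes "C_k 1 \<rho>" "C_k 1 \<eta>"
  shows "partial_deriv (1, 0) (\<lambda>z. \<rho> (fst z) * \<eta> (snd z)) = (\<lambda>z. partial_deriv 1 \<rho> (fst z) * \<eta> (snd z))"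
    and "partial_deriv (0, 1) (\<lambda>z. \<rho> (fst z) * \<eta> (snd z)) = (\<lambda>z. \<rho> (fst z) * partial_deriv 1 \<eta> (snd z))"
  using partial_deriv_eq[OF has_derivative_product[OF assms]] by (auto simp: fun_eq_iff)

lemma foldr_partial_deriv_product:
  fixes \<rho> \<eta> :: "real \<Rightarrow> real"
  assumes \<rho>: "\<And>k. C_k k \<rho>" and \<eta>: "\<And>k. C_k k \<eta>"
  shows "foldr partial_deriv ((1, 0) # replicate j (0, 1)) (\<lambda>z. \<rho> (fst z) * \<eta> (snd z))
    = (\<lambda>z. partial_deriv 1 \<rho> (fst z) * foldr partial_deriv (replicate j 1) \<eta> (snd z))"
proof -
  have *: "foldr partial_deriv (replicate j (0, 1)) (\<lambda>z. \<rho> (fst z) * \<eta> (snd z))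
      = (\<lambda>z. \<rho> (fst z) * foldr partial_deriv (replicate j 1) \<eta> (snd z))"
  proof (induction j)
    case (Suc j)
    show ?case
      unfolding replicate_Suc foldr_Cons comp_apply Suc
      by (rule partial_deriv_product(2)[OF \<rho> C_k_iterated_deriv[OF \<eta>]])
  qed simp
  show ?thesis
    unfolding foldr_Cons comp_apply *
    by (rule partial_deriv_product(1)[OF \<rho> C_k_iterated_deriv[OF \<eta>]])
qed

lemma test_function_product:
  fixes \<rho> \<eta> :: "real \<Rightarrow> real"
  assumes \<rho>: "test_function S \<rho>" and \<eta>: "test_function T \<eta>"
  shows "test_function (S \<times> T) (\<lambda>z. \<rho> (fst z) * \<eta> (snd z))"
proof (rule test_function_compactI)
  show "C_k k (\<lambda>z. \<rho> (fst z) * \<eta> (snd z))" for k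
    using C_k_mult[OF C_k_affine_comp[OF C_k_test_function[OF \<rho>], of k 0 1 "(1::real, 0::real)"]
        C_k_affine_comp[OF C_k_test_function[OF \<eta>], of k 0 1 "(0::real, 1::real)"]]
    by (simp add: inner_prod_def)
  show "{z. \<rho> (fst z) * \<eta> (snd z) \<noteq> 0} \<subseteq> closure {x. \<rho> x \<noteq> 0} \<times> closure {x. \<eta> x \<noteq> 0}"
    using closure_subset[of "{x. \<rho> x \<noteq> 0}"] closure_subset[of "{x. \<eta> x \<noteq> 0}"] by auto
qed (use \<rho> \<eta> in \<open>auto simp: test_function_def intro: compact_Times\<close>)

lemma compact_rect: "compact (rect a b)"
  by (intro compact_Times compact_Icc)

text \<open>
  Testing with the products \<open>\<rho>(s) \<eta>(x)\<close> says that \<open>F(s) = \<integral> \<eta>\<^sup>(\<^sup>j\<^sup>) \<phi>(s, \<cdot>)\<close> has the weak derivative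
  \<open>(-1)\<^sup>j \<integral> \<eta> g(s, \<cdot>)\<close> on \<open>[0, 1]\<close>.  As \<open>F\<close> is continuous, it is the integral of its derivative at every
  \<open>s\<close>, with no exceptional null set.
\<close>

lemma slice_weak_deriv:
  fixes \<phi> g :: "real \<times> real \<Rightarrow> 'e::euclidean_space"
  assumes \<phi>: "continuous_on (rect a b) \<phi>" and g: "integrable (leb (rect a b)) g"
    and weak: "is_weak_deriv (rect a b) ((1, 0) # replicate j (0, 1)) \<phi> g"
    and s: "s \<in> {0..1}" and \<eta>: "test_function (interior {a..b}) \<eta>"
  shows "(\<integral>x. foldr partial_deriv (replicate j 1) \<eta> x *\<^sub>R \<phi> (s, x) \<partial>leb {a..b})
    = (\<integral>x. foldr partial_deriv (replicate j 1) \<eta> x *\<^sub>R \<phi> (0, x) \<partial>leb {a..b})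
      + (- 1) ^ j *\<^sub>R (\<integral>x. \<eta> x *\<^sub>R (LINT \<theta>:{0..s}|lborel. g (\<theta>, x)) \<partial>leb {a..b})"
proof -
  let ?I = "leb {a..b}" and ?J = "leb {0..1::real}"
  define D where "D = foldr partial_deriv (replicate j 1) \<eta>"
  have \<eta>C: "C_k k \<eta>" for k using \<eta> by (rule C_k_test_function)
  have Dc: "continuous_on UNIV D"
    unfolding D_def by (rule C_k_continuous[OF C_k_iterated_deriv[OF \<eta>C]])
  have c_snd: "continuous_on UNIV (\<lambda>z. \<eta> (snd z))" and c_D: "continuous_on UNIV (\<lambda>z. D (snd z))"
    by (auto intro!: continuous_intros continuous_on_compose2[OF C_k_continuous[OF \<eta>C]] continuous_on_compose2[OF Dc])
  have \<phi>i: "integrable (leb (rect a b)) \<phi>"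
    by (intro l2_integrable[OF finite_leb_rect] l2_continuous \<phi>) (auto intro: compact_Times)
  have bd: "bounded (rect a b)" by (auto intro: bounded_Times)
  define F where "F s = (\<integral>x. D x *\<^sub>R \<phi> (s, x) \<partial>?I)" for s
  define G where "G s = (\<integral>x. \<eta> x *\<^sub>R g (s, x) \<partial>?I)" for s
  have \<eta>g: "integrable (?J \<Otimes>\<^sub>M ?I) (\<lambda>z. \<eta> (snd z) *\<^sub>R g z)"
    using integrable_continuous_scaleR[OF c_snd bd g] by (simp add: leb_rect)
  have Gi: "integrable ?J G"
    using intervals.integrable_fst'[OF \<eta>g] by (simp add: G_def[abs_def])
  have h: "continuous_on (rect a b) (\<lambda>z. D (snd z) *\<^sub>R \<phi> z)"
    by (intro continuous_intros \<phi> continuous_on_subset[OF c_D]) auto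
  have Fc: "continuous_on {0..1} F"
    unfolding continuous_on_sequentially
  proof (intro allI impI ballI)
    fix r :: "nat \<Rightarrow> real" and t assume "t \<in> {0..1}" "(\<forall>n. r n \<in> {0..1}) \<and> r \<longlonglongrightarrow> t"
    then have r: "\<And>n. r n \<in> {0..1}" "r \<longlonglongrightarrow> t" and t: "t \<in> {0..1}" by auto
    obtain C where C: "\<And>z. z \<in> rect a b \<Longrightarrow> norm (D (snd z) *\<^sub>R \<phi> z) \<le> C"
      using compact_imp_bounded[OF compact_continuous_image[OF h compact_rect]] unfolding bounded_iff by blast
    have m: "(\<lambda>x. D x *\<^sub>R \<phi> (t, x)) \<in> borel_measurable ?I" if t: "t \<in> {0..1}" for t
    proof -
      have "continuous_on {a..b} (\<lambda>x. D (snd (t, x)) *\<^sub>R \<phi> (t, x))"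
        by (rule continuous_on_compose2[OF h]) (use t in \<open>auto intro!: continuous_intros\<close>)
      then show ?thesis using l2_measurable[OF l2_continuous[OF compact_Icc]] by force
    qed
    show "(F \<circ> r) \<longlonglongrightarrow> F t"
      unfolding F_def comp_def
    proof (rule integral_dominated_convergence[where w="\<lambda>_. C"])
      show "AE x in ?I. (\<lambda>n. D x *\<^sub>R \<phi> (r n, x)) \<longlonglongrightarrow> D x *\<^sub>R \<phi> (t, x)"
      proof (rule AE_I2)
        fix x assume "x \<in> space ?I"
        then have "(\<lambda>n. \<phi> (r n, x)) \<longlonglongrightarrow> \<phi> (t, x)"
          using r t by (intro continuous_on_tendsto_compose[OF \<phi>]) (auto intro!: tendsto_intros)
        then show "(\<lambda>n. D x *\<^sub>R \<phi> (r n, x)) \<longlonglongrightarrow> D x *\<^sub>R \<phi> (t, x)" by (intro tendsto_intros)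
      qed
      show "AE x in ?I. norm (D x *\<^sub>R \<phi> (r n, x)) \<le> C" for n
        using C[of "(r n, _)"] r(1)[of n] by (intro AE_I2) auto
    qed (use m r t in auto)
  qed
  have "is_weak_deriv {0..1} [1] F (\<lambda>s. (- 1) ^ j *\<^sub>R G s)"
    unfolding is_weak_deriv_def
  proof (intro allI impI)
    fix \<rho> :: "real \<Rightarrow> real" assume \<rho>: "test_function (interior {0..1}) \<rho>"
    let ?\<psi> = "\<lambda>z. \<rho> (fst z) * \<eta> (snd z)"
    have \<rho>C: "C_k k \<rho>" for k using \<rho> by (rule C_k_test_function)
    have test: "test_function (interior (rect a b)) ?\<psi>"
      unfolding interior_Times by (rule test_function_product[OF \<rho> \<eta>])
    have c1: "continuous_on UNIV (\<lambda>z. partial_deriv 1 \<rho> (fst z) * D (snd z))"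
    proof -
      have "C_k 0 (partial_deriv 1 \<rho>)" by (rule C_k_partial_deriv[OF \<rho>C]) simp
      from continuous_on_compose2[OF C_k_continuous[OF this] continuous_on_fst[OF continuous_on_id]]
      have "continuous_on UNIV (\<lambda>z :: real \<times> real. partial_deriv 1 \<rho> (fst z))" by blast
      then show ?thesis by (intro continuous_on_mult c_D)
    qed
    have i1: "integrable (?J \<Otimes>\<^sub>M ?I) (\<lambda>z. (partial_deriv 1 \<rho> (fst z) * D (snd z)) *\<^sub>R \<phi> z)"
      using integrable_continuous_scaleR[OF c1 bd \<phi>i] by (simp add: leb_rect)
    have i2: "integrable (?J \<Otimes>\<^sub>M ?I) (\<lambda>z. ?\<psi> z *\<^sub>R g z)"
      using integrable_test_function[OF test bd g] by (simp add: leb_rect)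
    have "(\<integral>z. (partial_deriv 1 \<rho> (fst z) * D (snd z)) *\<^sub>R \<phi> z \<partial>leb (rect a b))
        = (- 1) ^ Suc j *\<^sub>R (\<integral>z. ?\<psi> z *\<^sub>R g z \<partial>leb (rect a b))"
      using weak[unfolded is_weak_deriv_def, rule_format, OF test]
      unfolding foldr_partial_deriv_product[OF \<rho>C \<eta>C] D_def[symmetric]
      by (simp add: set_integral_leb)
    moreover have "(\<integral>z. (partial_deriv 1 \<rho> (fst z) * D (snd z)) *\<^sub>R \<phi> z \<partial>leb (rect a b)) = (\<integral>s. partial_deriv 1 \<rho> s *\<^sub>R F s \<partial>?J)"
      unfolding leb_rect intervals.integral_fst'[OF i1, symmetric] F_def
      by (simp flip: integral_scaleR_right)
    moreover have "(\<integral>z. ?\<psi> z *\<^sub>R g z \<partial>leb (rect a b)) = (\<integral>s. \<rho> s *\<^sub>R G s \<partial>?J)"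
      unfolding leb_rect intervals.integral_fst'[OF i2, symmetric] G_def
      by (simp flip: integral_scaleR_right)
    moreover have "(\<integral>s. \<rho> s *\<^sub>R ((- 1) ^ j *\<^sub>R G s) \<partial>?J) = (- 1) ^ j *\<^sub>R (\<integral>s. \<rho> s *\<^sub>R G s \<partial>?J)"
      unfolding integral_scaleR_right[symmetric] by (simp add: mult.commute)
    ultimately show "(LINT s:{0..1}|lborel. foldr partial_deriv [1] \<rho> s *\<^sub>R F s)
        = (- 1) ^ length [1::real] *\<^sub>R (LINT s:{0..1}|lborel. \<rho> s *\<^sub>R ((- 1) ^ j *\<^sub>R G s))"
      by (simp add: set_integral_leb)
  qed
  from eq_integral_weak_deriv[OF Fc _ this s] Gi
  have Fs: "F s = F 0 + (- 1) ^ j *\<^sub>R (LINT t:{0..s}|lborel. G t)" by simp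
  have "(LINT t:{0..s}|lborel. G t) = (\<integral>x. \<eta> x *\<^sub>R (LINT \<theta>:{0..s}|lborel. g (\<theta>, x)) \<partial>?I)"
  proof -
    let ?w = "\<lambda>z. if fst z \<in> {0..s} then \<eta> (snd z) *\<^sub>R g z else 0"
    have [measurable]: "(\<lambda>z. \<eta> (snd z) *\<^sub>R g z) \<in> borel_measurable (?J \<Otimes>\<^sub>M ?I)" using \<eta>g by auto
    note [measurable] = fst_leb[of "{0..1}" ?I]
    have int: "integrable (?J \<Otimes>\<^sub>M ?I) (\<lambda>(\<theta>, x). ?w (\<theta>, x))"
      unfolding split_beta' prod.collapse
    proof (rule Bochner_Integration.integrable_bound[OF \<eta>g])
      show "?w \<in> borel_measurable (?J \<Otimes>\<^sub>M ?I)" by measurable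
    qed auto
    have "(LINT t:{0..s}|lborel. G t) = (\<integral>t. (\<integral>x. ?w (t, x) \<partial>?I) \<partial>?J)"
      using s by (subst set_integral_subset_leb[of _ "{0..1}"])
        (auto simp: G_def intro!: Bochner_Integration.integral_cong)
    also have "\<dots> = (\<integral>x. (\<integral>t. ?w (t, x) \<partial>?J) \<partial>?I)"
      using intervals.Fubini_integral[OF int] by simp
    also have "\<dots> = (\<integral>x. \<eta> x *\<^sub>R (LINT \<theta>:{0..s}|lborel. g (\<theta>, x)) \<partial>?I)"
    proof (intro Bochner_Integration.integral_cong refl)
      fix x
      have "(LINT \<theta>:{0..s}|lborel. g (\<theta>, x)) = (\<integral>\<theta>. (if \<theta> \<in> {0..s} then g (\<theta>, x) else 0) \<partial>?J)"
        using s by (intro set_integral_subset_leb) auto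
      then show "(\<integral>t. ?w (t, x) \<partial>?J) = \<eta> x *\<^sub>R (LINT \<theta>:{0..s}|lborel. g (\<theta>, x))"
        by (simp flip: integral_scaleR_right) (intro Bochner_Integration.integral_cong; auto)
    qed
    finally show ?thesis .
  qed
  with Fs show ?thesis by (simp add: F_def D_def)
qed

subsection \<open>Primitives in the first variable\<close>

definition primitive :: "(real \<times> real \<Rightarrow> 'e::euclidean_space) \<Rightarrow> real \<Rightarrow> real \<Rightarrow> 'e"
  where "primitive w s x = (LINT \<theta>:{0..s}|lborel. w (\<theta>, x))"

text \<open>
  The primitive is the average of \<open>w\<close> cut off at \<open>s\<close>.
\<close>

lemma primitive_l2:
  assumes w: "w \<in> l2 (leb (rect a b))" and s: "s \<in> {0..1}"
  shows "primitive w s \<in> l2 (leb {a..b})"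
    and "z \<in> l2 (leb {a..b}) \<Longrightarrow> ip_l2 (leb {a..b}) (primitive w s) z
      = (\<integral>\<theta>. (if \<theta> \<le> s then ip_l2 (leb {a..b}) (\<lambda>x. w (\<theta>, x)) z else 0) \<partial>leb {0..1})"
proof -
  let ?I = "leb {a..b}" and ?J = "leb {0..1::real}"
  define v where "v z = (if fst z \<le> s then w z else 0)" for z
  have [measurable]: "w \<in> borel_measurable (?J \<Otimes>\<^sub>M ?I)" using l2_measurable[OF w] by (simp add: leb_rect)
  note [measurable] = fst_leb[of "{0..1}" ?I]
  have v: "v \<in> l2 (?J \<Otimes>\<^sub>M ?I)"
  proof (rule l2_boundedI)
    show "v \<in> borel_measurable (?J \<Otimes>\<^sub>M ?I)" unfolding v_def by measurable
    show "integrable (?J \<Otimes>\<^sub>M ?I) (\<lambda>z. (norm (w z))\<^sup>2)" using l2_integrable_power2[OF w] by (simp add: leb_rect)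
  qed (auto simp: v_def)
  have eq: "primitive w s = (\<lambda>x. \<integral>\<theta>. v (\<theta>, x) \<partial>?J)"
  proof
    fix x
    have "primitive w s x = (\<integral>\<theta>. (if \<theta> \<in> {0..s} then w (\<theta>, x) else 0) \<partial>?J)"
      unfolding primitive_def using s by (intro set_integral_subset_leb) auto
    also have "\<dots> = (\<integral>\<theta>. v (\<theta>, x) \<partial>?J)"
      by (intro Bochner_Integration.integral_cong) (auto simp: v_def)
    finally show "primitive w s x = (\<integral>\<theta>. v (\<theta>, x) \<partial>?J)" .
  qed
  note avg = adj_average[OF finite_leb_interval[of a b] finite_leb_interval[of 0 1], unfolded adj_def]
  show "primitive w s \<in> l2 ?I" unfolding eq using avg v by blast
  assume z: "z \<in> l2 ?I"
  have "ip_l2 ?I (primitive w s) z = ip_l2 (?J \<Otimes>\<^sub>M ?I) v (\<lambda>y. z (snd y))"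
    unfolding eq using avg v z by blast
  also have "\<dots> = (\<integral>\<theta>. (\<integral>x. v (\<theta>, x) \<bullet> z x \<partial>?I) \<partial>?J)"
    unfolding ip_l2_def
    using intervals.integral_fst'[OF l2_integrable_inner[OF v l2_lift(2)[OF finite_leb_interval finite_leb_interval z]]] by simp
  also have "\<dots> = (\<integral>\<theta>. (if \<theta> \<le> s then ip_l2 ?I (\<lambda>x. w (\<theta>, x)) z else 0) \<partial>?J)"
    by (intro Bochner_Integration.integral_cong) (auto simp: v_def ip_l2_def)
  finally show "ip_l2 ?I (primitive w s) z = (\<integral>\<theta>. (if \<theta> \<le> s then ip_l2 ?I (\<lambda>x. w (\<theta>, x)) z else 0) \<partial>?J)" .
qed

lemma integrable_slice_ip:
  assumes w: "w \<in> l2 (leb (rect a b))" and z: "z \<in> l2 (leb {a..b})"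
  shows "integrable (leb {0..1}) (\<lambda>\<theta>. ip_l2 (leb {a..b}) (\<lambda>x. w (\<theta>, x)) z)"
proof -
  let ?I = "leb {a..b}" and ?J = "leb {0..1::real}"
  show ?thesis
    unfolding ip_l2_def
    using intervals.integrable_fst'[OF l2_integrable_inner[OF w[unfolded leb_rect] l2_lift(2)[OF finite_leb_interval finite_leb_interval z]]] by simp
qed

text \<open>
  Both sides have the same inner product with every \<open>z\<close>: with an adjoint \<open>G\<close> of \<open>F\<close>, the inner products
  become those of \<open>m\<close> and of the slices of \<open>w\<close> with \<open>G z\<close>, where only an integral in \<open>\<theta>\<close> is left.
  This yields the additivity of \<open>F\<close> together with its exchange with the integral.
\<close>

lemma adjointable_commutes_primitive:
  assumes F: "adjointable (leb {a..b}) (leb {a..b}) F"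
    and \<Phi>: "(\<lambda>(\<theta>, x). F (\<lambda>y. w (\<theta>, y)) x) \<in> l2 (leb (rect a b))"
    and m: "m \<in> l2 (leb {a..b})" and w: "w \<in> l2 (leb (rect a b))" and s: "s \<in> {0..1}"
  shows "AE x in leb {a..b}. F (\<lambda>x. m x + primitive w s x) x = F m x + primitive (\<lambda>(\<theta>, x). F (\<lambda>y. w (\<theta>, y)) x) s x"
proof -
  let ?I = "leb {a..b}" and ?J = "leb {0..1::real}"
  let ?\<Phi> = "\<lambda>(\<theta>, x). F (\<lambda>y. w (\<theta>, y)) x"
  obtain G where G: "adj ?I ?I F G" using F by (auto simp: adjointable_def)
  have Fl: "F f \<in> l2 ?I" if "f \<in> l2 ?I" for f using G that by (simp add: adj_def)
  have Gl: "G f \<in> l2 ?I" if "f \<in> l2 ?I" for f using G that by (simp add: adj_def)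
  have FG: "ip_l2 ?I (F f) z = ip_l2 ?I f (G z)" if "f \<in> l2 ?I" "z \<in> l2 ?I" for f z
    using G that by (simp add: adj_def)
  note pw = primitive_l2[OF w s] and p\<Phi> = primitive_l2[OF \<Phi> s]
  have eq: "ip_l2 ?I (primitive ?\<Phi> s) z = ip_l2 ?I (primitive w s) (G z)" if z: "z \<in> l2 ?I" for z
  proof -
    have "(\<integral>\<theta>. (if \<theta> \<le> s then ip_l2 ?I (\<lambda>x. ?\<Phi> (\<theta>, x)) z else 0) \<partial>?J)
        = (\<integral>\<theta>. (if \<theta> \<le> s then ip_l2 ?I (\<lambda>x. w (\<theta>, x)) (G z) else 0) \<partial>?J)"
    proof (rule integral_cong_AE)
      note [measurable] = ident_leb[of "{0..1}"]
      have [measurable]: "Measurable.pred ?J (\<lambda>\<theta>. \<theta> \<le> s)" by measurable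
      have [measurable]: "(\<lambda>\<theta>. ip_l2 ?I (\<lambda>x. ?\<Phi> (\<theta>, x)) z) \<in> borel_measurable ?J"
        using integrable_slice_ip[OF \<Phi> z] by auto
      have [measurable]: "(\<lambda>\<theta>. ip_l2 ?I (\<lambda>x. w (\<theta>, x)) (G z)) \<in> borel_measurable ?J"
        using integrable_slice_ip[OF w Gl[OF z]] by auto
      show "(\<lambda>\<theta>. if \<theta> \<le> s then ip_l2 ?I (\<lambda>x. ?\<Phi> (\<theta>, x)) z else 0) \<in> borel_measurable ?J" by measurable
      show "(\<lambda>\<theta>. if \<theta> \<le> s then ip_l2 ?I (\<lambda>x. w (\<theta>, x)) (G z) else 0) \<in> borel_measurable ?J" by measurable
      show "AE \<theta> in ?J. (if \<theta> \<le> s then ip_l2 ?I (\<lambda>x. ?\<Phi> (\<theta>, x)) z else 0)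
          = (if \<theta> \<le> s then ip_l2 ?I (\<lambda>x. w (\<theta>, x)) (G z) else 0)"
        using l2_slice[OF finite_leb_interval finite_leb_interval w[unfolded leb_rect]]
        by eventually_elim (simp add: FG z)
    qed
    then show ?thesis using pw(2)[OF Gl[OF z]] p\<Phi>(2)[OF z] by simp
  qed
  define d where "d x = F (\<lambda>x. m x + primitive w s x) x - (F m x + primitive ?\<Phi> s x)" for x
  have mp: "(\<lambda>x. m x + primitive w s x) \<in> l2 ?I" by (rule l2_add[OF m pw(1)])
  have d: "d \<in> l2 ?I" unfolding d_def[abs_def] by (intro l2_diff l2_add Fl mp m p\<Phi>(1))
  have "ip_l2 ?I d d = 0"
  proof -
    have "ip_l2 ?I d d = ip_l2 ?I (l2.sub (F (\<lambda>x. m x + primitive w s x)) (\<lambda>x. F m x + primitive ?\<Phi> s x)) d"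
      by (simp add: l2_sub d_def[abs_def])
    also have "\<dots> = ip_l2 ?I (\<lambda>x. m x + primitive w s x) (G d) - (ip_l2 ?I m (G d) + ip_l2 ?I (primitive w s) (G d))"
      using d by (simp add: l2.ip_sub_left l2.ip_add_left l2_add Fl mp m p\<Phi>(1) FG eq)
    also have "\<dots> = 0" by (simp add: l2.ip_add_left m pw(1) Gl d)
    finally show ?thesis .
  qed
  then have "AE x in ?I. d x = 0" by (intro AE_zero_if_nrm_zero d) (simp add: l2.nrm_def)
  then show ?thesis by (simp add: d_def)
qed

text \<open>
  The integral of \<open>k\<close> over a box is obtained by integrating in \<open>x\<close> a difference of two values of the
  primitive in \<open>s\<close>.
\<close>

lemma AE_zero_if_primitive_zero:
  fixes k :: "real \<times> real \<Rightarrow> 'e::euclidean_space"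
  assumes k: "k \<in> l2 (leb (rect a b))" and 0: "\<And>s. s \<in> {0..1} \<Longrightarrow> AE x in leb {a..b}. primitive k s x = 0"
  shows "AE z in leb (rect a b). k z = 0"
proof -
  let ?I = "leb {a..b}" and ?J = "leb {0..1::real}"
  have kint: "integrable lborel (\<lambda>z. indicator (rect a b) z *\<^sub>R k z)"
    using l2_integrable[OF finite_leb_rect k] by (simp add: integrable_restrict_space)
  have inner0: "AE z in lborel. (indicator (rect a b) z *\<^sub>R k z) \<bullet> e = 0" for e
  proof (rule AE_zero_if_box_integrals_zero)
    show "integrable lborel (\<lambda>z. (indicator (rect a b) z *\<^sub>R k z) \<bullet> e)"
      using kint by (rule integrable_inner_left)
    fix c d :: "real \<times> real"
    define z where "z x = indicator {snd c<..<snd d} x *\<^sub>R e" for x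
    define q where "q \<theta> = (indicator {fst c<..<fst d} \<theta> :: real)" for \<theta>
    have z: "z \<in> l2 ?I"
    proof (rule l2_boundedI[where g="\<lambda>_. (norm e)\<^sup>2"])
      show "z \<in> borel_measurable ?I" unfolding z_def by (intro measurable_leb) measurable
    qed (auto simp: z_def indicator_def)
    have qm: "q \<in> borel_measurable ?J" unfolding q_def by (intro measurable_leb) measurable
    define p where "p \<theta> = ip_l2 ?I (\<lambda>x. k (\<theta>, x)) z" for \<theta>
    have p: "integrable ?J p" unfolding p_def by (rule integrable_slice_ip[OF k z])
    have [measurable]: "p \<in> borel_measurable ?J" using p by auto
    have P0: "(\<integral>\<theta>. (if \<theta> \<le> s then p \<theta> else 0) \<partial>?J) = 0" if s: "s \<in> {0..1}" for s
    proof -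
      have "ip_l2 ?I (primitive k s) z = 0"
        unfolding ip_l2_def using 0[OF s] by (intro integral_eq_zero_AE) (auto elim!: eventually_mono)
      then show ?thesis using primitive_l2(2)[OF k s z] by (simp add: p_def cong: if_cong)
    qed
      have ifi: "integrable ?J (\<lambda>\<theta>. if \<theta> \<le> s then p \<theta> else 0)" for s
    proof (rule Bochner_Integration.integrable_bound[OF p])
      show "(\<lambda>\<theta>. if \<theta> \<le> s then p \<theta> else 0) \<in> borel_measurable ?J" using ident_leb by measurable
    qed auto
    have "(\<integral>\<theta>. q \<theta> * p \<theta> \<partial>?J) = 0"
    proof (cases "fst c < fst d")
      case True
      \<comment> \<open>On \<open>[0, 1]\<close> the indicator of an interval is, up to null sets, a difference of two
        cut-offs at points of \<open>[0, 1]\<close>.\<close>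
      define s1 where "s1 = max 0 (min 1 (fst c))"
      define s2 where "s2 = max 0 (min 1 (fst d))"
      have "(\<integral>\<theta>. q \<theta> * p \<theta> \<partial>?J) = (\<integral>\<theta>. (if \<theta> \<le> s2 then p \<theta> else 0) - (if \<theta> \<le> s1 then p \<theta> else 0) \<partial>?J)"
      proof (rule integral_cong_AE)
        show "(\<lambda>\<theta>. q \<theta> * p \<theta>) \<in> borel_measurable ?J" using qm by measurable
        show "(\<lambda>\<theta>. (if \<theta> \<le> s2 then p \<theta> else 0) - (if \<theta> \<le> s1 then p \<theta> else 0)) \<in> borel_measurable ?J"
          using ifi by (intro borel_measurable_diff) auto
        have "AE \<theta> in ?J. \<theta> \<noteq> 0" "AE \<theta> in ?J. \<theta> \<noteq> fst c" "AE \<theta> in ?J. \<theta> \<noteq> fst d"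
          by (rule AE_leb_neq; simp)+
        moreover have "AE \<theta> in ?J. \<theta> \<in> {0..1}" by (rule AE_leb_mem)
        ultimately show "AE \<theta> in ?J. q \<theta> * p \<theta> = (if \<theta> \<le> s2 then p \<theta> else 0) - (if \<theta> \<le> s1 then p \<theta> else 0)"
        proof eventually_elim
          case (elim \<theta>)
          have "\<theta> \<le> s2 \<longleftrightarrow> \<theta> < fst d" "\<theta> \<le> s1 \<longleftrightarrow> \<theta> < fst c"
            unfolding s1_def s2_def le_max_iff_disj min.bounded_iff using elim by auto
          moreover have "q \<theta> = (if fst c < \<theta> \<and> \<theta> < fst d then 1 else 0)"
            by (simp add: q_def indicator_def)
          moreover have "fst c < \<theta> \<longleftrightarrow> \<not> \<theta> < fst c" using elim by linarith
          ultimately show ?case using True by simp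
        qed
      qed
      also have "\<dots> = 0"
        using P0[of s1] P0[of s2] ifi by (simp add: s1_def s2_def)
      finally show ?thesis .
    qed (auto simp: q_def)
    moreover have "(\<integral>\<theta>. q \<theta> * p \<theta> \<partial>?J) = (\<integral>y. indicator (box c d) y * ((indicator (rect a b) y *\<^sub>R k y) \<bullet> e) \<partial>lborel)"
    proof -
      have 1: "integrable (?J \<Otimes>\<^sub>M ?I) (\<lambda>y. q (fst y) * (k y \<bullet> z (snd y)))"
      proof (rule Bochner_Integration.integrable_bound[OF l2_integrable_inner[OF k[unfolded leb_rect] l2_lift(2)[OF finite_leb_interval finite_leb_interval z]]])
        show "(\<lambda>y. q (fst y) * (k y \<bullet> z (snd y))) \<in> borel_measurable (?J \<Otimes>\<^sub>M ?I)"
          using qm l2_measurable[OF k[unfolded leb_rect]] l2_measurable[OF z] by measurable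
      qed (auto simp: q_def indicator_def)
      have "(\<integral>\<theta>. q \<theta> * p \<theta> \<partial>?J) = (\<integral>y. q (fst y) * (k y \<bullet> z (snd y)) \<partial>(?J \<Otimes>\<^sub>M ?I))"
        using intervals.integral_fst'[OF 1] by (simp add: p_def ip_l2_def)
      also have "\<dots> = (\<integral>y. indicator (rect a b) y *\<^sub>R (q (fst y) * (k y \<bullet> z (snd y))) \<partial>lborel)"
        unfolding leb_rect[symmetric] by (subst integral_restrict_space) auto
      also have "\<dots> = (\<integral>y. indicator (box c d) y * ((indicator (rect a b) y *\<^sub>R k y) \<bullet> e) \<partial>lborel)"
        by (intro Bochner_Integration.integral_cong refl)
          (auto simp: q_def z_def indicator_def mem_box Basis_prod_def inner_prod_def split: prod.splits)
      finally show ?thesis .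
    qed
    ultimately show "(\<integral>y. indicator (box c d) y * ((indicator (rect a b) y *\<^sub>R k y) \<bullet> e) \<partial>lborel) = 0" by simp
  qed
  have "AE z in lborel. \<forall>e\<in>Basis. (indicator (rect a b) z *\<^sub>R k z) \<bullet> e = 0"
    by (intro AE_finite_allI inner0) simp
  then have "AE z in lborel. z \<in> rect a b \<longrightarrow> k z = 0"
    by eventually_elim (auto simp: euclidean_eq_iff[of "k _"])
  then show ?thesis by (simp add: AE_restrict_space_iff)
qed


section \<open>Solutions of the delayed PDE in terms of the PIE operators\<close>

lemma primitive_diff:
  assumes w: "w \<in> l2 (leb (rect a b))" and v: "v \<in> l2 (leb (rect a b))" and s: "s \<in> {0..1}"
  shows "AE x in leb {a..b}. primitive (\<lambda>z. w z - v z) s x = primitive w s x - primitive v s x"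
proof -
  let ?I = "leb {a..b}" and ?J = "leb {0..1::real}"
  have slice: "AE x in ?I. set_integrable lborel {0..s} (\<lambda>\<theta>. f (\<theta>, x))"
    if f: "f \<in> l2 (leb (rect a b))" for f :: "real \<times> real \<Rightarrow> 'e::euclidean_space"
  proof -
    have "integrable (?J \<Otimes>\<^sub>M ?I) f"
      using l2_integrable[OF finite_leb_rect f] by (simp add: leb_rect)
    from intervals.AE_integrable_fst'[OF intervals.integrable_product_swap[OF this]]
    show ?thesis
    proof eventually_elim
      case (elim x)
      then have "set_integrable lborel {0..1} (\<lambda>\<theta>. f (\<theta>, x))" by (simp add: set_integrable_leb)
      then show ?case by (rule set_integrable_subset) (use s in auto)
    qed
  qed
  show ?thesis
    using slice[OF w] slice[OF v] by eventually_elim (simp add: primitive_def set_integral_diff)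
qed

lemma l2_slice_continuous:
  assumes "continuous_on (rect a b) \<phi>" "s \<in> {0..1}"
  shows "continuous_on {a..b} (\<lambda>x. \<phi> (s, x))"
  by (rule continuous_on_compose2[OF assms(1)]) (use assms(2) in \<open>auto intro!: continuous_intros\<close>)

text \<open>
  The case \<open>j = 0\<close> of \<open>slice_weak_deriv\<close>, freed from the test function by the fundamental lemma.
\<close>

lemma time_weak_deriv_slice:
  fixes \<phi> g :: "real \<times> real \<Rightarrow> 'e::euclidean_space"
  assumes \<phi>: "continuous_on (rect a b) \<phi>" and g: "g \<in> l2 (leb (rect a b))"
    and weak: "is_weak_deriv (rect a b) [(1, 0)] \<phi> g" and s: "s \<in> {0..1}"
  shows "AE x in leb {a..b}. \<phi> (s, x) = \<phi> (0, x) + primitive g s x"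
proof -
  let ?I = "leb {a..b}"
  have c: "integrable ?I (\<lambda>x. \<phi> (t, x))" if "t \<in> {0..1}" for t
    by (intro l2_integrable[OF finite_leb_interval] l2_continuous compact_Icc l2_slice_continuous[OF \<phi> that])
  have p: "integrable ?I (primitive g s)" by (rule l2_integrable[OF finite_leb_interval primitive_l2(1)[OF g s]])
  have "AE x in ?I. \<phi> (s, x) - \<phi> (0, x) - primitive g s x = 0"
    unfolding interval_cbox
  proof (rule fundamental_lemma)
    show "integrable (leb (cbox a b)) (\<lambda>x. \<phi> (s, x) - \<phi> (0, x) - primitive g s x)"
      unfolding interval_cbox[symmetric] using c[OF s] c[of 0] p by simp
    fix \<eta> :: "real \<Rightarrow> real" assume \<eta>: "test_function (box a b) \<eta>"
    then have \<eta>': "test_function (interior {a..b}) \<eta>"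
      unfolding interval_cbox interior_cbox .
    have weak0: "is_weak_deriv (rect a b) ((1, 0) # replicate 0 (0, 1)) \<phi> g" using weak by simp
    have eq: "(\<integral>x. \<eta> x *\<^sub>R \<phi> (s, x) \<partial>?I) = (\<integral>x. \<eta> x *\<^sub>R \<phi> (0, x) \<partial>?I) + (\<integral>x. \<eta> x *\<^sub>R primitive g s x \<partial>?I)"
      using slice_weak_deriv[OF \<phi> l2_integrable[OF finite_leb_rect g] weak0 s \<eta>', folded primitive_def] by simp
    have bd: "bounded {a..b}" by simp
    have 0: "(0::real) \<in> {0..1}" by simp
    have "(\<integral>x. \<eta> x *\<^sub>R (\<phi> (s, x) - \<phi> (0, x) - primitive g s x) \<partial>?I)
        = (\<integral>x. \<eta> x *\<^sub>R \<phi> (s, x) \<partial>?I) - (\<integral>x. \<eta> x *\<^sub>R \<phi> (0, x) \<partial>?I) - (\<integral>x. \<eta> x *\<^sub>R primitive g s x \<partial>?I)"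
      unfolding scaleR_diff_right
      using integrable_test_function[OF \<eta>' bd c[OF s]] integrable_test_function[OF \<eta>' bd c[OF 0]]
        integrable_test_function[OF \<eta>' bd p] by simp
    then show "(\<integral>x. \<eta> x *\<^sub>R (\<phi> (s, x) - \<phi> (0, x) - primitive g s x) \<partial>leb (cbox a b)) = 0"
      unfolding interval_cbox[symmetric] using eq by simp
  qed
  then show ?thesis by eventually_elim (simp add: algebra_simps)
qed

text \<open>
  The case \<open>j = 2\<close> of \<open>slice_weak_deriv\<close>.
\<close>

lemma second_weak_deriv_slice:
  fixes \<phi> g :: "real \<times> real \<Rightarrow> 'e::euclidean_space"
  assumes \<phi>: "continuous_on (rect a b) \<phi>" and g: "g \<in> l2 (leb (rect a b))"
    and weak: "is_weak_deriv (rect a b) [(1, 0), (0, 1), (0, 1)] \<phi> g" and s: "s \<in> {0..1}"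
    and m: "m \<in> l2 (leb {a..b})" and um: "is_weak_deriv {a..b} [1, 1] u m"
    and u: "\<And>x. x \<in> {a..b} \<Longrightarrow> \<phi> (0, x) = u x"
  shows "is_weak_deriv {a..b} [1, 1] (\<lambda>x. \<phi> (s, x)) (\<lambda>x. m x + primitive g s x)"
  unfolding is_weak_deriv_def
proof (intro allI impI)
  fix \<eta> :: "real \<Rightarrow> real" assume \<eta>: "test_function (interior {a..b}) \<eta>"
  let ?I = "leb {a..b}" and ?D = "foldr partial_deriv [1, 1] \<eta>"
  have two: "replicate 2 x = [x, x]" for x :: 'x by (simp add: numeral_2_eq_2)
  have "(\<integral>x. ?D x *\<^sub>R \<phi> (s, x) \<partial>?I) = (\<integral>x. ?D x *\<^sub>R \<phi> (0, x) \<partial>?I) + (\<integral>x. \<eta> x *\<^sub>R primitive g s x \<partial>?I)"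
    using slice_weak_deriv[OF \<phi> l2_integrable[OF finite_leb_rect g] _ s \<eta>, of 2, folded primitive_def] weak
    unfolding two by simp
  also have "(\<integral>x. ?D x *\<^sub>R \<phi> (0, x) \<partial>?I) = (\<integral>x. ?D x *\<^sub>R u x \<partial>?I)"
    by (intro Bochner_Integration.integral_cong) (auto simp: u)
  also have "\<dots> = (\<integral>x. \<eta> x *\<^sub>R m x \<partial>?I)"
    using um[unfolded is_weak_deriv_def, rule_format, OF \<eta>] by (simp add: set_integral_leb)
  also have "(\<integral>x. \<eta> x *\<^sub>R m x \<partial>?I) + (\<integral>x. \<eta> x *\<^sub>R primitive g s x \<partial>?I) = (\<integral>x. \<eta> x *\<^sub>R (m x + primitive g s x) \<partial>?I)"
    unfolding scaleR_add_right
    by (intro Bochner_Integration.integral_add[symmetric] integrable_test_function[OF \<eta>] bounded_closed_interval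
        l2_integrable[OF finite_leb_interval] m primitive_l2(1)[OF g s])
  finally show "(LINT x:{a..b}|lborel. ?D x *\<^sub>R \<phi> (s, x))
      = (- 1) ^ length [1::real, 1] *\<^sub>R (LINT x:{a..b}|lborel. \<eta> x *\<^sub>R (m x + primitive g s x))"
    by (simp add: set_integral_leb)
qed

lemma adjointable_l2: "adjointable M N F \<Longrightarrow> f \<in> l2 M \<Longrightarrow> F f \<in> l2 N"
  by (auto simp: adjointable_def adj_def)

lemma Z_eq_leb: "Z_eq a b w z \<longleftrightarrow> (AE x in leb {a..b}. fst w x = fst z x) \<and> (AE y in leb (rect a b). snd w y = snd z y)"
  by (simp add: Z_eq_def AE_leb)

text \<open>
  Take \<open>w = (m, g)\<close> with \<open>m = u\<^sub>x\<^sub>x\<close> and \<open>g = \<partial>\<^sub>s \<partial>\<^sub>x\<^sup>2 \<phi>\<close>.  The second derivative of \<open>\<phi>(s, \<cdot>)\<close> is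
  \<open>m + \<integral>\<^sub>0\<^sup>s g\<close>, so \<open>X_space_representation\<close> gives
  \<open>\<phi>(s, \<cdot>) = \<T>\<^sub>1 (m + \<integral>\<^sub>0\<^sup>s g) = \<T>\<^sub>1 m + \<integral>\<^sub>0\<^sup>s \<T>\<^sub>1 g\<close>, which is the second component of \<open>\<T> w\<close>.  Hence
  \<open>\<partial>\<^sub>s \<phi> = \<T>\<^sub>1 g\<close>, and at \<open>s = 1\<close> the delayed term becomes
  \<open>\<A>\<^sub>1\<^sub>1\<^sub>,\<^sub>d (m + \<integral>\<^sub>0\<^sup>1 g) = \<A>\<^sub>1\<^sub>1\<^sub>,\<^sub>d m + \<A>\<^sub>1\<^sub>2 g\<close>.
\<close>

lemma state_representation:
  fixes B :: "real ^ ('n + 'n + 'n + 'n) ^ ('n::finite + 'n)"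
  assumes ab: "a < b" and inv: "invertible (B ** H_mat a b)"
    and A: "A \<in> Linf_space {a..b}" and Ad: "Ad \<in> Linf_space {a..b}"
    and u: "u \<in> X_space a b B" and \<phi>: "\<phi> \<in> Y_space a b B u"
  shows "\<exists>w\<in>Z_space a b. Z_eq a b (u, \<phi>) (opT a b B w) \<and>
    Z_eq a b (\<lambda>x. A x *v jet a b u x + Ad x *v jet a b (\<lambda>y. \<phi> (1, y)) x,
      \<lambda>z. - (1 / \<tau>) *\<^sub>R weak_deriv (rect a b) [(1, 0)] \<phi> z) (opA a b A Ad B \<tau> w)"
proof -
  let ?I = "leb {a..b}" and ?J = "leb {0..1::real}" and ?R = "leb (rect a b)"
  have uH: "u \<in> H2_space a b" and \<phi>H: "\<phi> \<in> H12_space a b" and \<phi>0: "\<And>x. x \<in> {a..b} \<Longrightarrow> \<phi> (0, x) = u x"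
    and \<phi>X: "\<And>s. s \<in> {0..1} \<Longrightarrow> (\<lambda>x. \<phi> (s, x)) \<in> X_space a b B"
    using u \<phi> by (auto simp: X_space_def Y_space_def)
  have \<phi>c: "continuous_on (rect a b) \<phi>" using \<phi>H by (simp add: H12_space_def)
  have two: "replicate 2 x = [x, x]" for x :: 'x by (simp add: numeral_2_eq_2)
  have "\<exists>m\<in>L2_space {a..b}. is_weak_deriv {a..b} (replicate 2 1) u m"
    using uH unfolding H2_space_def by blast
  then obtain m where m: "m \<in> l2 ?I" and um: "is_weak_deriv {a..b} [1, 1] u m"
    unfolding two by (auto simp: L2_space_leb)
  have "\<exists>g\<in>L2_space (rect a b). is_weak_deriv (rect a b) (replicate 1 (1, 0) @ replicate 2 (0, 1)) \<phi> g"
    using \<phi>H unfolding H12_space_def by blast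
  then obtain g where g: "g \<in> l2 ?R" and \<phi>g: "is_weak_deriv (rect a b) [(1, 0), (0, 1), (0, 1)] \<phi> g"
    unfolding two by (auto simp: L2_space_leb)
  have "\<exists>g\<in>L2_space (rect a b). is_weak_deriv (rect a b) (replicate 1 (1, 0) @ replicate 0 (0, 1)) \<phi> g"
    using \<phi>H unfolding H12_space_def by blast
  then obtain g' where "g' \<in> l2 ?R" "is_weak_deriv (rect a b) [(1, 0)] \<phi> g'"
    by (auto simp: L2_space_leb)
  note \<phi>s = weak_deriv_l2(1,2)[of g' "(0, a)" "(1, b)", folded rect_cbox, OF this]
  define h where "h = (\<lambda>(\<theta>, x). opT1 a b B (\<lambda>y. g (\<theta>, y)) x)"
  have h: "h \<in> l2 ?R"
    unfolding h_def opT1_pi by (rule adjointable_l2[OF adjointable_fibered_pi3_op[OF T1_pi_ess_bounded] g])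
  have T1: "adjointable ?I ?I (opT1 a b B)"
    unfolding opT1_pi by (rule adjointable_pi3_op[OF T1_pi_ess_bounded])
  have deriv_s: "is_weak_deriv {a..b} [1, 1] (\<lambda>x. \<phi> (s, x)) (\<lambda>x. m x + primitive g s x)" if "s \<in> {0..1}" for s
    by (rule second_weak_deriv_slice[OF \<phi>c g \<phi>g that m um \<phi>0])
  have ms: "(\<lambda>x. m x + primitive g s x) \<in> l2 ?I" if "s \<in> {0..1}" for s
    by (rule l2_add[OF m primitive_l2(1)[OF g that]])
  have u_eq: "u x = opT1 a b B m x" if "x \<in> {a..b}" for x
    using X_space_representation[OF u ab inv m um] that by blast
  have \<phi>_eq: "AE x in ?I. \<phi> (s, x) = opT1 a b B m x + primitive h s x" if s: "s \<in> {0..1}" for s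
  proof -
    have "AE x in ?I. opT1 a b B (\<lambda>x. m x + primitive g s x) x = opT1 a b B m x + primitive h s x"
      unfolding h_def by (rule adjointable_commutes_primitive[OF T1 h[unfolded h_def] m g s])
    moreover have "AE x in ?I. x \<in> {a..b}" by (rule AE_leb_mem)
    ultimately show ?thesis
    proof eventually_elim
      case (elim x)
      have "\<phi> (s, x) = opT1 a b B (\<lambda>x. m x + primitive g s x) x"
        using X_space_representation[OF \<phi>X[OF s] ab inv ms[OF s] deriv_s[OF s]] elim(2) by blast
      then show ?case using elim(1) by simp
    qed
  qed
  let ?w = "(m, g)"
  have w: "?w \<in> Z_space a b" using m g by (simp add: Z_space_l2)
  have prim_h: "primitive h s x = opT2 a b B g (s, x)" for s x
    by (simp add: primitive_def h_def opT2_def)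
  have Z1: "Z_eq a b (u, \<phi>) (opT a b B ?w)"
    unfolding Z_eq_leb
  proof
    have "AE x in ?I. x \<in> {a..b}" by (rule AE_leb_mem)
    then show "AE x in ?I. fst (u, \<phi>) x = fst (opT a b B ?w) x"
      by eventually_elim (simp add: opT_def u_eq)
    have "opT a b B ?w \<in> Z_space a b"
      using ex_adjoint_opT[of a b B] w by (auto simp: is_adjoint_def)
    then have T: "snd (opT a b B ?w) \<in> borel_measurable (?J \<Otimes>\<^sub>M ?I)"
      by (auto simp: Z_space_l2 leb_rect mem_Times_iff intro: l2_measurable)
    have P: "\<phi> \<in> borel_measurable (?J \<Otimes>\<^sub>M ?I)"
      using l2_measurable[OF l2_continuous[OF compact_rect \<phi>c]] by (simp add: leb_rect)
    show "AE y in ?R. snd (u, \<phi>) y = snd (opT a b B ?w) y"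
      unfolding leb_rect
    proof (rule intervals.AE_pair_measure)
      show "{y \<in> space (?J \<Otimes>\<^sub>M ?I). snd (u, \<phi>) y = snd (opT a b B ?w) y} \<in> sets (?J \<Otimes>\<^sub>M ?I)"
      proof -
        have "(\<lambda>y. \<phi> y - snd (opT a b B ?w) y) -` {0} \<inter> space (?J \<Otimes>\<^sub>M ?I) \<in> sets (?J \<Otimes>\<^sub>M ?I)"
          by (rule measurable_sets[OF borel_measurable_diff[OF P T]]) simp
        moreover have "(\<lambda>y. \<phi> y - snd (opT a b B ?w) y) -` {0} \<inter> space (?J \<Otimes>\<^sub>M ?I)
            = {y \<in> space (?J \<Otimes>\<^sub>M ?I). snd (u, \<phi>) y = snd (opT a b B ?w) y}" by auto
        ultimately show ?thesis by simp
      qed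
      show "AE s in ?J. AE x in ?I. snd (u, \<phi>) (s, x) = snd (opT a b B ?w) (s, x)"
      proof (rule AE_I2)
        fix s assume "s \<in> space ?J"
        then have "s \<in> {0..1}" by simp
        from \<phi>_eq[OF this] show "AE x in ?I. snd (u, \<phi>) (s, x) = snd (opT a b B ?w) (s, x)"
          by eventually_elim (simp add: opT_def prim_h)
      qed
    qed
  qed
  have \<phi>_s: "AE z in ?R. weak_deriv (rect a b) [(1, 0)] \<phi> z - h z = 0"
  proof (rule AE_zero_if_primitive_zero)
    show "(\<lambda>z. weak_deriv (rect a b) [(1, 0)] \<phi> z - h z) \<in> l2 ?R" by (rule l2_diff[OF \<phi>s(1) h])
    fix s :: real assume s: "s \<in> {0..1}"
    have "AE x in ?I. x \<in> {a..b}" by (rule AE_leb_mem)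
    then show "AE x in ?I. primitive (\<lambda>z. weak_deriv (rect a b) [(1, 0)] \<phi> z - h z) s x = 0"
      using primitive_diff[OF \<phi>s(1) h s] \<phi>_eq[OF s] time_weak_deriv_slice[OF \<phi>c \<phi>s s]
      by eventually_elim (simp add: \<phi>0 u_eq)
  qed
  have A11: "adjointable ?I ?I (opA11 a b B Ad)"
    unfolding opA11_pi by (intro adjointable_pi3_op A11_pi_ess_bounded Ad)
  have Ag: "(\<lambda>(\<theta>, x). opA11 a b B Ad (\<lambda>y. g (\<theta>, y)) x) \<in> l2 ?R"
    unfolding opA11_pi by (rule adjointable_l2[OF adjointable_fibered_pi3_op[OF A11_pi_ess_bounded[OF Ad]] g])
  have 1: "1 \<in> {0..1::real}" by simp
  have Z2: "Z_eq a b (\<lambda>x. A x *v jet a b u x + Ad x *v jet a b (\<lambda>y. \<phi> (1, y)) x,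
      \<lambda>z. - (1 / \<tau>) *\<^sub>R weak_deriv (rect a b) [(1, 0)] \<phi> z) (opA a b A Ad B \<tau> ?w)"
    unfolding Z_eq_leb
  proof
    show "AE x in ?I. fst (\<lambda>x. A x *v jet a b u x + Ad x *v jet a b (\<lambda>y. \<phi> (1, y)) x,
      \<lambda>z. - (1 / \<tau>) *\<^sub>R weak_deriv (rect a b) [(1, 0)] \<phi> z) x = fst (opA a b A Ad B \<tau> ?w) x"
      using opA11_eq_jet[OF u ab inv m um, of A] opA11_eq_jet[OF \<phi>X[OF 1] ab inv ms[OF 1] deriv_s[OF 1], of Ad]
        adjointable_commutes_primitive[OF A11 Ag m g 1]
      by eventually_elim (simp add: opA_def opA12_def primitive_def)
    show "AE z in ?R. snd (\<lambda>x. A x *v jet a b u x + Ad x *v jet a b (\<lambda>y. \<phi> (1, y)) x,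
      \<lambda>z. - (1 / \<tau>) *\<^sub>R weak_deriv (rect a b) [(1, 0)] \<phi> z) z = snd (opA a b A Ad B \<tau> ?w) z"
      using \<phi>_s by eventually_elim (auto simp: opA_def opA22_def h_def split: prod.splits)
  qed
  show ?thesis using w Z1 Z2 by blast
qed


section \<open>The space Z\<close>

interpretation Z: semi_inner_space "Z_space a b" Z_add Z_scale "Z_inner a b" for a b
proof unfold_locales
  fix x y z :: "'a::finite Z" and c :: real
  assume x: "x \<in> Z_space a b" and y: "y \<in> Z_space a b"
  show "Z_add x y \<in> Z_space a b" "Z_scale c x \<in> Z_space a b"
    using x y by (auto simp: Z_space_l2 Z_add_def Z_scale_def l2_add l2_scaleR)
  show "Z_inner a b x y = Z_inner a b y x"
    using x y by (simp add: Z_inner_l2 Z_space_l2 mem_Times_iff l2.ip_commute)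
  show "Z_inner a b (Z_scale c x) y = c * Z_inner a b x y"
    using x y by (simp add: Z_inner_l2 Z_space_l2 mem_Times_iff Z_scale_def l2.ip_scale_left algebra_simps)
  show "0 \<le> Z_inner a b x x"
    using x by (simp add: Z_inner_l2 Z_space_l2 mem_Times_iff l2.ip_nonneg)
  assume z: "z \<in> Z_space a b"
  show "Z_inner a b (Z_add x y) z = Z_inner a b x z + Z_inner a b y z"
    using x y z by (simp add: Z_inner_l2 Z_space_l2 mem_Times_iff Z_add_def l2.ip_add_left)
qed

lemma Z_sub: "Z.sub w z = (\<lambda>x. fst w x - fst z x, \<lambda>y. snd w y - snd z y)"
  by (simp add: Z.sub_def Z_add_def Z_scale_def)

lemma Z_nrm_power2:
  assumes "w \<in> Z_space a b"
  shows "(Z.nrm a b w)\<^sup>2 = (l2.nrm (leb {a..b}) (fst w))\<^sup>2 + (l2.nrm (leb (rect a b)) (snd w))\<^sup>2"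
  using assms by (simp add: Z.nrm_power2 l2.nrm_power2 Z_inner_l2 Z_space_l2 mem_Times_iff)

lemma Z_nrm_le:
  assumes w: "w \<in> Z_space a b"
  shows "Z.nrm a b w \<le> l2.nrm (leb {a..b}) (fst w) + l2.nrm (leb (rect a b)) (snd w)"
proof (rule power2_le_imp_le)
  have nn: "0 \<le> l2.nrm (leb {a..b}) (fst w)" "0 \<le> l2.nrm (leb (rect a b)) (snd w)"
    using w by (auto simp: Z_space_l2 mem_Times_iff intro: l2.nrm_nonneg)
  then show "(Z.nrm a b w)\<^sup>2 \<le> (l2.nrm (leb {a..b}) (fst w) + l2.nrm (leb (rect a b)) (snd w))\<^sup>2"
    by (simp add: Z_nrm_power2[OF w] power2_sum)
  show "0 \<le> l2.nrm (leb {a..b}) (fst w) + l2.nrm (leb (rect a b)) (snd w)" using nn by simp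
qed

lemma Z_norm_eq:
  assumes w: "w \<in> Z_space a b"
  shows "Z_norm a b w = Z.nrm a b w"
proof -
  let ?I = "leb {a..b}" and ?J = "leb {0..1::real}"
  have l: "snd w \<in> l2 (?J \<Otimes>\<^sub>M ?I)" using w by (simp add: Z_space_l2 mem_Times_iff leb_rect)
  have "(LINT s:{0..1}|lborel. (L2_norm {a..b} (\<lambda>x. snd w (s, x)))\<^sup>2) = (l2.nrm (leb (rect a b)) (snd w))\<^sup>2"
    using intervals.integral_fst'[OF l2_integrable_power2[OF l]]
    by (simp add: set_integral_leb L2_norm_leb l2_nrm_power2 leb_rect)
  then show ?thesis
    by (simp add: Z_norm_def L2_norm_leb Z_nrm_power2[OF w, symmetric] Z.nrm_nonneg[OF w])
qed

lemma ip_l2_cong_AE: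
  assumes "f \<in> l2 M" "g \<in> l2 M" "h \<in> l2 M" "AE x in M. f x = g x"
  shows "ip_l2 M f h = ip_l2 M g h"
  unfolding ip_l2_def using assms
  by (intro integral_cong_AE borel_measurable_inner l2_measurable) (auto elim!: eventually_mono)

lemma l2_nrm_cong_AE:
  assumes "f \<in> l2 M" "g \<in> l2 M" "AE x in M. f x = g x"
  shows "l2.nrm M f = l2.nrm M g"
proof -
  have "(\<integral>x. (norm (f x))\<^sup>2 \<partial>M) = (\<integral>x. (norm (g x))\<^sup>2 \<partial>M)"
    using assms l2_measurable[OF l2_norm[OF assms(1)]] l2_measurable[OF l2_norm[OF assms(2)]]
    by (intro integral_cong_AE borel_measurable_power) (auto elim!: eventually_mono)
  then show ?thesis by (simp add: nrm_l2)
qed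

lemma Z_inner_cong:
  assumes "w \<in> Z_space a b" "w' \<in> Z_space a b" "z \<in> Z_space a b" "Z_eq a b w w'"
  shows "Z_inner a b w z = Z_inner a b w' z"
  using assms ip_l2_cong_AE[of "fst w" _ "fst w'" "fst z"] ip_l2_cong_AE[of "snd w" _ "snd w'" "snd z"]
  by (simp add: Z_inner_l2 Z_space_l2 mem_Times_iff Z_eq_leb)

lemma Z_complete:
  fixes S :: "nat \<Rightarrow> 'n::finite Z"
  assumes S: "\<And>n. S n \<in> Z_space a b" and step: "\<And>n. Z.nrm a b (Z.sub (S (Suc n)) (S n)) \<le> (1/3) ^ n"
  shows "\<exists>y\<in>Z_space a b. (\<lambda>n. Z.nrm a b (Z.sub y (S n))) \<longlonglongrightarrow> 0"
proof -
  let ?I = "leb {a..b}" and ?R = "leb (rect a b)"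
  have S1: "fst (S n) \<in> l2 ?I" and S2: "snd (S n) \<in> l2 ?R" for n
    using S[of n] by (auto simp: Z_space_l2 mem_Times_iff)
  have le: "l2.nrm ?I (fst w) \<le> Z.nrm a b w" "l2.nrm ?R (snd w) \<le> Z.nrm a b w" if "w \<in> Z_space a b" for w :: "'n Z"
  proof -
    have sq: "(l2.nrm ?I (fst w))\<^sup>2 \<le> (Z.nrm a b w)\<^sup>2" "(l2.nrm ?R (snd w))\<^sup>2 \<le> (Z.nrm a b w)\<^sup>2"
      unfolding Z_nrm_power2[OF that] by simp_all
    show "l2.nrm ?I (fst w) \<le> Z.nrm a b w" "l2.nrm ?R (snd w) \<le> Z.nrm a b w"
      by (rule power2_le_imp_le[OF sq(1) Z.nrm_nonneg[OF that]], rule power2_le_imp_le[OF sq(2) Z.nrm_nonneg[OF that]])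
  qed
  have sub1: "l2.nrm ?I (l2.sub (fst (S (Suc n))) (fst (S n))) \<le> (1/3) ^ n"
    and sub2: "l2.nrm ?R (l2.sub (snd (S (Suc n))) (snd (S n))) \<le> (1/3) ^ n" for n
    using order_trans[OF le(1)[OF Z.sub_in[OF S[of "Suc n"] S[of n]]] step[of n]]
      order_trans[OF le(2)[OF Z.sub_in[OF S[of "Suc n"] S[of n]]] step[of n]]
    by (simp_all add: Z_sub l2_sub)
  obtain y1 where y1: "y1 \<in> l2 ?I" "(\<lambda>n. l2.nrm ?I (l2.sub y1 (fst (S n)))) \<longlonglongrightarrow> 0"
    using l2_complete[of "\<lambda>n. fst (S n)", OF S1 sub1] by blast
  obtain y2 where y2: "y2 \<in> l2 ?R" "(\<lambda>n. l2.nrm ?R (l2.sub y2 (snd (S n)))) \<longlonglongrightarrow> 0"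
    using l2_complete[of "\<lambda>n. snd (S n)", OF S2 sub2] by blast
  have y: "(y1, y2) \<in> Z_space a b" using y1 y2 by (simp add: Z_space_l2)
  have "(\<lambda>n. Z.nrm a b (Z.sub (y1, y2) (S n))) \<longlonglongrightarrow> 0"
  proof (rule tendsto_sandwich)
    show "\<forall>\<^sub>F n in sequentially. 0 \<le> Z.nrm a b (Z.sub (y1, y2) (S n))"
      using Z.nrm_nonneg[OF Z.sub_in[OF y S]] by simp
    show "\<forall>\<^sub>F n in sequentially. Z.nrm a b (Z.sub (y1, y2) (S n))
        \<le> l2.nrm ?I (l2.sub y1 (fst (S n))) + l2.nrm ?R (l2.sub y2 (snd (S n)))"
      using Z_nrm_le[OF Z.sub_in[OF y S]] by (simp add: Z_sub l2_sub)
    show "(\<lambda>n. l2.nrm ?I (l2.sub y1 (fst (S n))) + l2.nrm ?R (l2.sub y2 (snd (S n)))) \<longlonglongrightarrow> 0"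
      using tendsto_add[OF y1(2) y2(2)] by simp
  qed simp
  then show ?thesis using y by blast
qed

lemma selfadjoint_bounded:
  fixes P :: "'n::finite Z \<Rightarrow> 'n Z"
  assumes "is_adjoint a b P P"
  obtains C where "0 \<le> C" "\<And>w. w \<in> Z_space a b \<Longrightarrow> Z.nrm a b (P w) \<le> C * Z.nrm a b w"
proof -
  have P_in: "P w \<in> Z_space a b" if "w \<in> Z_space a b" for w
    using assms that unfolding is_adjoint_def by blast
  have sym: "Z_inner a b (P w) z = Z_inner a b w (P z)" if "w \<in> Z_space a b" "z \<in> Z_space a b" for w z
    using assms that unfolding is_adjoint_def by blast
  obtain C where C: "\<forall>w\<in>Z_space a b. Z.nrm a b (P w) \<le> C * Z.nrm a b w"
    using Z.Hellinger_Toeplitz[of a b P, OF Z_complete P_in sym] by blast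
  have "Z.nrm a b (P w) \<le> max C 0 * Z.nrm a b w" if "w \<in> Z_space a b" for w
    using C that mult_right_mono[of C "max C 0" "Z.nrm a b w"] Z.nrm_nonneg[OF that] by fastforce
  then show ?thesis using that[of "max C 0"] by simp
qed

text \<open>
  A supremum of reals is an upper bound only if the set is bounded, here by \<open>selfadjoint_bounded\<close>.
\<close>

lemma Z_opnorm_bound:
  fixes P :: "'n::finite Z \<Rightarrow> 'n Z"
  assumes P: "is_adjoint a b P P" and w: "w \<in> Z_space a b"
  shows "Z_inner a b w (P w) \<le> Z_opnorm a b P * (Z_norm a b w)\<^sup>2"
proof -
  obtain C where C: "0 \<le> C" "\<And>w. w \<in> Z_space a b \<Longrightarrow> Z.nrm a b (P w) \<le> C * Z.nrm a b w"
    using selfadjoint_bounded[OF P] by blast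
  have Pw: "P v \<in> Z_space a b" if "v \<in> Z_space a b" for v using P that by (auto simp: is_adjoint_def)
  have "bdd_above ((\<lambda>w. Z_norm a b (P w) / Z_norm a b w) ` Z_space a b)"
  proof (rule bdd_aboveI2)
    fix v :: "'n Z" assume v: "v \<in> Z_space a b"
    show "Z_norm a b (P v) / Z_norm a b v \<le> C"
      using C(1) C(2)[OF v] Z.nrm_nonneg[OF v]
      by (cases "Z.nrm a b v = 0") (auto simp: Z_norm_eq v Pw divide_simps)
  qed
  then have le: "Z_norm a b (P w) / Z_norm a b w \<le> Z_opnorm a b P"
    unfolding Z_opnorm_def by (rule cSUP_upper[OF w])
  have "Z_inner a b w (P w) \<le> Z_norm a b w * Z_norm a b (P w)"
    using Z.Cauchy_Schwarz[OF w Pw[OF w]] by (simp add: Z_norm_eq w Pw)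
  also have "\<dots> \<le> Z_norm a b w * (Z_opnorm a b P * Z_norm a b w)"
  proof (cases "Z_norm a b w = 0")
    case False
    then have "Z_norm a b w > 0" using Z.nrm_nonneg[OF w] by (simp add: Z_norm_eq w)
    then show ?thesis using le by (simp add: divide_simps mult_left_mono)
  qed simp
  finally show ?thesis by (simp add: power2_eq_square mult_ac)
qed


section \<open>The Lyapunov function\<close>

text \<open>
  For the symmetric form \<open>q(x, y) = \<langle>x, P y\<rangle>\<close>, the increment \<open>\<Delta> = U(r) - U(t)\<close> and its remainder
  \<open>\<rho> = \<Delta> - h U'\<close>, the increment of \<open>q(U, U)\<close> is exactly \<open>2 h q(U', U) + 2 q(\<rho>, U) + q(\<Delta>, \<Delta>)\<close>, and the
  last two terms are \<open>o(h)\<close> because \<open>q\<close> is bounded.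
\<close>

lemma (in semi_inner_space) quadratic_form_has_derivative:
  assumes P_in: "\<And>x. x \<in> V \<Longrightarrow> P x \<in> V"
    and sym: "\<And>x y. x \<in> V \<Longrightarrow> y \<in> V \<Longrightarrow> ip (P x) y = ip x (P y)"
    and bound: "0 \<le> C" "\<And>x. x \<in> V \<Longrightarrow> nrm (P x) \<le> C * nrm x"
    and U: "\<And>r. r \<in> T \<Longrightarrow> U r \<in> V" and t: "t \<in> T" and U': "U' \<in> V"
    and deriv: "((\<lambda>r. nrm (sub (sub (U r) (U t)) (scale (r - t) U')) / \<bar>r - t\<bar>) \<longlongrightarrow> 0) (at t within T)"
  shows "((\<lambda>r. ip (U r) (P (U r))) has_real_derivative 2 * ip U' (P (U t))) (at t within T)"
proof -
  define e where "e r = nrm (sub (sub (U r) (U t)) (scale (r - t) U')) / \<bar>r - t\<bar>" for r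
  define E where "E r = 2 * C * nrm (U t) * e r + C * \<bar>r - t\<bar> * (e r + nrm U')\<^sup>2" for r
  have q: "\<bar>ip x (P y)\<bar> \<le> C * nrm x * nrm y" if "x \<in> V" "y \<in> V" for x y
  proof -
    have "\<bar>ip x (P y)\<bar> \<le> nrm x * nrm (P y)" using that by (intro Cauchy_Schwarz P_in)
    also have "\<dots> \<le> nrm x * (C * nrm y)" using that by (intro mult_left_mono bound nrm_nonneg)
    finally show ?thesis by (simp add: mult_ac)
  qed
  have qs: "ip x (P y) = ip y (P x)" if "x \<in> V" "y \<in> V" for x y
    using that by (metis sym ip_commute P_in)
  have q_sub: "ip (sub x y) (P z) = ip x (P z) - ip y (P z)" if "x \<in> V" "y \<in> V" "z \<in> V" for x y z
    using that by (simp add: ip_sub_left P_in)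
  have "((\<lambda>r. (ip (U r) (P (U r)) - ip (U t) (P (U t))) / (r - t) - 2 * ip U' (P (U t))) \<longlongrightarrow> 0) (at t within T)"
  proof (rule Lim_null_comparison)
    have "(E \<longlongrightarrow> 2 * C * nrm (U t) * 0 + C * \<bar>t - t\<bar> * (0 + nrm U')\<^sup>2) (at t within T)"
      unfolding E_def[abs_def] using deriv[folded e_def] by (intro tendsto_intros)
    then show "(E \<longlongrightarrow> 0) (at t within T)" by simp
    show "\<forall>\<^sub>F r in at t within T. norm ((ip (U r) (P (U r)) - ip (U t) (P (U t))) / (r - t) - 2 * ip U' (P (U t))) \<le> E r"
      unfolding eventually_at_filter
    proof (intro always_eventually allI impI)
      fix r assume r: "r \<noteq> t" "r \<in> T"
      define \<Delta> where "\<Delta> = sub (U r) (U t)"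
      define \<rho> where "\<rho> = sub \<Delta> (scale (r - t) U')"
      have V: "U r \<in> V" "U t \<in> V" "\<Delta> \<in> V" "\<rho> \<in> V" "scale (r - t) U' \<in> V"
        using r t U U' by (auto simp: \<Delta>_def \<rho>_def intro!: sub_in scale_in)
      have n\<rho>: "nrm \<rho> = e r * \<bar>r - t\<bar>" using r by (simp add: e_def \<rho>_def \<Delta>_def)
      have "nrm \<Delta> = nrm (add \<rho> (scale (r - t) U'))"
        using V U' by (simp add: nrm_def \<rho>_def ip_sub_left ip_sub_right ip_add_left ip_add_right add_in sub_in)
      also have "\<dots> \<le> nrm \<rho> + nrm (scale (r - t) U')" by (intro nrm_triangle V)
      also have "\<dots> = \<bar>r - t\<bar> * (e r + nrm U')" by (simp add: n\<rho> nrm_scale U' algebra_simps)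
      finally have n\<Delta>: "nrm \<Delta> \<le> \<bar>r - t\<bar> * (e r + nrm U')" .
      have eq: "ip (U r) (P (U r)) - ip (U t) (P (U t)) - (r - t) * (2 * ip U' (P (U t)))
          = 2 * ip \<rho> (P (U t)) + ip \<Delta> (P \<Delta>)"
      proof -
        have "ip \<rho> (P (U t)) = ip (U r) (P (U t)) - ip (U t) (P (U t)) - (r - t) * ip U' (P (U t))"
          using V U' by (simp add: \<rho>_def \<Delta>_def q_sub sub_in ip_scale_left P_in)
        moreover have "ip \<Delta> (P \<Delta>) = ip (U r) (P \<Delta>) - ip (U t) (P \<Delta>)"
          using V by (simp add: \<Delta>_def q_sub)
        moreover have "ip (U r) (P \<Delta>) = ip (U r) (P (U r)) - ip (U t) (P (U r))"
          using V qs[of "U r" \<Delta>] by (simp add: \<Delta>_def q_sub)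
        moreover have "ip (U t) (P \<Delta>) = ip (U r) (P (U t)) - ip (U t) (P (U t))"
          using V qs[of "U t" \<Delta>] by (simp add: \<Delta>_def q_sub)
        moreover have "ip (U t) (P (U r)) = ip (U r) (P (U t))" using V by (intro qs)
        ultimately show ?thesis by (simp add: algebra_simps)
      qed
      have "\<bar>ip (U r) (P (U r)) - ip (U t) (P (U t)) - (r - t) * (2 * ip U' (P (U t)))\<bar>
          \<le> 2 * (C * nrm \<rho> * nrm (U t)) + C * nrm \<Delta> * nrm \<Delta>"
        unfolding eq using q[OF V(4,2)] q[OF V(3,3)] by linarith
      moreover have "C * nrm \<Delta> * nrm \<Delta> \<le> C * (\<bar>r - t\<bar> * (e r + nrm U'))\<^sup>2"
        using power_mono[OF n\<Delta> nrm_nonneg[OF V(3)], of 2] bound(1)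
        by (simp add: power2_eq_square mult.assoc mult_left_mono)
      moreover have "2 * (C * nrm \<rho> * nrm (U t)) + C * (\<bar>r - t\<bar> * (e r + nrm U'))\<^sup>2 = \<bar>r - t\<bar> * E r"
      proof -
        have "2 * (c * (x * h) * y) + c * (h * (x + z))\<^sup>2 = h * (2 * c * y * x + c * h * (x + z)\<^sup>2)" for c h x y z :: real
          by (simp add: power2_eq_square algebra_simps)
        then show ?thesis unfolding n\<rho> E_def .
      qed
      ultimately have "\<bar>ip (U r) (P (U r)) - ip (U t) (P (U t)) - (r - t) * (2 * ip U' (P (U t)))\<bar> \<le> \<bar>r - t\<bar> * E r"
        by linarith
      moreover have "(ip (U r) (P (U r)) - ip (U t) (P (U t))) / (r - t) - 2 * ip U' (P (U t))
          = (ip (U r) (P (U r)) - ip (U t) (P (U t)) - (r - t) * (2 * ip U' (P (U t)))) / (r - t)"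
        using r by (simp add: diff_divide_distrib)
      ultimately show "norm ((ip (U r) (P (U r)) - ip (U t) (P (U t))) / (r - t) - 2 * ip U' (P (U t))) \<le> E r"
        using r by (simp add: abs_divide pos_divide_le_eq mult.commute)
    qed
  qed
  from LIM_zero_cancel[OF this] show ?thesis
    unfolding has_field_derivative_iff .
qed

text \<open>
  The term of order zero of the Sobolev norm: by the fundamental lemma the chosen weak derivative of
  order zero equals \<open>f\<close> almost everywhere.
\<close>

lemma L2_norm_le_H2_norm:
  fixes f :: "real \<Rightarrow> real ^ 'n"
  assumes f: "continuous_on {a..b} f"
  shows "l2.nrm (leb {a..b}) f \<le> H2_norm a b f"
proof -
  have fl: "f \<in> l2 (leb {a..b})" by (rule l2_continuous[OF compact_Icc f])
  have "AE x in leb {a..b}. weak_deriv {a..b} [] f x = f x"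
    and wl: "weak_deriv {a..b} [] f \<in> l2 (leb {a..b})"
    using weak_deriv_l2(1,3)[of f a b "[]" f, folded interval_cbox] fl is_weak_deriv_Nil by blast+
  then have "l2.nrm (leb {a..b}) f = L2_norm {a..b} (weak_deriv {a..b} (replicate 0 1) f)"
    using l2_nrm_cong_AE[OF wl fl] by (simp add: L2_norm_leb)
  also have "\<dots> \<le> H2_norm a b f"
    unfolding H2_norm_def
    by (rule real_le_rsqrt, rule member_le_sum[of 0 "{..2}" "\<lambda>k. (L2_norm {a..b} (weak_deriv {a..b} (replicate k 1) f))\<^sup>2"]) auto
  finally show ?thesis .
qed

lemma L2_norm_le_H12_norm:
  fixes f :: "real \<times> real \<Rightarrow> real ^ 'n"
  assumes f: "continuous_on (rect a b) f"
  shows "l2.nrm (leb (rect a b)) f \<le> H12_norm a b f"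
proof -
  let ?S = "\<lambda>i j. (L2_norm (rect a b) (weak_deriv (rect a b) (replicate i (1, 0) @ replicate j (0, 1)) f))\<^sup>2"
  have fl: "f \<in> l2 (leb (rect a b))" by (rule l2_continuous[OF compact_rect f])
  have "AE x in leb (rect a b). weak_deriv (rect a b) [] f x = f x"
    and wl: "weak_deriv (rect a b) [] f \<in> l2 (leb (rect a b))"
    using weak_deriv_l2(1,3)[of f "(0, a)" "(1, b)" "[]" f, folded rect_cbox] fl is_weak_deriv_Nil by blast+
  then have "l2.nrm (leb (rect a b)) f = L2_norm (rect a b) (weak_deriv (rect a b) (replicate 0 (1, 0) @ replicate 0 (0, 1)) f)"
    using l2_nrm_cong_AE[OF wl fl] by (simp add: L2_norm_leb)
  also have "\<dots> \<le> H12_norm a b f"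
    unfolding H12_norm_def
  proof (rule real_le_rsqrt)
    have "?S 0 0 \<le> (\<Sum>j\<le>2. ?S 0 j)" by (rule member_le_sum) auto
    also have "\<dots> \<le> (\<Sum>i\<le>1. \<Sum>j\<le>2. ?S i j)"
      by (rule member_le_sum[of 0 "{..1}" "\<lambda>i. \<Sum>j\<le>2. ?S i j"]) (auto intro: sum_nonneg)
    finally show "?S 0 0 \<le> (\<Sum>i\<le>1. \<Sum>j\<le>2. ?S i j)" .
  qed
  finally show ?thesis .
qed

lemma Z_time_deriv:
  fixes u :: "real \<Rightarrow> real \<Rightarrow> real ^ 'n::finite"
  assumes u: "\<And>r. r \<ge> 0 \<Longrightarrow> continuous_on {a..b} (u r)" "continuous_on {a..b} u'"
    and \<phi>: "\<And>r. r \<ge> 0 \<Longrightarrow> continuous_on (rect a b) (\<phi> r)" "continuous_on (rect a b) \<phi>'"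
    and du: "has_time_deriv (H2_norm a b) u u' t" and d\<phi>: "has_time_deriv (H12_norm a b) \<phi> \<phi>' t" and t: "0 \<le> t"
  shows "((\<lambda>r. Z.nrm a b (Z.sub (Z.sub (u r, \<phi> r) (u t, \<phi> t)) (Z_scale (r - t) (u', \<phi>'))) / \<bar>r - t\<bar>) \<longlongrightarrow> 0) (at t within {0..})"
proof -
  let ?f = "\<lambda>r x. u r x - u t x - (r - t) *\<^sub>R u' x" and ?g = "\<lambda>r z. \<phi> r z - \<phi> t z - (r - t) *\<^sub>R \<phi>' z"
  show ?thesis
  proof (rule Lim_null_comparison)
    show "((\<lambda>r. H2_norm a b (?f r) / \<bar>r - t\<bar> + H12_norm a b (?g r) / \<bar>r - t\<bar>) \<longlongrightarrow> 0) (at t within {0..})"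
      using tendsto_add[OF du[unfolded has_time_deriv_def] d\<phi>[unfolded has_time_deriv_def]] by simp
    show "\<forall>\<^sub>F r in at t within {0..}. norm (Z.nrm a b (Z.sub (Z.sub (u r, \<phi> r) (u t, \<phi> t)) (Z_scale (r - t) (u', \<phi>'))) / \<bar>r - t\<bar>)
        \<le> H2_norm a b (?f r) / \<bar>r - t\<bar> + H12_norm a b (?g r) / \<bar>r - t\<bar>"
      unfolding eventually_at_filter
    proof (intro always_eventually allI impI)
      fix r :: real assume "r \<in> {0..}"
      then have r: "r \<ge> 0" by simp
      have c: "continuous_on {a..b} (?f r)" "continuous_on (rect a b) (?g r)"
        by (intro continuous_intros u \<phi> r t)+
      have eq: "Z.sub (Z.sub (u r, \<phi> r) (u t, \<phi> t)) (Z_scale (r - t) (u', \<phi>')) = (?f r, ?g r)"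
        by (simp add: Z_sub Z_scale_def)
      have Z: "(?f r, ?g r) \<in> Z_space a b"
        using l2_continuous[OF compact_Icc c(1)] l2_continuous[OF compact_rect c(2)] by (simp add: Z_space_l2)
      have "Z.nrm a b (?f r, ?g r) \<le> H2_norm a b (?f r) + H12_norm a b (?g r)"
        using Z_nrm_le[OF Z] L2_norm_le_H2_norm[OF c(1)] L2_norm_le_H12_norm[OF c(2)] by simp
      then show "norm (Z.nrm a b (Z.sub (Z.sub (u r, \<phi> r) (u t, \<phi> t)) (Z_scale (r - t) (u', \<phi>'))) / \<bar>r - t\<bar>)
          \<le> H2_norm a b (?f r) / \<bar>r - t\<bar> + H12_norm a b (?g r) / \<bar>r - t\<bar>"
        unfolding eq using Z.nrm_nonneg[OF Z] by (simp add: divide_right_mono flip: add_divide_distrib)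
    qed
  qed
qed

text \<open>
  Gronwall's inequality: \<open>V(t) e\<^sup>c\<^sup>t\<close> does not increase.
\<close>

lemma exponential_decay:
  fixes V :: "real \<Rightarrow> real"
  assumes deriv: "\<And>t. t \<ge> 0 \<Longrightarrow> \<exists>d. (V has_real_derivative d) (at t within {0..}) \<and> d \<le> - c * V t"
    and t: "0 \<le> t"
  shows "V t \<le> V 0 * exp (- c * t)"
proof (cases "t = 0")
  case False
  then have t0: "0 < t" using t by simp
  let ?W = "\<lambda>t. V t * exp (c * t)"
  have d: "\<exists>d. (?W has_real_derivative d) (at s within {0..}) \<and> d \<le> 0" if s: "s \<ge> 0" for s
  proof -
    obtain d where d: "(V has_real_derivative d) (at s within {0..})" "d \<le> - c * V s"
      using deriv[OF s] by blast
    have "(?W has_real_derivative d * exp (c * s) + V s * (exp (c * s) * c)) (at s within {0..})"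
      by (auto intro!: derivative_eq_intros d)
    moreover have "d * exp (c * s) + V s * (exp (c * s) * c) = (d + c * V s) * exp (c * s)"
      by (simp add: algebra_simps)
    moreover have "(d + c * V s) * exp (c * s) \<le> 0"
      using d(2) by (intro mult_nonpos_nonneg) auto
    ultimately show ?thesis by metis
  qed
  have "?W t \<le> ?W 0"
  proof (rule DERIV_nonpos_imp_decreasing_open[OF t])
    fix s assume "0 < s" "s < t"
    then have "at s within {0..} = at s" by (intro at_within_interior) simp
    then show "\<exists>y. (?W has_real_derivative y) (at s) \<and> y \<le> 0" using d[of s] \<open>0 < s\<close> by simp
  next
    show "continuous_on {0..t} ?W"
    proof (rule continuous_on_subset)
      show "continuous_on {0..} ?W"
        unfolding continuous_on_eq_continuous_within using d DERIV_continuous by fastforce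
    qed auto
  qed
  then show ?thesis by (simp add: exp_minus field_simps)
qed simp

theorem corollary12:
  fixes a b \<tau> \<epsilon> \<alpha> \<zeta> t :: real
    and A Ad :: "real \<Rightarrow> real ^ ('n + 'n + 'n) ^ 'n::finite"
    and B :: "real ^ ('n + 'n + 'n + 'n) ^ ('n + 'n)"
    and P \<T> \<A> :: "'n Z \<Rightarrow> 'n Z"
    and u0 :: "real \<Rightarrow> real ^ 'n" and \<phi>0 :: "real \<times> real \<Rightarrow> real ^ 'n"
    and u :: "real \<Rightarrow> real \<Rightarrow> real ^ 'n" and \<phi> :: "real \<Rightarrow> real \<times> real \<Rightarrow> real ^ 'n"
  defines "\<T> \<equiv> opT a b B"
    and "\<A> \<equiv> opA a b A Ad B \<tau>"
    and "\<zeta> \<equiv> sqrt (Z_opnorm a b P)"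
  assumes "a < b" and "0 < \<tau>"
    and "A \<in> Linf_space {a..b}" and "Ad \<in> Linf_space {a..b}"
    and "invertible (B ** H_mat a b)"
    and "0 < \<epsilon>" and "0 < \<alpha>"
    and "PI_operator a b P"
    and "is_adjoint a b P P"
    and "op_le a b (\<lambda>w. Z_scale (\<epsilon>\<^sup>2) w) P"
    and "op_le a b
           (\<lambda>w. Z_add (Z_adjoint a b \<A> (P (\<T> w))) (Z_adjoint a b \<T> (P (\<A> w))))
           (\<lambda>w. Z_scale (- 2 * \<alpha>) (Z_adjoint a b \<T> (P (\<T> w))))"
    and "DPDE_solution a b A Ad B \<tau> u0 \<phi>0 u \<phi>"
    and "0 \<le> t"
  shows "Z_norm a b (u t, \<phi> t) \<le> \<zeta> / \<epsilon> * Z_norm a b (u 0, \<phi> 0) * exp (- \<alpha> * t)"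
proof -
  note P = \<open>is_adjoint a b P P\<close> and lyap = \<open>op_le a b (\<lambda>w. Z_add _ _) _\<close>
  have adjT: "is_adjoint a b \<T> (Z_adjoint a b \<T>)"
    unfolding Z_adjoint_def \<T>_def by (rule someI_ex[OF ex_adjoint_opT])
  have adjA: "is_adjoint a b \<A> (Z_adjoint a b \<A>)"
    unfolding Z_adjoint_def \<A>_def by (rule someI_ex[OF ex_adjoint_opA]) fact+
  have P_in: "P w \<in> Z_space a b" if "w \<in> Z_space a b" for w using P that by (auto simp: is_adjoint_def)
  have T_in: "\<T> w \<in> Z_space a b" "Z_adjoint a b \<T> w \<in> Z_space a b" if "w \<in> Z_space a b" for w
    using adjT that by (auto simp: is_adjoint_def)
  have A_in: "\<A> w \<in> Z_space a b" "Z_adjoint a b \<A> w \<in> Z_space a b" if "w \<in> Z_space a b" for w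
    using adjA that by (auto simp: is_adjoint_def)
  have P_sym: "Z_inner a b (P w) z = Z_inner a b w (P z)" if "w \<in> Z_space a b" "z \<in> Z_space a b" for w z
    using P that by (auto simp: is_adjoint_def)
  have T_ip: "Z_inner a b w (Z_adjoint a b \<T> z) = Z_inner a b (\<T> w) z" if "w \<in> Z_space a b" "z \<in> Z_space a b" for w z
    using adjT that by (auto simp: is_adjoint_def)
  have A_ip: "Z_inner a b w (Z_adjoint a b \<A> z) = Z_inner a b (\<A> w) z" if "w \<in> Z_space a b" "z \<in> Z_space a b" for w z
    using adjA that by (auto simp: is_adjoint_def)
  obtain C where C: "0 \<le> C" "\<And>w. w \<in> Z_space a b \<Longrightarrow> Z.nrm a b (P w) \<le> C * Z.nrm a b w"
    using selfadjoint_bounded[OF P] by blast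
  let ?U = "\<lambda>r. (u r, \<phi> r)"
  let ?V = "\<lambda>r. Z_inner a b (?U r) (P (?U r))"
  note sol = \<open>DPDE_solution a b A Ad B \<tau> u0 \<phi>0 u \<phi>\<close>[unfolded DPDE_solution_def]
  have X: "u r \<in> X_space a b B" and Y: "\<phi> r \<in> Y_space a b B (u r)" if "r \<ge> 0" for r
    using sol that by auto
  have uc: "continuous_on {a..b} (u r)" if "r \<ge> 0" for r
    using X[OF that] by (simp add: X_space_def H2_space_def)
  have \<phi>c: "continuous_on (rect a b) (\<phi> r)" if "r \<ge> 0" for r
    using Y[OF that] by (simp add: Y_space_def H12_space_def)
  have U: "?U r \<in> Z_space a b" if "r \<ge> 0" for r
    using l2_continuous[OF compact_Icc uc[OF that]] l2_continuous[OF compact_rect \<phi>c[OF that]] by (simp add: Z_space_l2)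
  have decay: "\<exists>d. (?V has_real_derivative d) (at r within {0..}) \<and> d \<le> - (2 * \<alpha>) * ?V r" if r: "r \<ge> 0" for r
  proof -
    obtain u' \<phi>' where u': "u' \<in> H2_space a b" "has_time_deriv (H2_norm a b) u u' r"
      and \<phi>': "\<phi>' \<in> H12_space a b" "has_time_deriv (H12_norm a b) \<phi> \<phi>' r"
      and pde: "AE x\<in>{a..b} in lborel. u' x = A x *v jet a b (u r) x + Ad x *v jet a b (\<lambda>y. \<phi> r (1, y)) x"
        "AE z\<in>rect a b in lborel. \<phi>' z = - (1 / \<tau>) *\<^sub>R weak_deriv (rect a b) [(1, 0)] (\<phi> r) z"
      using sol r by blast
    have c': "continuous_on {a..b} u'" "continuous_on (rect a b) \<phi>'"
      using u' \<phi>' by (auto simp: H2_space_def H12_space_def)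
    have U': "(u', \<phi>') \<in> Z_space a b"
      using l2_continuous[OF compact_Icc c'(1)] l2_continuous[OF compact_rect c'(2)] by (simp add: Z_space_l2)
    have d: "(?V has_real_derivative 2 * Z_inner a b (u', \<phi>') (P (?U r))) (at r within {0..})"
    proof (rule Z.quadratic_form_has_derivative[OF P_in P_sym C])
      show "((\<lambda>s. Z.nrm a b (Z.sub (Z.sub (u s, \<phi> s) (u r, \<phi> r)) (Z_scale (s - r) (u', \<phi>'))) / \<bar>s - r\<bar>) \<longlongrightarrow> 0) (at r within {0..})"
        by (rule Z_time_deriv[where t=r, OF uc c'(1) \<phi>c c'(2) u'(2) \<phi>'(2) r])
    qed (use U U' r in auto)
    obtain w where w: "w \<in> Z_space a b" and wT: "Z_eq a b (?U r) (\<T> w)"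
      and wA: "Z_eq a b (\<lambda>x. A x *v jet a b (u r) x + Ad x *v jet a b (\<lambda>y. \<phi> r (1, y)) x,
        \<lambda>z. - (1 / \<tau>) *\<^sub>R weak_deriv (rect a b) [(1, 0)] (\<phi> r) z) (\<A> w)"
      using state_representation[OF \<open>a < b\<close> \<open>invertible (B ** H_mat a b)\<close> \<open>A \<in> Linf_space {a..b}\<close> \<open>Ad \<in> Linf_space {a..b}\<close> X[OF r] Y[OF r]]
      unfolding \<T>_def \<A>_def by blast
    have wU': "Z_eq a b (u', \<phi>') (\<A> w)"
      using wA pde unfolding Z_eq_def by (auto elim!: eventually_elim2)
    \<comment> \<open>\<open>P\<close> acts on functions, while \<open>U\<close> and \<open>\<T> w\<close> agree only almost everywhere; before a function is
      replaced by an equal one, symmetry moves \<open>P\<close> to the other argument.\<close>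
    have "Z_inner a b (u', \<phi>') (P (?U r)) = Z_inner a b (\<A> w) (P (?U r))"
      by (rule Z_inner_cong[OF U' A_in(1)[OF w] P_in[OF U[OF r]] wU'])
    also have "\<dots> = Z_inner a b (?U r) (P (\<A> w))"
      using P_sym[OF A_in(1)[OF w] U[OF r]] Z.ip_commute[OF P_in[OF A_in(1)[OF w]] U[OF r]] by simp
    also have "\<dots> = Z_inner a b (\<T> w) (P (\<A> w))"
      by (rule Z_inner_cong[OF U[OF r] T_in(1)[OF w] P_in[OF A_in(1)[OF w]] wT])
    finally have 1: "Z_inner a b (u', \<phi>') (P (?U r)) = Z_inner a b (\<T> w) (P (\<A> w))" .
    have "?V r = Z_inner a b (\<T> w) (P (?U r))"
      by (rule Z_inner_cong[OF U[OF r] T_in(1)[OF w] P_in[OF U[OF r]] wT])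
    also have "\<dots> = Z_inner a b (?U r) (P (\<T> w))"
      using P_sym[OF T_in(1)[OF w] U[OF r]] Z.ip_commute[OF P_in[OF T_in(1)[OF w]] U[OF r]] by simp
    also have "\<dots> = Z_inner a b (\<T> w) (P (\<T> w))"
      by (rule Z_inner_cong[OF U[OF r] T_in(1)[OF w] P_in[OF T_in(1)[OF w]] wT])
    finally have 2: "?V r = Z_inner a b (\<T> w) (P (\<T> w))" .
    have 3: "Z_inner a b (\<A> w) (P (\<T> w)) = Z_inner a b (\<T> w) (P (\<A> w))"
      using P_sym[OF A_in(1)[OF w] T_in(1)[OF w]] Z.ip_commute[OF P_in[OF A_in(1)[OF w]] T_in(1)[OF w]] by simp
    have "Z_inner a b w (Z_add (Z_adjoint a b \<A> (P (\<T> w))) (Z_adjoint a b \<T> (P (\<A> w))))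
        \<le> Z_inner a b w (Z_scale (- 2 * \<alpha>) (Z_adjoint a b \<T> (P (\<T> w))))"
      using lyap w by (auto simp: op_le_def)
    then have "2 * Z_inner a b (\<T> w) (P (\<A> w)) \<le> - 2 * \<alpha> * Z_inner a b (\<T> w) (P (\<T> w))"
      using w by (simp add: Z.ip_add_right Z.ip_scale_right A_in T_in P_in A_ip T_ip 3)
    then show ?thesis using d 1 2 by (intro exI[of _ "2 * Z_inner a b (u', \<phi>') (P (?U r))"]) simp
  qed
  have "\<epsilon>\<^sup>2 * (Z_norm a b (?U t))\<^sup>2 \<le> ?V t"
  proof -
    have "Z_inner a b (?U t) (Z_scale (\<epsilon>\<^sup>2) (?U t)) \<le> ?V t"
      using \<open>op_le a b (\<lambda>w. Z_scale (\<epsilon>\<^sup>2) w) P\<close> U[OF \<open>0 \<le> t\<close>] by (auto simp: op_le_def)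
    then show ?thesis
      using U[OF \<open>0 \<le> t\<close>] by (simp add: Z.ip_scale_right Z_norm_eq Z.nrm_power2)
  qed
  also have "?V t \<le> ?V 0 * exp (- (2 * \<alpha>) * t)"
    by (rule exponential_decay[OF decay \<open>0 \<le> t\<close>])
  also have "\<dots> \<le> Z_opnorm a b P * (Z_norm a b (?U 0))\<^sup>2 * exp (- (2 * \<alpha>) * t)"
    by (intro mult_right_mono Z_opnorm_bound P U) simp_all
  finally have "sqrt (\<epsilon>\<^sup>2 * (Z_norm a b (?U t))\<^sup>2) \<le> sqrt (Z_opnorm a b P * (Z_norm a b (?U 0))\<^sup>2 * exp (- (2 * \<alpha>) * t))"
    by (rule real_sqrt_le_mono)
  moreover have "Z_norm a b (?U r) \<ge> 0" if "r \<ge> 0" for r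
    using Z.nrm_nonneg[OF U[OF that]] by (simp add: Z_norm_eq U that)
  moreover have "exp (- (2 * \<alpha>) * t) = (exp (- \<alpha> * t))\<^sup>2"
    by (simp add: exp_double[symmetric])
  ultimately have "\<epsilon> * Z_norm a b (?U t) \<le> \<zeta> * Z_norm a b (?U 0) * exp (- \<alpha> * t)"
    using \<open>0 < \<epsilon>\<close> \<open>0 \<le> t\<close> by (simp add: real_sqrt_mult \<zeta>_def)
  then show ?thesis
    using \<open>0 < \<epsilon>\<close> by (simp add: field_simps)
qed

end
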